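(* In the setting described in the context, let $\mathbf{L}$ be the exact lower triangular Cholesky factor of $\Theta\in\mathbb{R}^{I\times I}$, with $I$ ordered from coarse to fine levels. Then, denoting by $\|\cdot\|$ the matrix $2$-norm, for $1\le k\le N=|I|$, $$\left\|\Theta-\mathbf{L}_{:,1:k}\left(\mathbf{L}_{:,1:k}\right)^\top\right\|\le C\,\|\Theta\|\,k^{-2s/d},$$ with the constant $C$ depending only on $\|\mathcal{L}\|$, $\|\mathcal{L}^{-1}\|$, $d$, $h$, $\delta$ and $s$. This is, up to a constant, the optimal rate of decay of any low-rank approximation.
   Context: Setting. $\Omega\subset\mathbb{R}^d$ is a bounded Lipschitz domain of diameter one, $s\ge1$ is an integer, and $\mathcal{L}:H_0^s(\Omega)\to H^{-s}(\Omega)$ is linear, bounded, invertible, self-adjoint, positive, and local, meaning $\int_\Omega u\,\mathcal{L}v\,\mathrm{d}x=0$ whenever $u,v\in H_0^s(\Omega)$ have disjoint supports. $\|\mathcal{L}\|$ and $\|\mathcal{L}^{-1}\|$ are operator norms between $H_0^s(\Omega)$ and $H^{-s}(\Omega)$. Fix $h,\delta\in(0,1)$ and an integer $q\ge1$. For $1\le k\le q$, $\tau^{(k)}$ is a partition of $\Omega$ into convex, uniformly Lipschitz sets, each contained in a ball of radius $h^k$ and containing a ball of radius $\delta h^k$. The partitions are nested: each element of $\tau^{(k)}$ is a union of elements of $\tau^{(k+1)}$. Set $\tau^{(0)}=\{\Omega\}$. Multiresolution basis. $V^{(k)}$ is the space of functions on $\Omega$ that are constant on each element of $\tau^{(k)}$,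 with the convention $V^{(0)}=\{0\}$. $W^{(k)}$ is the $L^2$-orthogonal complement of $V^{(k-1)}$ in $V^{(k)}$. $\{w_i\}_{i\in I^{(k)}}$ is an $L^2$-orthonormal basis of $W^{(k)}$ such that the support of each $w_i$ is contained in the closure of a single element of $\tau^{(k-1)}$. $I=\bigcup_{1\le k\le q}I^{(k)}$ (disjoint), $N=|I|$, and $\Theta_{ij}=\langle w_i,\mathcal{L}^{-1}w_j\rangle_{L^2}$ for $i,j\in I$. An ordering from coarse to fine is a total order on $I$ in which all elements of $I^{(k)}$ precede all elements of $I^{(l)}$ whenever $k<l$. $\mathbf{L}_{:,1:k}$ denotes the first $k$ columns of $\mathbf{L}$ in this ordering, and $\Theta=\mathbf{L}\mathbf{L}^\top$. (This exact factor is what one obtains from sparse Cholesky recovery procedures for $\Theta$ when their truncation radius $\rho$ is set to $\infty$, i.e. when no sparsification is applied.) *)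

theory Defs
  imports
    "HOL-Analysis.Analysis"
    "HOL-Library.Disjoint_Sets"
    "Jordan_Normal_Form.Matrix"
    "Jordan_Normal_Form.DL_Rank"
begin

section \<open>Lipschitz boundaries\<close>

text \<open>
  Near each boundary point, the set is the region above the graph of an \<open>M\<close>-Lipschitz function
  in some direction \<open>e\<close>; \<open>x - (x \<cdot> e) e\<close> is the projection of \<open>x\<close> to the hyperplane orthogonal
  to \<open>e\<close>. Whether the graph itself belongs to the set is left open, so that the notion applies to
  domains and to the cells of a set-theoretic partition (which need be neither open nor closed);
  for an open set the graph is automatically excluded.
\<close>

definition lipschitz_boundary :: "real \<Rightarrow> (real^'n) set \<Rightarrow> bool" where
  "lipschitz_boundary M S \<longleftrightarrow>
     (\<forall>p\<in>frontier S. \<exists>r>0. \<exists>e \<gamma>. norm e = 1 \<and> M-lipschitz_on UNIV \<gamma> \<and>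
        (\<forall>x\<in>ball p r.
           (\<gamma> (x - inner x e *\<^sub>R e) < inner x e \<longrightarrow> x \<in> S) \<and>
           (inner x e < \<gamma> (x - inner x e *\<^sub>R e) \<longrightarrow> x \<notin> S)))"

definition bounded_lipschitz_domain :: "(real^'n) set \<Rightarrow> bool" where
  "bounded_lipschitz_domain \<Omega> \<longleftrightarrow>
     open \<Omega> \<and> connected \<Omega> \<and> \<Omega> \<noteq> {} \<and> bounded \<Omega> \<and> (\<exists>M. lipschitz_boundary M \<Omega>)"

section \<open>Square-integrable functions and Sobolev spaces\<close>

text \<open>
  Functions on \<open>\<Omega>\<close> are represented by functions on the whole space; only the values on \<open>\<Omega>\<close> matter.
  Elements of the function spaces are representatives of classes modulo equality almost everywhere.
\<close>

definition square_integrable :: "(real^'n) set \<Rightarrow> (real^'n \<Rightarrow> real) \<Rightarrow> bool" where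
  "square_integrable \<Omega> u \<longleftrightarrow>
     u \<in> borel_measurable (lebesgue_on \<Omega>) \<and> integrable (lebesgue_on \<Omega>) (\<lambda>x. (u x)\<^sup>2)"

definition l2_inner :: "(real^'n) set \<Rightarrow> (real^'n \<Rightarrow> real) \<Rightarrow> (real^'n \<Rightarrow> real) \<Rightarrow> real" where
  "l2_inner \<Omega> u v = (LINT x|lebesgue_on \<Omega>. u x * v x)"

text \<open>Classical iterated partial derivatives; a list of coordinate directions serves as index.\<close>

fun iter_partial :: "'n list \<Rightarrow> (real^'n \<Rightarrow> real) \<Rightarrow> (real^'n \<Rightarrow> real)" where
  "iter_partial [] f = f"
| "iter_partial (i # is) f =
     (\<lambda>x. frechet_derivative (iter_partial is f) (at x) (axis i 1))"

definition smooth_function :: "(real^'n \<Rightarrow> real) \<Rightarrow> bool" where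
  "smooth_function f \<longleftrightarrow> (\<forall>is x. iter_partial is f differentiable (at x))"

definition test_function :: "(real^'n) set \<Rightarrow> (real^'n \<Rightarrow> real) \<Rightarrow> bool" where
  "test_function \<Omega> \<phi> \<longleftrightarrow>
     smooth_function \<phi> \<and> (\<exists>K. compact K \<and> K \<subseteq> \<Omega> \<and> (\<forall>x. x \<notin> K \<longrightarrow> \<phi> x = 0))"

definition is_weak_deriv ::
    "(real^'n) set \<Rightarrow> 'n list \<Rightarrow> (real^'n \<Rightarrow> real) \<Rightarrow> (real^'n \<Rightarrow> real) \<Rightarrow> bool" where
  "is_weak_deriv \<Omega> is u g \<longleftrightarrow>
     (\<forall>\<phi>. test_function \<Omega> \<phi> \<longrightarrow>
        l2_inner \<Omega> u (iter_partial is \<phi>) = (-1) ^ length is * l2_inner \<Omega> g \<phi>)"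

text \<open>A representative of the weak derivative, which is unique almost everywhere if it exists.\<close>

definition weak_deriv :: "(real^'n) set \<Rightarrow> 'n list \<Rightarrow> (real^'n \<Rightarrow> real) \<Rightarrow> (real^'n \<Rightarrow> real)" where
  "weak_deriv \<Omega> is u = (SOME g. square_integrable \<Omega> g \<and> is_weak_deriv \<Omega> is u g)"

definition sobolev :: "(real^'n) set \<Rightarrow> nat \<Rightarrow> (real^'n \<Rightarrow> real) set" where
  "sobolev \<Omega> s = {u. square_integrable \<Omega> u \<and>
     (\<forall>is. length is \<le> s \<longrightarrow> (\<exists>g. square_integrable \<Omega> g \<and> is_weak_deriv \<Omega> is u g))}"

text \<open>
  The sum over lists of length \<open>j\<close> is the squared \<open>L\<^sup>2\<close>-norm of the full derivative tensor of
  order \<open>j\<close> (Frobenius norm). So every multi-index occurs with its multinomial multiplicity.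
\<close>

definition sobolev_norm :: "(real^'n) set \<Rightarrow> nat \<Rightarrow> (real^'n \<Rightarrow> real) \<Rightarrow> real" where
  "sobolev_norm \<Omega> s u =
     sqrt (\<Sum>is | length is \<le> s. l2_inner \<Omega> (weak_deriv \<Omega> is u) (weak_deriv \<Omega> is u))"

definition sobolev0 :: "(real^'n) set \<Rightarrow> nat \<Rightarrow> (real^'n \<Rightarrow> real) set" where
  "sobolev0 \<Omega> s = {u \<in> sobolev \<Omega> s.
     \<exists>\<phi> :: nat \<Rightarrow> real^'n \<Rightarrow> real. (\<forall>n. test_function \<Omega> (\<phi> n)) \<and>
        (\<lambda>n. sobolev_norm \<Omega> s (\<lambda>x. \<phi> n x - u x)) \<longlonglongrightarrow> 0}"

text \<open>
  \<open>H\<^sup>-\<^sup>s\<close> as the dual of \<open>H\<^sub>0\<^sup>s\<close>. Functionals are HOL functions of which only the values on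
  \<open>H\<^sub>0\<^sup>s\<close> are relevant; boundedness makes them respect equality almost everywhere. The pairing
  written as the integral of \<open>u F\<close> over \<open>\<Omega>\<close> is the value \<open>F u\<close>.
\<close>

definition sobolev_dual :: "(real^'n) set \<Rightarrow> nat \<Rightarrow> ((real^'n \<Rightarrow> real) \<Rightarrow> real) set" where
  "sobolev_dual \<Omega> s = {F.
     (\<forall>u\<in>sobolev0 \<Omega> s. \<forall>v\<in>sobolev0 \<Omega> s. \<forall>a b.
        F (\<lambda>x. a * u x + b * v x) = a * F u + b * F v) \<and>
     (\<exists>B. \<forall>u\<in>sobolev0 \<Omega> s. \<bar>F u\<bar> \<le> B * sobolev_norm \<Omega> s u)}"

definition dual_norm :: "(real^'n) set \<Rightarrow> nat \<Rightarrow> ((real^'n \<Rightarrow> real) \<Rightarrow> real) \<Rightarrow> real" where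
  "dual_norm \<Omega> s F = (SUP u\<in>{u \<in> sobolev0 \<Omega> s. sobolev_norm \<Omega> s u \<le> 1}. \<bar>F u\<bar>)"

definition ess_support :: "(real^'n) set \<Rightarrow> (real^'n \<Rightarrow> real) \<Rightarrow> (real^'n) set" where
  "ess_support \<Omega> u = {x. \<forall>r>0. \<not> (AE y in lebesgue_on (\<Omega> \<inter> ball x r). u y = 0)}"

section \<open>The operator\<close>

text \<open>
  An operator from \<open>H\<^sub>0\<^sup>s\<close> to \<open>H\<^sup>-\<^sup>s\<close> maps a function to a functional, and \<open>\<L> u v\<close> stands for the
  integral of \<open>v \<L> u\<close>.
\<close>

type_synonym 'n sobolev_op = "(real^'n \<Rightarrow> real) \<Rightarrow> (real^'n \<Rightarrow> real) \<Rightarrow> real"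

definition linear_op :: "(real^'n) set \<Rightarrow> nat \<Rightarrow> 'n sobolev_op \<Rightarrow> bool" where
  "linear_op \<Omega> s \<L> \<longleftrightarrow>
     (\<forall>u\<in>sobolev0 \<Omega> s. \<L> u \<in> sobolev_dual \<Omega> s) \<and>
     (\<forall>u\<in>sobolev0 \<Omega> s. \<forall>v\<in>sobolev0 \<Omega> s. \<forall>w\<in>sobolev0 \<Omega> s. \<forall>a b.
        \<L> (\<lambda>x. a * u x + b * v x) w = a * \<L> u w + b * \<L> v w)"

definition bounded_op :: "(real^'n) set \<Rightarrow> nat \<Rightarrow> 'n sobolev_op \<Rightarrow> bool" where
  "bounded_op \<Omega> s \<L> \<longleftrightarrow>
     (\<exists>B. \<forall>u\<in>sobolev0 \<Omega> s. dual_norm \<Omega> s (\<L> u) \<le> B * sobolev_norm \<Omega> s u)"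

text \<open>Bijective (modulo equality almost everywhere) with bounded inverse.\<close>

definition invertible_op :: "(real^'n) set \<Rightarrow> nat \<Rightarrow> 'n sobolev_op \<Rightarrow> bool" where
  "invertible_op \<Omega> s \<L> \<longleftrightarrow>
     (\<forall>u\<in>sobolev0 \<Omega> s. (\<forall>v\<in>sobolev0 \<Omega> s. \<L> u v = 0) \<longrightarrow> (AE x in lebesgue_on \<Omega>. u x = 0)) \<and>
     (\<forall>F\<in>sobolev_dual \<Omega> s. \<exists>u\<in>sobolev0 \<Omega> s. \<forall>v\<in>sobolev0 \<Omega> s. \<L> u v = F v) \<and>
     (\<exists>B. \<forall>u\<in>sobolev0 \<Omega> s. sobolev_norm \<Omega> s u \<le> B * dual_norm \<Omega> s (\<L> u))"

definition self_adjoint_op :: "(real^'n) set \<Rightarrow> nat \<Rightarrow> 'n sobolev_op \<Rightarrow> bool" where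
  "self_adjoint_op \<Omega> s \<L> \<longleftrightarrow> (\<forall>u\<in>sobolev0 \<Omega> s. \<forall>v\<in>sobolev0 \<Omega> s. \<L> u v = \<L> v u)"

definition positive_op :: "(real^'n) set \<Rightarrow> nat \<Rightarrow> 'n sobolev_op \<Rightarrow> bool" where
  "positive_op \<Omega> s \<L> \<longleftrightarrow> (\<forall>u\<in>sobolev0 \<Omega> s. 0 \<le> \<L> u u)"

definition local_op :: "(real^'n) set \<Rightarrow> nat \<Rightarrow> 'n sobolev_op \<Rightarrow> bool" where
  "local_op \<Omega> s \<L> \<longleftrightarrow>
     (\<forall>u\<in>sobolev0 \<Omega> s. \<forall>v\<in>sobolev0 \<Omega> s.
        ess_support \<Omega> u \<inter> ess_support \<Omega> v = {} \<longrightarrow> \<L> v u = 0)"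

definition admissible_op :: "(real^'n) set \<Rightarrow> nat \<Rightarrow> 'n sobolev_op \<Rightarrow> bool" where
  "admissible_op \<Omega> s \<L> \<longleftrightarrow>
     linear_op \<Omega> s \<L> \<and> bounded_op \<Omega> s \<L> \<and> invertible_op \<Omega> s \<L> \<and>
     self_adjoint_op \<Omega> s \<L> \<and> positive_op \<Omega> s \<L> \<and> local_op \<Omega> s \<L>"

text \<open>A representative of the preimage, which is unique almost everywhere.\<close>

definition inverse_op ::
    "(real^'n) set \<Rightarrow> nat \<Rightarrow> 'n sobolev_op \<Rightarrow> ((real^'n \<Rightarrow> real) \<Rightarrow> real) \<Rightarrow> (real^'n \<Rightarrow> real)" where
  "inverse_op \<Omega> s \<L> F =
     (SOME u. u \<in> sobolev0 \<Omega> s \<and> (\<forall>v\<in>sobolev0 \<Omega> s. \<L> u v = F v))"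

definition op_norm :: "(real^'n) set \<Rightarrow> nat \<Rightarrow> 'n sobolev_op \<Rightarrow> real" where
  "op_norm \<Omega> s \<L> =
     (SUP u\<in>{u \<in> sobolev0 \<Omega> s. sobolev_norm \<Omega> s u \<le> 1}. dual_norm \<Omega> s (\<L> u))"

definition inverse_op_norm :: "(real^'n) set \<Rightarrow> nat \<Rightarrow> 'n sobolev_op \<Rightarrow> real" where
  "inverse_op_norm \<Omega> s \<L> =
     (SUP F\<in>{F \<in> sobolev_dual \<Omega> s. dual_norm \<Omega> s F \<le> 1}. sobolev_norm \<Omega> s (inverse_op \<Omega> s \<L> F))"

section \<open>Nested partitions and the multiresolution basis\<close>

definition nested_partitions ::
    "(real^'n) set \<Rightarrow> real \<Rightarrow> real \<Rightarrow> nat \<Rightarrow> (nat \<Rightarrow> (real^'n) set set) \<Rightarrow> bool" where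
  "nested_partitions \<Omega> h \<delta> q \<tau> \<longleftrightarrow>
     \<tau> 0 = {\<Omega>} \<and>
     (\<forall>k\<in>{1..q}. partition_on \<Omega> (\<tau> k)) \<and>
     (\<forall>k\<in>{1..q}. \<forall>T\<in>\<tau> k. convex T \<and>
        (\<exists>y. T \<subseteq> cball y (h ^ k)) \<and> (\<exists>y. ball y (\<delta> * h ^ k) \<subseteq> T)) \<and>
     (\<exists>M. \<forall>k\<in>{1..q}. \<forall>T\<in>\<tau> k. lipschitz_boundary M T) \<and>
     (\<forall>k\<in>{1..<q}. \<forall>T\<in>\<tau> k. \<exists>U\<subseteq>\<tau> (Suc k). T = \<Union>U)"

definition V_space ::
    "(real^'n) set \<Rightarrow> (nat \<Rightarrow> (real^'n) set set) \<Rightarrow> nat \<Rightarrow> (real^'n \<Rightarrow> real) set" where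
  "V_space \<Omega> \<tau> k =
     (if k = 0 then {f. \<forall>x\<in>\<Omega>. f x = 0} else {f. \<forall>T\<in>\<tau> k. f constant_on T})"

definition W_space ::
    "(real^'n) set \<Rightarrow> (nat \<Rightarrow> (real^'n) set set) \<Rightarrow> nat \<Rightarrow> (real^'n \<Rightarrow> real) set" where
  "W_space \<Omega> \<tau> k =
     {f \<in> V_space \<Omega> \<tau> k. \<forall>g\<in>V_space \<Omega> \<tau> (k - 1). l2_inner \<Omega> f g = 0}"

text \<open>
  The index set \<open>I\<close> with its total order is identified with \<open>{..<N}\<close>, where \<open>lev i\<close> is the level
  of \<open>i\<close>, so that \<open>I\<^sup>(\<^sup>k\<^sup>)\<close> is \<open>{i. i < N \<and> lev i = k}\<close>; the order is from coarse to fine iff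
  \<open>lev\<close> is monotone.
\<close>

definition coarse_to_fine :: "nat \<Rightarrow> nat \<Rightarrow> (nat \<Rightarrow> nat) \<Rightarrow> bool" where
  "coarse_to_fine q N lev \<longleftrightarrow> (\<forall>i<N. lev i \<in> {1..q}) \<and> mono_on {..<N} lev"

definition multiresolution_basis ::
    "(real^'n) set \<Rightarrow> nat \<Rightarrow> (nat \<Rightarrow> (real^'n) set set) \<Rightarrow> nat \<Rightarrow> (nat \<Rightarrow> nat) \<Rightarrow>
     (nat \<Rightarrow> real^'n \<Rightarrow> real) \<Rightarrow> bool" where
  "multiresolution_basis \<Omega> q \<tau> N lev w \<longleftrightarrow>
     (\<forall>k\<in>{1..q}. let J = {i. i < N \<and> lev i = k} in
        (\<forall>i\<in>J. w i \<in> W_space \<Omega> \<tau> k) \<and>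
        (\<forall>i\<in>J. \<forall>j\<in>J. l2_inner \<Omega> (w i) (w j) = (if i = j then 1 else 0)) \<and>
        (\<forall>f\<in>W_space \<Omega> \<tau> k. \<exists>a. \<forall>x\<in>\<Omega>. f x = (\<Sum>i\<in>J. a i * w i x)) \<and>
        (\<forall>i\<in>J. \<exists>T\<in>\<tau> (k - 1). closure {x \<in> \<Omega>. w i x \<noteq> 0} \<subseteq> closure T))"

definition Theta_mat ::
    "(real^'n) set \<Rightarrow> nat \<Rightarrow> 'n sobolev_op \<Rightarrow> nat \<Rightarrow> (nat \<Rightarrow> real^'n \<Rightarrow> real) \<Rightarrow> real mat" where
  "Theta_mat \<Omega> s \<L> N w =
     mat N N (\<lambda>(i, j). l2_inner \<Omega> (w i) (inverse_op \<Omega> s \<L> (\<lambda>v. l2_inner \<Omega> (w j) v)))"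

section \<open>Matrices\<close>

definition eucl_norm :: "real Matrix.vec \<Rightarrow> real" where
  "eucl_norm v = sqrt (scalar_prod v v)"

definition mat_norm2 :: "real mat \<Rightarrow> real" where
  "mat_norm2 A =
     (SUP v\<in>{v \<in> carrier_vec (dim_col A). eucl_norm v \<le> 1}. eucl_norm (mult_mat_vec A v))"

definition is_cholesky_factor :: "real mat \<Rightarrow> real mat \<Rightarrow> bool" where
  "is_cholesky_factor A L \<longleftrightarrow>
     L \<in> carrier_mat (dim_row A) (dim_row A) \<and>
     (\<forall>j<dim_row A. \<forall>i<j. L $$ (i, j) = 0) \<and>
     (\<forall>i<dim_row A. 0 < L $$ (i, i)) \<and>
     A = L * transpose_mat L"

definition first_cols :: "real mat \<Rightarrow> nat \<Rightarrow> real mat" where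
  "first_cols L k = mat (dim_row L) k (\<lambda>(i, j). L $$ (i, j))"

end

theory Submission
  imports Defs
begin

text \<open>
  Write \<open>\<Theta>\<close> as the Gram matrix of the basis in the energy form of the inverse operator. The error of the
  truncated factorisation is a Schur complement, so its quadratic form at \<open>x\<close> is the energy of a
  function \<open>v\<close> that is \<open>L\<^sup>2\<close>-orthogonal to the first \<open>k\<close> basis functions, hence has mean zero on every cell
  of some level \<open>l\<close> with \<open>k\<close> comparable to \<open>h\<^sup>-\<^sup>d\<^sup>l\<close>. On convex cells the Poincare inequality gives
  \<open>\<parallel>v\<parallel> \<le> C h\<^sup>l \<parallel>Dv\<parallel>\<close>. Since \<open>v\<close> lies in \<open>H\<^sub>0\<^sup>s\<close>, integration by parts yields
  \<open>\<parallel>D\<^sup>jv\<parallel>\<^sup>2 \<le> \<surd>d \<parallel>D\<^sup>j\<^sup>-\<^sup>1v\<parallel> \<parallel>D\<^sup>j\<^sup>+\<^sup>1v\<parallel>\<close>, and this propagates the gain \<open>h\<^sup>l\<close> through all \<open>s\<close> derivatives to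
  \<open>\<parallel>v\<parallel> \<le> C h\<^sup>l\<^sup>s \<parallel>D\<^sup>sv\<parallel>\<close>. For the optimality, testing a step function of level
  \<open>l\<close> against scaled bump functions in its cells bounds \<open>\<Theta>\<close> from below by \<open>c h\<^sup>2\<^sup>l\<^sup>s\<close> on the span of the
  first \<open>k + 1\<close> basis functions, and a matrix of rank at most \<open>k\<close> has a kernel vector there.
\<close>

section \<open>Smooth functions and test functions\<close>

text \<open>Piecewise constants reproduce only constants, so orthogonality to the first
  \<open>k\<close> basis functions yields by itself a single power of the cell size. The other
  \<open>s - 1\<close> powers come from the boundary values, hence the role of
  \<open>H\<^sub>0\<^sup>s\<close>. The estimate for \<open>v\<close> has to be in terms of its
  energy, and positivity of the operator alone gives no such bound. Cauchy-Schwarz in the energy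
  combined with the bounded inverse gives coercivity, with a constant in the two operator norms.
  Neither constant may see \<open>\<Omega>\<close>, \<open>q\<close> or the basis. The domain enters
  through its volume, which lies between the volumes of balls of radius \<open>\<delta> * h\<close>
  and 1; this bounds the number of cells of each level from both sides. Since \<open>k\<close> may
  fall inside a level, it is matched with a level only up to one step, which costs powers of
  \<open>\<delta>\<close> and \<open>h\<close>. The norm of \<open>\<Theta>\<close> is brought into
  the rates at the end: for the upper rate by the energy of a basis function of level 1, for the
  lower rate by the bound of \<open>\<Theta>\<close> that coercivity gives.\<close>

definition partial :: "'n \<Rightarrow> (real^'n \<Rightarrow> real) \<Rightarrow> real^'n \<Rightarrow> real" where
  "partial i f = (\<lambda>x. frechet_derivative f (at x) (axis i 1))"

lemma iter_partial_Cons: "iter_partial (i # is) f = partial i (iter_partial is f)"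
  by (simp add: partial_def)

text \<open>The recursion equation in terms of \<open>frechet_derivative\<close> would compete with
  \<open>iter_partial_Cons\<close>; the form through \<open>partial\<close> is the one that later
  lemmas speak about.\<close>

declare iter_partial.simps(2)[simp del]

lemma iter_partial_append: "iter_partial (is @ js) f = iter_partial is (iter_partial js f)"
  by (induction "is") (auto simp: iter_partial_Cons)

lemma partialI: "(f has_derivative D) (at x) \<Longrightarrow> partial i f x = D (axis i 1)"
  by (metis frechet_derivative_at partial_def)

lemma smooth_differentiable: "smooth_function f \<Longrightarrow> iter_partial is f differentiable (at x)"
  by (auto simp: smooth_function_def)

lemma smooth_differentiable': "smooth_function f \<Longrightarrow> f differentiable (at x)"
  using smooth_differentiable[of f "[]"] by simp

lemma smooth_iter_partial: "smooth_function f \<Longrightarrow> smooth_function (iter_partial is f)"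
  unfolding smooth_function_def by (metis iter_partial_append)

lemma smooth_partial: "smooth_function f \<Longrightarrow> smooth_function (partial i f)"
  using smooth_iter_partial[of f "[i]"] by (simp add: iter_partial_Cons)

text \<open>Every iterated derivative of a member of \<open>S\<close> stays in \<open>S\<close> and
  is therefore differentiable. Smoothness proofs reduce to finding a set invariant under
  \<open>partial\<close>, without formulas for higher derivatives.\<close>

lemma smooth_function_coinduct:
  assumes "f \<in> S" and "\<And>f x. f \<in> S \<Longrightarrow> f differentiable (at x)"
    and "\<And>f i. f \<in> S \<Longrightarrow> partial i f \<in> S"
  shows "smooth_function f"
proof -
  have "iter_partial is f \<in> S" for "is"
    by (induction "is") (auto simp: iter_partial_Cons assms)
  then show ?thesis using assms(2) by (auto simp: smooth_function_def)
qed

lemma smooth_has_derivative: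
  assumes "smooth_function f"
  shows "(f has_derivative (\<lambda>h. \<Sum>i\<in>UNIV. h $ i * partial i f x)) (at x)"
proof -
  let ?D = "frechet_derivative f (at x)"
  have D: "(f has_derivative ?D) (at x)"
    using smooth_differentiable'[OF assms] frechet_derivative_works by blast
  have lin: "linear ?D" using D has_derivative_linear by blast
  have "?D h = (\<Sum>i\<in>UNIV. h $ i * partial i f x)" for h
  proof -
    have "?D h = ?D (\<Sum>i\<in>UNIV. h $ i *\<^sub>R axis i 1)"
      using basis_expansion[of h] by (simp add: scalar_mult_eq_scaleR)
    also have "\<dots> = (\<Sum>i\<in>UNIV. h $ i * ?D (axis i 1))"
      by (simp add: linear_sum[OF lin] linear_cmul[OF lin])
    finally show ?thesis by (simp add: partial_def)
  qed
  then have "?D = (\<lambda>h. \<Sum>i\<in>UNIV. h $ i * partial i f x)" by auto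
  then show ?thesis using D by simp
qed

lemma smooth_continuous: "smooth_function f \<Longrightarrow> continuous_on S f"
  by (meson continuous_at_imp_continuous_on differentiable_imp_continuous_within smooth_differentiable')

lemma smooth_borel: "smooth_function f \<Longrightarrow> f \<in> borel_measurable borel"
  by (simp add: borel_measurable_continuous_onI smooth_continuous)

section \<open>Closure of smooth functions under sums, products and rescaling\<close>

lemma partial_lincomb:
  assumes "smooth_function f" "smooth_function g"
  shows "partial i (\<lambda>x. a * f x + b * g x) = (\<lambda>x. a * partial i f x + b * partial i g x)"
proof
  fix x
  have "((\<lambda>x. a * f x + b * g x) has_derivative
      (\<lambda>h. a * (\<Sum>i\<in>UNIV. h $ i * partial i f x) + b * (\<Sum>i\<in>UNIV. h $ i * partial i g x))) (at x)"
    by (intro derivative_intros smooth_has_derivative assms)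
  from partialI[OF this, of i] show "partial i (\<lambda>x. a * f x + b * g x) x = a * partial i f x + b * partial i g x"
    by (simp add: axis_def if_distrib[of "\<lambda>y. y * _"] cong: if_cong)
qed

lemma smooth_lincomb:
  assumes "smooth_function f" "smooth_function g"
  shows "smooth_function (\<lambda>x. a * f x + b * g x)"
proof (rule smooth_function_coinduct[where S = "{\<lambda>x. a * f x + b * g x | f g. smooth_function f \<and> smooth_function g}"])
  show "(\<lambda>x. a * f x + b * g x) \<in> {\<lambda>x. a * f x + b * g x |f g. smooth_function f \<and> smooth_function g}"
    using assms by blast
next
  fix u x assume "u \<in> {\<lambda>x. a * f x + b * g x |f g. smooth_function f \<and> smooth_function g}"
  then show "u differentiable at x"
    by (elim CollectE exE conjE) (simp only:, intro differentiable_add differentiable_mult differentiable_const; rule smooth_differentiable', assumption)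
next
  fix u i assume "u \<in> {\<lambda>x. a * f x + b * g x |f g. smooth_function f \<and> smooth_function g}"
  then show "partial i u \<in> {\<lambda>x. a * f x + b * g x |f g. smooth_function f \<and> smooth_function g}"
    by (elim CollectE exE conjE) (use partial_lincomb smooth_partial in blast)
qed

lemma smooth_const: "smooth_function (\<lambda>x. c)"
proof (rule smooth_function_coinduct[where S = "range (\<lambda>c x. c)"])
  fix f :: "real^'a \<Rightarrow> real" and i assume "f \<in> range (\<lambda>c x. c)"
  then obtain c where f: "f = (\<lambda>x. c)" by auto
  have "partial i f x = 0" for x
    unfolding f by (rule partialI[of _ "\<lambda>_. 0"]) (auto intro: derivative_eq_intros)
  then show "partial i f \<in> range (\<lambda>c x. c)" by auto
qed auto

lemma partial_mult:
  assumes "smooth_function f" "smooth_function g"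
  shows "partial i (\<lambda>x. f x * g x) = (\<lambda>x. partial i f x * g x + f x * partial i g x)"
proof
  fix x
  have "((\<lambda>x. f x * g x) has_derivative
      (\<lambda>h. f x * (\<Sum>i\<in>UNIV. h $ i * partial i g x) + (\<Sum>i\<in>UNIV. h $ i * partial i f x) * g x)) (at x)"
    by (intro derivative_intros smooth_has_derivative assms)
  from partialI[OF this, of i] show "partial i (\<lambda>x. f x * g x) x = partial i f x * g x + f x * partial i g x"
    by (simp add: axis_def if_distrib[of "\<lambda>y. y * _"] cong: if_cong)
qed

text \<open>Products alone are not invariant under \<open>partial\<close>, since the Leibniz rule
  turns one product into a sum of two; finite sums of products are.\<close>

inductive_set smooth_product_sums :: "(real^'n \<Rightarrow> real) set" where
  prod: "smooth_function f \<Longrightarrow> smooth_function g \<Longrightarrow> (\<lambda>x. f x * g x) \<in> smooth_product_sums"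
| add: "u \<in> smooth_product_sums \<Longrightarrow> v \<in> smooth_product_sums \<Longrightarrow> (\<lambda>x. u x + v x) \<in> smooth_product_sums"

lemma smooth_mult:
  assumes "smooth_function f" "smooth_function g"
  shows "smooth_function (\<lambda>x. f x * g x)"
proof (rule smooth_function_coinduct[where S = smooth_product_sums])
  show "(\<lambda>x. f x * g x) \<in> smooth_product_sums"
    using assms by (rule smooth_product_sums.prod)
next
  fix u :: "real^'a \<Rightarrow> real" and x assume "u \<in> smooth_product_sums"
  then show "u differentiable at x"
    by induction (assumption | rule differentiable_add differentiable_mult | erule smooth_differentiable')+
next
  fix u :: "real^'a \<Rightarrow> real" and i assume u: "u \<in> smooth_product_sums"
  \<comment> \<open>Both claims go through one induction because the derivative of a sum splits only
    when the summands are known to be differentiable.\<close>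
  have "(\<forall>x. u differentiable at x) \<and> partial i u \<in> smooth_product_sums" using u
  proof induction
    case (prod f g)
    then show ?case
      unfolding partial_mult[OF prod]
      by (intro conjI allI differentiable_mult smooth_product_sums.add smooth_product_sums.prod)
        (rule smooth_differentiable' smooth_partial, assumption | assumption)+
  next
    case (add u v)
    have "partial i (\<lambda>x. u x + v x) = (\<lambda>x. partial i u x + partial i v x)"
    proof
      fix x
      have "((\<lambda>x. u x + v x) has_derivative
        (\<lambda>h. frechet_derivative u (at x) h + frechet_derivative v (at x) h)) (at x)"
        using add by (intro derivative_intros) (auto simp: frechet_derivative_works)
      from partialI[OF this, of i]
      show "partial i (\<lambda>x. u x + v x) x = partial i u x + partial i v x" by (simp add: partial_def)
    qed
    then show ?case using add by (simp add: smooth_product_sums.add differentiable_add)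
  qed
  then show "partial i u \<in> smooth_product_sums" by simp
qed

lemma smooth_prod:
  assumes "finite A" "\<And>a. a \<in> A \<Longrightarrow> smooth_function (f a)"
  shows "smooth_function (\<lambda>x. \<Prod>a\<in>A. f a x)"
  using assms by (induction A rule: finite_induct) (auto intro: smooth_const smooth_mult)

lemma iter_partial_lincomb:
  assumes "smooth_function f" "smooth_function g"
  shows "iter_partial is (\<lambda>x. a * f x + b * g x) = (\<lambda>x. a * iter_partial is f x + b * iter_partial is g x)"
  using assms by (induction "is") (auto simp: iter_partial_Cons partial_lincomb smooth_iter_partial)

lemma iter_partial_zero: "iter_partial is (\<lambda>x. 0) = (\<lambda>x. 0)"
  using iter_partial_lincomb[OF smooth_const[of 0] smooth_const[of 0], where a = 0 and b = 0] by simp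

lemma smooth_sum:
  assumes "finite A" "\<And>a. a \<in> A \<Longrightarrow> smooth_function (f a)"
  shows "smooth_function (\<lambda>x. \<Sum>a\<in>A. c a * f a x)"
  using assms
proof (induction A rule: finite_induct)
  case (insert y A)
  then have "smooth_function (\<lambda>x. c y * f y x + 1 * (\<Sum>a\<in>A. c a * f a x))"
    by (intro smooth_lincomb) auto
  then show ?case using insert by simp
qed (auto intro: smooth_const)

lemma iter_partial_sum:
  assumes "finite A" "\<And>a. a \<in> A \<Longrightarrow> smooth_function (f a)"
  shows "iter_partial is (\<lambda>x. \<Sum>a\<in>A. c a * f a x) = (\<lambda>x. \<Sum>a\<in>A. c a * iter_partial is (f a) x)"
  using assms
proof (induction A rule: finite_induct)
  case (insert y A)
  then have "iter_partial is (\<lambda>x. c y * f y x + 1 * (\<Sum>a\<in>A. c a * f a x)) =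
     (\<lambda>x. c y * iter_partial is (f y) x + 1 * iter_partial is (\<lambda>x. \<Sum>a\<in>A. c a * f a x) x)"
    by (intro iter_partial_lincomb smooth_sum) auto
  then show ?case using insert by simp
qed (auto simp: iter_partial_zero)

lemma iter_partial_scale:
  assumes "smooth_function f"
  shows "iter_partial is (\<lambda>x. f (c *\<^sub>R (x - y))) = (\<lambda>x. c ^ length is * iter_partial is f (c *\<^sub>R (x - y)))"
proof (induction "is")
  case (Cons i "is")
  let ?g = "iter_partial is f"
  have g: "smooth_function ?g" by (simp add: assms smooth_iter_partial)
  have "partial i (\<lambda>x. c ^ length is * ?g (c *\<^sub>R (x - y))) x = c ^ Suc (length is) * partial i ?g (c *\<^sub>R (x - y))" for x
  proof -
    have "((\<lambda>x. ?g (c *\<^sub>R (x - y))) has_derivative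
       (\<lambda>h. \<Sum>i\<in>UNIV. (c *\<^sub>R h) $ i * partial i ?g (c *\<^sub>R (x - y)))) (at x)"
      by (rule has_derivative_compose[OF _ smooth_has_derivative[OF g]]) (auto intro!: derivative_eq_intros)
    then have "((\<lambda>x. c ^ length is * ?g (c *\<^sub>R (x - y))) has_derivative
       (\<lambda>h. c ^ length is * (\<Sum>i\<in>UNIV. (c *\<^sub>R h) $ i * partial i ?g (c *\<^sub>R (x - y))))) (at x)"
      by (intro derivative_intros)
    from partialI[OF this, of i] show ?thesis
      by (simp add: axis_def if_distrib[of "\<lambda>y. y * _"] if_distrib[of "\<lambda>y. _ * y"] cong: if_cong)
  qed
  then show ?case using Cons by (simp add: iter_partial_Cons)
qed auto

lemma smooth_scale:
  assumes "smooth_function f"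
  shows "smooth_function (\<lambda>x. f (c *\<^sub>R (x - y)))"
  unfolding smooth_function_def
proof (intro allI)
  fix "is" x
  have "(\<lambda>x. iter_partial is f (c *\<^sub>R (x - y))) differentiable (at x)"
    by (rule differentiable_compose[where f = "iter_partial is f"])
       (auto intro!: derivative_intros smooth_differentiable assms)
  then show "iter_partial is (\<lambda>x. f (c *\<^sub>R (x - y))) differentiable at x"
    unfolding iter_partial_scale[OF assms] by (intro derivative_intros)
qed

text \<open>Off the closed set \<open>K\<close> the function vanishes on a whole neighbourhood, so
  its derivative at the point is that of the zero function, and the argument can be
  iterated.\<close>

lemma iter_partial_eq_0_outside:
  assumes "closed K" "\<And>x. x \<notin> K \<Longrightarrow> f x = 0" "x \<notin> K"
  shows "iter_partial is f x = 0"
  using assms(3)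
proof (induction "is" arbitrary: x)
  case (Cons i "is")
  have "eventually (\<lambda>y. y \<in> - K) (nhds x)"
    using assms(1) Cons.prems by (intro eventually_nhds_in_open) auto
  then have ev: "eventually (\<lambda>y. iter_partial is f y = 0) (nhds x)"
    by eventually_elim (use Cons.IH in auto)
  have "(iter_partial is f has_derivative (\<lambda>h. 0)) (at x)"
    by (rule has_derivative_transform_eventually[OF has_derivative_const[where c = 0]])
       (use ev Cons eventually_mono[OF ev] in \<open>auto simp: eventually_at_filter\<close>)
  from partialI[OF this] show ?case by (simp add: iter_partial_Cons)
qed (use assms in auto)

subsection \<open>Bump functions\<close>

text \<open>\<open>flat 1\<close> is the classical function \<open>exp (- (1/t))\<close> continued
  by zero. The polynomial in \<open>1/t\<close> is the factor that differentiation produces, so the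
  family is closed under derivatives.\<close>

definition flat :: "real poly \<Rightarrow> real \<Rightarrow> real" where
  "flat p t = (if t \<le> 0 then 0 else poly p (1/t) * exp (- (1/t)))"

lemma poly_times_exp_tendsto_0: "((\<lambda>u. poly p u * exp (- u)) \<longlongrightarrow> 0) (at_top :: real filter)"
proof -
  have "((\<lambda>u. \<Sum>i\<le>degree p. coeff p i * (u ^ i / exp u)) \<longlongrightarrow> (\<Sum>i\<le>degree p. coeff p i * 0)) at_top"
    by (intro tendsto_sum tendsto_mult tendsto_const tendsto_power_div_exp_0)
  moreover have "(\<lambda>u. \<Sum>i\<le>degree p. coeff p i * (u ^ i / exp u)) = (\<lambda>u. poly p u * exp (- u))"
    by (auto simp: poly_altdef sum_distrib_right exp_minus divide_inverse mult.assoc)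
  ultimately show ?thesis by simp
qed

text \<open>With \<open>u = 1/t\<close>, the chain rule multiplies the \<open>u\<close>-derivative,
  whose polynomial factor is \<open>pderiv p - p\<close>, by minus the square of \<open>u\<close>;
  this is where \<open>[:0,0,1:]\<close> comes from.\<close>

lemma flat_has_derivative:
  "(flat p has_real_derivative flat ([:0,0,1:] * (p - pderiv p)) t) (at t)"
proof (cases t "0 :: real" rule: linorder_cases)
  case less
  have "((\<lambda>t. 0) has_real_derivative 0) (at t)" by simp
  moreover have "\<forall>\<^sub>F x in nhds t. flat p x = 0"
    using eventually_nhds_in_open[of "{..<0}" t] less by (auto elim!: eventually_mono simp: flat_def)
  ultimately show ?thesis using less
    by (subst DERIV_cong_ev[OF refl _ refl, where g = "\<lambda>_. 0"]) (auto simp: flat_def)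
next
  case greater
  have "\<forall>\<^sub>F x in nhds t. flat p x = poly p (1/x) * exp (-(1/x))"
    using eventually_nhds_in_open[of "{0<..}" t] greater by (auto elim!: eventually_mono simp: flat_def)
  moreover have "((\<lambda>x. poly p (1/x) * exp (-(1/x))) has_real_derivative
      flat ([:0,0,1:] * (p - pderiv p)) t) (at t)"
    using greater
    by (auto intro!: derivative_eq_intros DERIV_chain2[OF poly_DERIV] simp: flat_def field_simps power2_eq_square)
  ultimately show ?thesis by (subst DERIV_cong_ev[OF refl _ refl])
next
  case equal
  \<comment> \<open>The difference quotient at 0 is \<open>flat p h / h\<close>; dividing by
    \<open>h\<close> multiplies the polynomial in \<open>1/h\<close> by its variable, that is by
    \<open>[:0,1:]\<close>.\<close>
  have "((\<lambda>h. poly ([:0,1:] * p) h * exp (- h)) \<longlongrightarrow> 0) at_top"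
    by (rule poly_times_exp_tendsto_0)
  then have "((\<lambda>h. poly ([:0,1:] * p) (inverse h) * exp (- inverse h)) \<longlongrightarrow> 0) (at_right 0)"
    by (simp add: filterlim_at_top_to_right)
  then have r: "((\<lambda>h. flat p h / h) \<longlongrightarrow> 0) (at_right 0)"
    by (rule Lim_transform_eventually)
       (auto simp: eventually_at_filter flat_def field_simps)
  have l: "((\<lambda>h. flat p h / h) \<longlongrightarrow> 0) (at_left 0)"
    by (rule Lim_transform_eventually[OF tendsto_const]) (auto simp: eventually_at_filter flat_def)
  from l r have "((\<lambda>h. flat p h / h) \<longlongrightarrow> 0) (at 0)" by (simp add: filterlim_at_split)
  then show ?thesis unfolding equal DERIV_def by (simp add: flat_def)
qed

text \<open>The prefactor \<open>c\<close> in the invariant set absorbs the inner derivative; it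
  becomes 0 when the derivative is taken along another coordinate.\<close>

lemma smooth_flat_coordinate: "smooth_function (\<lambda>x. flat p (\<alpha> * x $ i + \<beta>))"
proof (rule smooth_function_coinduct[where S = "{\<lambda>x. c * flat p (\<alpha> * x $ i + \<beta>) | c p. True}"])
  show "(\<lambda>x. flat p (\<alpha> * x $ i + \<beta>)) \<in> {\<lambda>x. c * flat p (\<alpha> * x $ i + \<beta>) | c p. True}"
    by (rule CollectI, rule exI[of _ 1], rule exI[of _ p]) simp
next
  fix f :: "real^'a \<Rightarrow> real" and j
  assume "f \<in> {\<lambda>x. c * flat p (\<alpha> * x $ i + \<beta>) | c p. True}"
  then obtain c p where f: "f = (\<lambda>x. c * flat p (\<alpha> * x $ i + \<beta>))" by auto
  let ?q = "[:0,0,1:] * (p - pderiv p)"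
  have D: "(f has_derivative (\<lambda>h. c * ((\<alpha> * h $ i) * flat ?q (\<alpha> * x $ i + \<beta>)))) (at x)" for x
  proof -
    have "((\<lambda>x. \<alpha> * x $ i + \<beta>) has_derivative (\<lambda>h. \<alpha> * h $ i)) (at x)"
      by (intro has_derivative_add_const has_derivative_mult_right bounded_linear_imp_has_derivative bounded_linear_vec_nth)
    from has_derivative_compose[OF this flat_has_derivative[unfolded has_field_derivative_def]]
    show ?thesis unfolding f by (intro has_derivative_mult_right) (simp add: mult_ac)
  qed
  show "partial j f \<in> {\<lambda>x. c * flat p (\<alpha> * x $ i + \<beta>) | c p. True}"
    using partialI[OF D, of j] by (auto intro!: exI[of _ "c * \<alpha> * (axis j 1 $ i)"] exI[of _ ?q])
  fix x show "f differentiable (at x)" using D by (auto simp: differentiable_def)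
qed

text \<open>The steepness \<open>c\<close> has two uses: letting it tend to infinity turns the bumps
  into the indicator of the box, and \<open>c = 1\<close> yields the reference bump that is later
  placed in the cells.\<close>

definition box_bump :: "real \<Rightarrow> real^'n \<Rightarrow> real^'n \<Rightarrow> real^'n \<Rightarrow> real" where
  "box_bump c a b x = (\<Prod>i\<in>UNIV. flat 1 (c * (x $ i - a $ i)) * flat 1 (c * (b $ i - x $ i)))"

lemma flat_1_nonneg: "0 \<le> flat 1 t" and flat_1_le_1: "flat 1 t \<le> 1"
  and flat_1_pos_iff: "0 < flat 1 t \<longleftrightarrow> 0 < t"
  by (auto simp: flat_def)

lemma box_bump_smooth: "smooth_function (box_bump c a b)"
proof -
  have "smooth_function (\<lambda>x. \<Prod>i\<in>UNIV. flat 1 (c * x $ i + (- c * a $ i)) * flat 1 ((- c) * x $ i + c * b $ i))"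
    by (intro smooth_prod smooth_mult smooth_flat_coordinate) auto
  moreover have "box_bump c a b = (\<lambda>x. \<Prod>i\<in>UNIV. flat 1 (c * x $ i + (- c * a $ i)) * flat 1 ((- c) * x $ i + c * b $ i))"
    by (auto simp: box_bump_def algebra_simps)
  ultimately show ?thesis by simp
qed

lemma box_bump_nonneg: "0 \<le> box_bump c a b x"
  by (auto simp: box_bump_def intro!: prod_nonneg mult_nonneg_nonneg flat_1_nonneg)

lemma box_bump_le_1: "box_bump c a b x \<le> 1"
  unfolding box_bump_def
  by (rule prod_le_1) (auto intro!: mult_nonneg_nonneg mult_le_one flat_1_nonneg flat_1_le_1)

lemma box_bump_eq_0: "c > 0 \<Longrightarrow> x \<notin> box a b \<Longrightarrow> box_bump c a b x = 0"
  by (auto simp: box_bump_def mem_box_cart flat_def not_less mult_le_0_iff)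

lemma box_bump_pos: "c > 0 \<Longrightarrow> x \<in> box a b \<Longrightarrow> box_bump c a b x > 0"
  by (auto simp: box_bump_def mem_box_cart intro!: prod_pos mult_pos_pos simp: flat_1_pos_iff)

lemma box_bump_tendsto:
  "(\<lambda>n. box_bump (real (Suc n)) a b x) \<longlonglongrightarrow> indicat_real (box a b) x"
proof (cases "x \<in> box a b")
  case True
  have *: "(\<lambda>n. flat 1 (real (Suc n) * t)) \<longlonglongrightarrow> 1" if "t > 0" for t
  proof -
    have "(\<lambda>n. exp (- ((1/t) * inverse (real (Suc n))))) \<longlonglongrightarrow> exp (- ((1/t) * 0))"
      by (intro tendsto_intros LIMSEQ_inverse_real_of_nat)
    moreover have "(\<lambda>n. flat 1 (real (Suc n) * t)) = (\<lambda>n. exp (- ((1/t) * inverse (real (Suc n)))))"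
      using that by (auto simp: flat_def mult_le_0_iff field_simps simp del: of_nat_Suc)
    ultimately show ?thesis by simp
  qed
  have "(\<lambda>n. box_bump (real (Suc n)) a b x) \<longlonglongrightarrow> (\<Prod>i\<in>(UNIV :: 'a set). 1 * 1)"
    unfolding box_bump_def
    by (intro tendsto_prod tendsto_mult *) (use True in \<open>auto simp: mem_box_cart\<close>)
  then show ?thesis using True by simp
qed (simp add: box_bump_eq_0)

lemma test_function_box_bump:
  assumes "c > 0" "cbox a b \<subseteq> \<Omega>"
  shows "test_function \<Omega> (box_bump c a b)"
  unfolding test_function_def
  using assms box_bump_smooth box_bump_eq_0[OF assms(1)] box_subset_cbox
  by (metis compact_cbox subsetD)

subsection \<open>Integration by parts\<close>

lemma test_function_mono: "test_function \<Omega> \<phi> \<Longrightarrow> \<Omega> \<subseteq> \<Omega>' \<Longrightarrow> test_function \<Omega>' \<phi>"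
  unfolding test_function_def by blast

lemma test_function_smooth: "test_function \<Omega> \<phi> \<Longrightarrow> smooth_function \<phi>"
  by (simp add: test_function_def)

lemma test_function_eq_0: "test_function \<Omega> \<phi> \<Longrightarrow> x \<notin> \<Omega> \<Longrightarrow> \<phi> x = 0"
  unfolding test_function_def by blast

lemma test_function_iter_partial:
  assumes "test_function \<Omega> \<phi>"
  shows "test_function \<Omega> (iter_partial is \<phi>)"
  using assms smooth_iter_partial iter_partial_eq_0_outside[where f = \<phi>] compact_imp_closed
  unfolding test_function_def by metis

lemma test_function_partial: "test_function \<Omega> \<phi> \<Longrightarrow> test_function \<Omega> (partial i \<phi>)"
  using test_function_iter_partial[of \<Omega> \<phi> "[i]"] by (simp add: iter_partial_Cons)

lemma test_function_lincomb:
  assumes "test_function \<Omega> \<phi>" "test_function \<Omega> \<psi>"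
  shows "test_function \<Omega> (\<lambda>x. a * \<phi> x + b * \<psi> x)"
proof -
  obtain K K' where "compact K" "K \<subseteq> \<Omega>" "\<forall>x. x \<notin> K \<longrightarrow> \<phi> x = 0"
    "compact K'" "K' \<subseteq> \<Omega>" "\<forall>x. x \<notin> K' \<longrightarrow> \<psi> x = 0"
    using assms unfolding test_function_def by blast
  then show ?thesis
    unfolding test_function_def using assms
    by (intro conjI smooth_lincomb exI[of _ "K \<union> K'"]) (auto simp: test_function_def)
qed

lemma test_function_zero: "test_function \<Omega> (\<lambda>x. 0)"
  unfolding test_function_def by (intro conjI smooth_const exI[of _ "{}"]) auto

lemma test_function_sum:
  assumes "finite A" "\<And>a. a \<in> A \<Longrightarrow> test_function \<Omega> (f a)"
  shows "test_function \<Omega> (\<lambda>x. \<Sum>a\<in>A. c a * f a x)"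
  using assms
proof (induction A rule: finite_induct)
  case (insert y A)
  then have "test_function \<Omega> (\<lambda>x. c y * f y x + 1 * (\<Sum>a\<in>A. c a * f a x))"
    by (intro test_function_lincomb) auto
  then show ?case using insert by simp
qed (auto intro: test_function_zero)

lemma test_function_mult:
  assumes "smooth_function f" "test_function \<Omega> \<phi>"
  shows "test_function \<Omega> (\<lambda>x. f x * \<phi> x)"
  using assms unfolding test_function_def by (auto intro: smooth_mult)

lemma test_function_borel: "test_function \<Omega> \<phi> \<Longrightarrow> \<phi> \<in> borel_measurable borel"
  by (simp add: smooth_borel test_function_smooth)

lemma test_function_integrable:
  assumes "test_function \<Omega> \<phi>"
  shows "integrable lborel \<phi>"
proof -
  obtain K where K: "compact K" "\<And>x. x \<notin> K \<Longrightarrow> \<phi> x = 0"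
    using assms unfolding test_function_def by blast
  have "integrable lborel (\<lambda>x. indicator K x *\<^sub>R \<phi> x)"
    by (intro borel_integrable_compact K smooth_continuous test_function_smooth[OF assms])
  moreover have "(\<lambda>x. indicator K x *\<^sub>R \<phi> x) = \<phi>"
    using K(2) by (intro ext) (force simp: indicator_def)
  ultimately show ?thesis by simp
qed

lemma test_function_bounded:
  assumes "test_function \<Omega> \<phi>"
  obtains M where "M > 0" "\<And>x. \<bar>\<phi> x\<bar> \<le> M"
proof -
  obtain K where K: "compact K" "\<And>x. x \<notin> K \<Longrightarrow> \<phi> x = 0"
    using assms unfolding test_function_def by blast
  have "compact (\<phi> ` K)"
    by (intro compact_continuous_image K smooth_continuous test_function_smooth[OF assms])
  then obtain M where "M > 0" "\<forall>x\<in>\<phi> ` K. norm x \<le> M"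
    using bounded_pos compact_imp_bounded by blast
  then have "\<bar>\<phi> x\<bar> \<le> M" for x using K(2)[of x] by (cases "x \<in> K") auto
  with \<open>M > 0\<close> show ?thesis by (rule that)
qed

lemma smooth_line_derivative:
  assumes "smooth_function g"
  shows "((\<lambda>t. g (x + t *\<^sub>R h)) has_real_derivative (\<Sum>i\<in>UNIV. h $ i * partial i g (x + t *\<^sub>R h))) (at t)"
proof -
  have "((\<lambda>t. x + t *\<^sub>R h) has_derivative (\<lambda>s. s *\<^sub>R h)) (at t)"
    by (auto intro!: derivative_eq_intros)
  from has_derivative_compose[OF this smooth_has_derivative[OF assms]]
  show ?thesis
    unfolding has_field_derivative_def
    by (rule has_derivative_eq_rhs) (auto simp: sum_distrib_right sum_distrib_left mult_ac)
qed

lemma axis_sum: "(\<Sum>i\<in>UNIV. axis j (1::real) $ i * f i) = f j"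
  by (simp add: axis_def if_distrib[of "\<lambda>y. y * _"] cong: if_cong)

text \<open>The difference quotients of \<open>g\<close> have integral \<open>0\<close> by translation invariance.\<close>

lemma integral_partial_eq_0:
  assumes g: "test_function UNIV g"
  shows "integral\<^sup>L lborel (partial i g) = 0"
proof -
  let ?e = "axis i 1 :: real^'a"
  define q where "q n x = (g (x + inverse (real (Suc n)) *\<^sub>R ?e) - g x) / inverse (real (Suc n))" for n x
  obtain K where K: "compact K" "\<And>x. x \<notin> K \<Longrightarrow> g x = 0"
    using g unfolding test_function_def by blast
  obtain R where R: "\<And>x. x \<in> K \<Longrightarrow> norm x \<le> R"
    using compact_imp_bounded[OF K(1)] unfolding bounded_iff by blast
  obtain M where M: "M > 0" "\<And>x. \<bar>partial i g x\<bar> \<le> M"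
    using test_function_bounded[OF test_function_partial[OF g]] by metis
  have sg: "smooth_function g" using g by (rule test_function_smooth)
  have line: "((\<lambda>t. g (x + t *\<^sub>R ?e)) has_real_derivative partial i g (x + t *\<^sub>R ?e)) (at t)" for x t
    using smooth_line_derivative[OF sg, of x ?e t] by (simp add: axis_sum)
  \<comment> \<open>Domination uniform in \<open>n\<close>: the mean value theorem bounds the
    quotient by the maximum of the derivative, and a step of length at most 1 keeps its support in
    the ball of radius \<open>R + 1\<close>.\<close>
  have bd: "\<bar>q n x\<bar> \<le> M * indicator (cball 0 (R + 1)) x" for n x
  proof -
    let ?t = "inverse (real (Suc n))"
    have t: "0 < ?t" "?t \<le> 1" by (auto simp: field_simps)
    have "\<exists>z. 0 < z \<and> z < ?t \<and> g (x + ?t *\<^sub>R ?e) - g (x + 0 *\<^sub>R ?e) = (?t - 0) * partial i g (x + z *\<^sub>R ?e)"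
      by (rule MVT2[OF t(1)]) (rule line)
    then obtain z where z: "g (x + ?t *\<^sub>R ?e) - g x = ?t * partial i g (x + z *\<^sub>R ?e)" by auto
    have "\<bar>q n x\<bar> \<le> M" unfolding q_def z using t M(2) by simp
    moreover have "q n x = 0" if "x \<notin> cball 0 (R + 1)"
    proof -
      have "norm x > R + 1" using that by simp
      moreover have "norm (?t *\<^sub>R ?e) \<le> 1" using t by simp
      moreover have "norm x \<le> norm (x + ?t *\<^sub>R ?e) + norm (?t *\<^sub>R ?e)"
        by (metis add_diff_cancel norm_triangle_ineq4)
      ultimately have "norm x > R" "norm (x + ?t *\<^sub>R ?e) > R" by linarith+
      then have "x \<notin> K" "x + ?t *\<^sub>R ?e \<notin> K" using R by force+
      then show ?thesis using K(2) by (simp add: q_def)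
    qed
    ultimately show ?thesis by (cases "x \<in> cball 0 (R + 1)") auto
  qed
  have gm[measurable]: "g \<in> borel_measurable borel" by (rule test_function_borel[OF g])
  have int0: "integral\<^sup>L lborel (q n) = 0" for n
  proof -
    let ?t = "inverse (real (Suc n)) *\<^sub>R ?e"
    have "integral\<^sup>L lborel g = integral\<^sup>L (distr lborel borel ((+) ?t)) g"
      by (simp add: lborel_distr_plus)
    also have "\<dots> = (\<integral>x. g (x + ?t) \<partial>lborel)"
      by (subst integral_distr) (auto simp: add.commute)
    finally have eq: "(\<integral>x. g (x + ?t) \<partial>lborel) = integral\<^sup>L lborel g" by simp
    have "integrable (distr lborel borel ((+) ?t)) g"
      using test_function_integrable[OF g] by (simp add: lborel_distr_plus)
    then have "integrable lborel (\<lambda>x. g (x + ?t))"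
      by (subst (asm) integrable_distr_eq) (auto simp: add.commute)
    then show ?thesis using test_function_integrable[OF g] eq
      unfolding q_def by simp
  qed
  have "(\<lambda>n. integral\<^sup>L lborel (q n)) \<longlonglongrightarrow> integral\<^sup>L lborel (partial i g)"
  proof (rule integral_dominated_convergence[where w = "\<lambda>x. M * indicator (cball 0 (R + 1)) x"])
    show "partial i g \<in> borel_measurable lborel"
      using test_function_borel[OF test_function_partial[OF g]] by simp
    show "q n \<in> borel_measurable lborel" for n unfolding q_def by measurable
    have "emeasure lborel (cball 0 (R + 1) :: (real^'a) set) < \<infinity>"
      using emeasure_lborel_cball_finite by (simp add: less_top)
    then show "integrable lborel (\<lambda>x :: real^'a. M * indicator (cball 0 (R + 1)) x :: real)"
      by (intro integrable_mult_right integrable_real_indicator) auto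
    show "AE x in lborel. norm (q n x) \<le> M * indicator (cball 0 (R + 1)) x" for n
      using bd by simp
    show "AE x in lborel. (\<lambda>n. q n x) \<longlonglongrightarrow> partial i g x"
    proof (rule AE_I2)
      fix x
      have "((\<lambda>h. (g (x + (0 + h) *\<^sub>R ?e) - g (x + 0 *\<^sub>R ?e)) / h) \<longlongrightarrow> partial i g (x + 0 *\<^sub>R ?e)) (at 0)"
        using line[of x 0] unfolding DERIV_def .
      moreover have "filterlim (\<lambda>n. inverse (real (Suc n))) (at 0) sequentially"
        using LIMSEQ_inverse_real_of_nat by (auto simp: filterlim_at)
      ultimately have "((\<lambda>n. (g (x + (0 + inverse (real (Suc n))) *\<^sub>R ?e) - g (x + 0 *\<^sub>R ?e)) / inverse (real (Suc n)))
        \<longlongrightarrow> partial i g (x + 0 *\<^sub>R ?e)) sequentially"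
        by (rule filterlim_compose)
      then show "(\<lambda>n. q n x) \<longlonglongrightarrow> partial i g x" by (simp add: q_def)
    qed
  qed
  then show ?thesis using int0 by (simp add: LIMSEQ_const_iff)
qed

text \<open>The compact support of \<open>g\<close> alone makes both products integrable and lets
  the integral of the derivative of the product vanish.\<close>

lemma integration_by_parts_partial:
  assumes f: "smooth_function f" and g: "test_function UNIV g"
  shows "(\<integral>x. f x * partial i g x \<partial>lborel) = - (\<integral>x. partial i f x * g x \<partial>lborel)"
proof -
  have i: "integrable lborel (\<lambda>x. partial i f x * g x)" "integrable lborel (\<lambda>x. f x * partial i g x)"
    by (intro test_function_integrable[where \<Omega> = UNIV] test_function_mult test_function_partial
        smooth_partial f g)+
  have "0 = integral\<^sup>L lborel (partial i (\<lambda>x. f x * g x))"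
    using integral_partial_eq_0[OF test_function_mult[OF f g]] by simp
  also have "\<dots> = (\<integral>x. partial i f x * g x \<partial>lborel) + (\<integral>x. f x * partial i g x \<partial>lborel)"
    using i by (simp add: partial_mult f test_function_smooth[OF g])
  finally show ?thesis by simp
qed

text \<open>The outermost derivative of \<open>g\<close> is moved first and ends up innermost on
  \<open>f\<close>, hence \<open>rev is\<close>. Keeping the reversed order avoids any appeal to the
  symmetry of mixed derivatives.\<close>

lemma integration_by_parts:
  assumes f: "smooth_function f" and g: "test_function UNIV g"
  shows "(\<integral>x. f x * iter_partial is g x \<partial>lborel) =
    (-1) ^ length is * (\<integral>x. iter_partial (rev is) f x * g x \<partial>lborel)"
  using f
proof (induction "is" arbitrary: f)
  case (Cons i "is")
  have "(\<integral>x. f x * iter_partial (i # is) g x \<partial>lborel) = - (\<integral>x. partial i f x * iter_partial is g x \<partial>lborel)"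
    unfolding iter_partial_Cons
    by (rule integration_by_parts_partial[OF Cons.prems test_function_iter_partial[OF g]])
  also have "\<dots> = - ((-1) ^ length is * (\<integral>x. iter_partial (rev is) (partial i f) x * g x \<partial>lborel))"
    using Cons.IH[OF smooth_partial[OF Cons.prems]] by simp
  also have "iter_partial (rev is) (partial i f) = iter_partial (rev (i # is)) f"
    by (simp add: iter_partial_append iter_partial_Cons)
  finally show ?case by simp
qed simp

section \<open>Square-integrable functions and weak derivatives\<close>

text \<open>Definiteness is left out on purpose, since functions are representatives modulo null
  sets. The same facts serve the \<open>L\<^sup>2\<close> pairing, the Sobolev forms and the energy
  of the operator.\<close>

locale semi_inner =
  fixes S :: "('a \<Rightarrow> real) set" and B :: "('a \<Rightarrow> real) \<Rightarrow> ('a \<Rightarrow> real) \<Rightarrow> real"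
  assumes lincomb_closed: "u \<in> S \<Longrightarrow> v \<in> S \<Longrightarrow> (\<lambda>x. a * u x + b * v x) \<in> S"
    and lincomb_left: "u \<in> S \<Longrightarrow> v \<in> S \<Longrightarrow> w \<in> S \<Longrightarrow> B (\<lambda>x. a * u x + b * v x) w = a * B u w + b * B v w"
    and sym: "u \<in> S \<Longrightarrow> v \<in> S \<Longrightarrow> B u v = B v u"
    and nonneg: "u \<in> S \<Longrightarrow> 0 \<le> B u u"
begin

lemma lincomb_right: "u \<in> S \<Longrightarrow> v \<in> S \<Longrightarrow> w \<in> S \<Longrightarrow> B w (\<lambda>x. a * u x + b * v x) = a * B w u + b * B w v"
  using lincomb_left lincomb_closed sym by simp

lemma square_lincomb:
  assumes "u \<in> S" "v \<in> S"
  shows "B (\<lambda>x. a * u x + b * v x) (\<lambda>x. a * u x + b * v x) = a\<^sup>2 * B u u + 2 * a * b * B u v + b\<^sup>2 * B v v"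
proof -
  have "B (\<lambda>x. a * u x + b * v x) (\<lambda>x. a * u x + b * v x) =
     a * (a * B u u + b * B u v) + b * (a * B v u + b * B v v)"
    using assms by (simp add: lincomb_left lincomb_right lincomb_closed)
  then show ?thesis using sym[OF assms] by (simp add: algebra_simps power2_eq_square)
qed

lemma cauchy_schwarz_square:
  assumes "u \<in> S" "v \<in> S"
  shows "(B u v)\<^sup>2 \<le> B u u * B v v"
proof -
  have q: "0 \<le> a\<^sup>2 * B u u + 2 * a * b * B u v + b\<^sup>2 * B v v" for a b
    using nonneg[OF lincomb_closed[OF assms, of a b]] square_lincomb[OF assms, of a b] by simp
  show ?thesis
  proof (cases "B u u = 0")
    case True
    have "B u v = 0"
    proof (rule ccontr)
      \<comment> \<open>Without definiteness a degenerate \<open>u\<close> may still pair with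
        \<open>v\<close>. The form is then affine in the coefficient of \<open>u\<close>, which is
        chosen to give the value -1.\<close>
      assume n: "B u v \<noteq> 0"
      have "0 \<le> 2 * (- (B v v + 1) / (2 * B u v)) * 1 * B u v + 1\<^sup>2 * B v v"
        using q[of "- (B v v + 1) / (2 * B u v)" 1] True by simp
      also have "\<dots> = -1" using n by (simp add: field_simps)
      finally show False by simp
    qed
    then show ?thesis using True by simp
  next
    case False
    then have p: "B u u > 0" using nonneg[OF assms(1)] by simp
    \<comment> \<open>The coefficients \<open>B u v\<close> and \<open>- B u u\<close> are the
      minimiser of the quadratic polynomial, cleared of denominators.\<close>
    have "0 \<le> B u u * (B u u * B v v - (B u v)\<^sup>2)"
      using q[of "B u v" "- B u u"] by (simp add: algebra_simps power2_eq_square)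
    then show ?thesis using p by (simp add: zero_le_mult_iff)
  qed
qed

lemma cauchy_schwarz:
  assumes "u \<in> S" "v \<in> S"
  shows "\<bar>B u v\<bar> \<le> sqrt (B u u) * sqrt (B v v)"
  using real_sqrt_le_mono[OF cauchy_schwarz_square[OF assms]] by (simp add: real_sqrt_mult)

lemma seminorm_lincomb:
  assumes "u \<in> S" "v \<in> S"
  shows "sqrt (B (\<lambda>x. a * u x + b * v x) (\<lambda>x. a * u x + b * v x)) \<le> \<bar>a\<bar> * sqrt (B u u) + \<bar>b\<bar> * sqrt (B v v)"
proof (rule real_le_lsqrt)
  have "a * b * B u v \<le> \<bar>a * b\<bar> * (sqrt (B u u) * sqrt (B v v))"
    using mult_left_mono[OF cauchy_schwarz[OF assms], of "\<bar>a * b\<bar>"] abs_ge_self[of "a * b * B u v"]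
    by (simp add: abs_mult)
  moreover have "(sqrt (B u u))\<^sup>2 = B u u" "(sqrt (B v v))\<^sup>2 = B v v"
    using nonneg assms by auto
  ultimately show "B (\<lambda>x. a * u x + b * v x) (\<lambda>x. a * u x + b * v x) \<le> (\<bar>a\<bar> * sqrt (B u u) + \<bar>b\<bar> * sqrt (B v v))\<^sup>2"
    unfolding square_lincomb[OF assms] power2_sum power_mult_distrib power2_abs
    by (simp add: abs_mult mult_ac)
qed (use nonneg assms in auto)

lemma seminorm_scale:
  assumes "u \<in> S"
  shows "sqrt (B (\<lambda>x. a * u x) (\<lambda>x. a * u x)) = \<bar>a\<bar> * sqrt (B u u)"
  using square_lincomb[OF assms assms, of a 0] by (simp add: real_sqrt_mult)

lemma seminorm_diff_le:
  assumes "u \<in> S" "v \<in> S"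
  shows "\<bar>sqrt (B u u) - sqrt (B v v)\<bar> \<le> sqrt (B (\<lambda>x. u x - v x) (\<lambda>x. u x - v x))"
proof -
  let ?w = "\<lambda>x. u x - v x"
  have w: "?w \<in> S" using lincomb_closed[OF assms, of 1 "-1"] by simp
  have "sqrt (B u u) \<le> sqrt (B ?w ?w) + sqrt (B v v)"
    using seminorm_lincomb[OF w assms(2), of 1 1] by simp
  moreover have "sqrt (B v v) \<le> sqrt (B ?w ?w) + sqrt (B u u)"
    using seminorm_lincomb[OF w assms(1), of "-1" 1] by simp
  ultimately show ?thesis by linarith
qed

lemma seminorm_tendsto:
  assumes "\<And>n. u n \<in> S" "v \<in> S"
    and "(\<lambda>n. sqrt (B (\<lambda>x. u n x - v x) (\<lambda>x. u n x - v x))) \<longlonglongrightarrow> 0"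
  shows "(\<lambda>n. sqrt (B (u n) (u n))) \<longlonglongrightarrow> sqrt (B v v)"
proof -
  have "(\<lambda>n. sqrt (B (u n) (u n)) - sqrt (B v v)) \<longlonglongrightarrow> 0"
    by (rule Lim_null_comparison[OF _ assms(3)]) (use seminorm_diff_le assms in auto)
  then show ?thesis by (simp add: LIM_zero_iff)
qed

end

section \<open>Square-integrable functions and the \<open>L\<^sup>2\<close> pairing\<close>

lemma square_integrable_mult:
  assumes "square_integrable \<Omega> u" "square_integrable \<Omega> v"
  shows "integrable (lebesgue_on \<Omega>) (\<lambda>x. u x * v x)"
proof (rule Bochner_Integration.integrable_bound)
  show "integrable (lebesgue_on \<Omega>) (\<lambda>x. (u x)\<^sup>2 + (v x)\<^sup>2)"
    using assms unfolding square_integrable_def by auto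
  show "(\<lambda>x. u x * v x) \<in> borel_measurable (lebesgue_on \<Omega>)"
    using assms unfolding square_integrable_def by auto
  have "\<bar>a * b\<bar> \<le> a\<^sup>2 + b\<^sup>2" for a b :: real
  proof -
    have "2 * (\<bar>a\<bar> * \<bar>b\<bar>) \<le> a\<^sup>2 + b\<^sup>2"
      using sum_squares_bound[of "\<bar>a\<bar>" "\<bar>b\<bar>"] by simp
    then show ?thesis unfolding abs_mult
      using mult_nonneg_nonneg[of "\<bar>a\<bar>" "\<bar>b\<bar>"] by linarith
  qed
  then show "AE x in lebesgue_on \<Omega>. norm (u x * v x) \<le> norm ((u x)\<^sup>2 + (v x)\<^sup>2)"
    by auto
qed

lemma square_integrable_lincomb:
  assumes "square_integrable \<Omega> u" "square_integrable \<Omega> v"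
  shows "square_integrable \<Omega> (\<lambda>x. a * u x + b * v x)"
proof -
  have "(\<lambda>x. (a * u x + b * v x)\<^sup>2) = (\<lambda>x. a\<^sup>2 * (u x)\<^sup>2 + 2 * a * b * (u x * v x) + b\<^sup>2 * (v x)\<^sup>2)"
    by (auto simp: algebra_simps power2_eq_square)
  then show ?thesis
    using assms square_integrable_mult[OF assms] unfolding square_integrable_def by auto
qed

lemma square_integrable_sum:
  assumes "finite A" "\<And>a. a \<in> A \<Longrightarrow> square_integrable \<Omega> (f a)"
  shows "square_integrable \<Omega> (\<lambda>x. \<Sum>a\<in>A. c a * f a x)"
  using assms
proof (induction A rule: finite_induct)
  case (insert y A)
  then have "square_integrable \<Omega> (\<lambda>x. c y * f y x + 1 * (\<Sum>a\<in>A. c a * f a x))"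
    by (intro square_integrable_lincomb) auto
  then show ?case using insert by simp
qed (simp add: square_integrable_def)

lemma l2_semi_inner: "semi_inner {u. square_integrable \<Omega> u} (l2_inner \<Omega>)"
proof
  fix u v w :: "real^'a \<Rightarrow> real" and a b
  assume "u \<in> {u. square_integrable \<Omega> u}" "v \<in> {u. square_integrable \<Omega> u}" "w \<in> {u. square_integrable \<Omega> u}"
  then have i: "integrable (lebesgue_on \<Omega>) (\<lambda>x. u x * w x)" "integrable (lebesgue_on \<Omega>) (\<lambda>x. v x * w x)"
    by (auto intro: square_integrable_mult)
  have "l2_inner \<Omega> (\<lambda>x. a * u x + b * v x) w = (LINT x|lebesgue_on \<Omega>. a * (u x * w x) + b * (v x * w x))"
    unfolding l2_inner_def by (simp add: algebra_simps)
  also have "\<dots> = a * l2_inner \<Omega> u w + b * l2_inner \<Omega> v w"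
    unfolding l2_inner_def using i by simp
  finally show "l2_inner \<Omega> (\<lambda>x. a * u x + b * v x) w = a * l2_inner \<Omega> u w + b * l2_inner \<Omega> v w" .
qed (auto simp: square_integrable_lincomb l2_inner_def mult.commute)

lemma l2_sym: "l2_inner \<Omega> u v = l2_inner \<Omega> v u"
  by (simp add: l2_inner_def mult.commute)

lemma l2_nonneg: "0 \<le> l2_inner \<Omega> u u"
  by (simp add: l2_inner_def)

lemma l2_lincomb_left:
  assumes "square_integrable \<Omega> u" "square_integrable \<Omega> v" "square_integrable \<Omega> w"
  shows "l2_inner \<Omega> (\<lambda>x. a * u x + b * v x) w = a * l2_inner \<Omega> u w + b * l2_inner \<Omega> v w"
  using semi_inner.lincomb_left[OF l2_semi_inner] assms by auto

lemma l2_lincomb_right: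
  assumes "square_integrable \<Omega> u" "square_integrable \<Omega> v" "square_integrable \<Omega> w"
  shows "l2_inner \<Omega> w (\<lambda>x. a * u x + b * v x) = a * l2_inner \<Omega> w u + b * l2_inner \<Omega> w v"
  using l2_lincomb_left[OF assms] by (simp add: l2_sym)

lemma l2_sum_left:
  assumes "finite A" "\<And>a. a \<in> A \<Longrightarrow> square_integrable \<Omega> (f a)" "square_integrable \<Omega> w"
  shows "l2_inner \<Omega> (\<lambda>x. \<Sum>a\<in>A. c a * f a x) w = (\<Sum>a\<in>A. c a * l2_inner \<Omega> (f a) w)"
  using assms
proof (induction A rule: finite_induct)
  case (insert y A)
  then have "l2_inner \<Omega> (\<lambda>x. c y * f y x + 1 * (\<Sum>a\<in>A. c a * f a x)) w =
     c y * l2_inner \<Omega> (f y) w + 1 * l2_inner \<Omega> (\<lambda>x. \<Sum>a\<in>A. c a * f a x) w"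
    by (intro l2_lincomb_left square_integrable_sum) auto
  then show ?case using insert by simp
qed (simp add: l2_inner_def)

lemma l2_sum_right:
  assumes "finite A" "\<And>a. a \<in> A \<Longrightarrow> square_integrable \<Omega> (f a)" "square_integrable \<Omega> w"
  shows "l2_inner \<Omega> w (\<lambda>x. \<Sum>a\<in>A. c a * f a x) = (\<Sum>a\<in>A. c a * l2_inner \<Omega> w (f a))"
  using l2_sum_left[OF assms, where c = c] by (simp add: l2_sym[of \<Omega> w])

lemma l2_cong_AE:
  assumes "square_integrable \<Omega> u" "square_integrable \<Omega> u'" "square_integrable \<Omega> v" "square_integrable \<Omega> v'"
    and "AE x in lebesgue_on \<Omega>. u x = u' x" "AE x in lebesgue_on \<Omega>. v x = v' x"
  shows "l2_inner \<Omega> u v = l2_inner \<Omega> u' v'"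
  unfolding l2_inner_def
proof (rule integral_cong_AE)
  show "AE x in lebesgue_on \<Omega>. u x * v x = u' x * v' x"
    using assms(5,6) by eventually_elim simp
qed (use assms in \<open>auto simp: square_integrable_def\<close>)

lemma l2_cong: "(\<And>x. x \<in> \<Omega> \<Longrightarrow> u x = u' x) \<Longrightarrow> (\<And>x. x \<in> \<Omega> \<Longrightarrow> v x = v' x) \<Longrightarrow> l2_inner \<Omega> u v = l2_inner \<Omega> u' v'"
  unfolding l2_inner_def by (intro Bochner_Integration.integral_cong) auto

text \<open>A bridge between two measures: \<open>l2_inner\<close> uses the completed measure
  restricted to the domain, whereas translation invariance and scaling are used for
  \<open>lborel\<close>.\<close>

lemma integral_lebesgue_on_open:
  assumes "open \<Omega>" "f \<in> borel_measurable borel" "\<And>x. x \<notin> \<Omega> \<Longrightarrow> f x = (0::real)"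
  shows "integral\<^sup>L (lebesgue_on \<Omega>) f = integral\<^sup>L lborel f"
    and "integrable (lebesgue_on \<Omega>) f \<longleftrightarrow> integrable lborel f"
proof -
  have O: "\<Omega> \<in> sets lebesgue" using assms(1) by auto
  have f: "(\<lambda>x. if x \<in> \<Omega> then f x else 0) = f" using assms(3) by auto
  show "integral\<^sup>L (lebesgue_on \<Omega>) f = integral\<^sup>L lborel f"
    using Lebesgue_Measure.integral_restrict_UNIV[OF O, of f] f integral_completion[of f lborel] assms(2) by simp
  show "integrable (lebesgue_on \<Omega>) f \<longleftrightarrow> integrable lborel f"
    using Lebesgue_Measure.integrable_restrict_UNIV[OF O, of f] f integrable_completion[of f lborel] assms(2) by simp
qed

lemma test_function_square_integrable:
  assumes "open \<Omega>" "test_function \<Omega> \<phi>"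
  shows "square_integrable \<Omega> \<phi>"
proof -
  have sq: "test_function \<Omega> (\<lambda>x. \<phi> x * \<phi> x)"
    by (intro test_function_mult test_function_smooth[OF assms(2)] assms)
  have "integrable (lebesgue_on \<Omega>) (\<lambda>x. \<phi> x * \<phi> x)"
    using integral_lebesgue_on_open(2)[OF assms(1) test_function_borel[OF sq] test_function_eq_0[OF sq]]
      test_function_integrable[OF sq] by simp
  moreover have "\<phi> \<in> borel_measurable (lebesgue_on \<Omega>)"
    using test_function_borel[OF assms(2)]
    by (intro measurable_restrict_space1 measurable_completion) simp
  ultimately show ?thesis unfolding square_integrable_def by (simp add: power2_eq_square)
qed

lemma l2_test_function:
  assumes "open \<Omega>" "test_function \<Omega> \<phi>" "smooth_function \<psi>"
  shows "l2_inner \<Omega> \<psi> \<phi> = (\<integral>x. \<psi> x * \<phi> x \<partial>lborel)"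
proof -
  have t: "test_function \<Omega> (\<lambda>x. \<psi> x * \<phi> x)" by (intro test_function_mult assms)
  show ?thesis unfolding l2_inner_def
    using integral_lebesgue_on_open(1)[OF assms(1) test_function_borel[OF t] test_function_eq_0[OF t]] .
qed

subsection \<open>The fundamental lemma of the calculus of variations\<close>

text \<open>Boxes are an intersection-stable generator of the Borel sets, and the sets over which
  \<open>g\<close> integrates to zero form a Dynkin system, complements being handled by the
  integral over the whole space. So \<open>g\<close> and 0 are densities of the same signed
  measure.\<close>

lemma AE_eq_0_of_box_integrals:
  fixes g :: "'a::euclidean_space \<Rightarrow> real"
  assumes g: "integrable lborel g"
    and box: "\<And>c d. (LINT x:box c d|lborel. g x) = 0" and UNIV: "integral\<^sup>L lborel g = 0"
  shows "AE x in lborel. g x = 0"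
proof -
  have gm[measurable]: "g \<in> borel_measurable borel" using g by auto
  have si: "set_integrable lborel A g" if "A \<in> sets borel" for A
    unfolding set_integrable_def using that by (intro integrable_mult_indicator g) auto
  have zero: "(LINT x:A|lborel. g x) = 0" if "A \<in> sets borel" for A
  proof -
    let ?E = "range (\<lambda>(a, b). box a b :: 'a set)"
    have sb: "sigma_sets UNIV ?E = sets borel" by (simp add: borel_eq_box)
    have "Int_stable ?E" by (auto simp: Int_stable_def box_Int_box)
    moreover have "?E \<subseteq> Pow UNIV" by simp
    moreover have "A \<in> sigma_sets UNIV ?E" using that by (simp add: borel_eq_box)
    ultimately show ?thesis
    proof (induction rule: sigma_sets_induct_disjoint)
      case (compl B)
      have "(LINT x:(UNIV - B) \<union> B|lborel. g x) = (LINT x:UNIV - B|lborel. g x) + (LINT x:B|lborel. g x)"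
        using compl sb by (intro set_integral_Un si) auto
      then show ?case using compl UNIV by (simp add: set_lebesgue_integral_def)
    next
      case (union F)
      have "(LINT x:(\<Union>i. F i)|lborel. g x) = (\<Sum>i. (LINT x:(F i)|lborel. g x))"
        using union sb by (intro lebesgue_integral_countable_add si) (auto simp: disjoint_family_on_def)
      then show ?case using union by simp
    qed (use box[unfolded set_lebesgue_integral_def] in \<open>auto simp: set_lebesgue_integral_def\<close>)
  qed
  then show ?thesis
    using density_unique_real[OF g, of "\<lambda>_. 0"] by simp
qed

text \<open>Box bumps are test functions converging to the indicator of a box, so \<open>g\<close>
  integrates to zero over each box whose closed box lies in the domain. This gives the claim on such
  a box, and countably many of them cover the domain.\<close>

lemma fundamental_lemma:
  fixes g :: "real^'n \<Rightarrow> real"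
  assumes "open \<Omega>" and g: "integrable (lebesgue_on \<Omega>) g"
    and ort: "\<And>\<phi>. test_function \<Omega> \<phi> \<Longrightarrow> l2_inner \<Omega> g \<phi> = 0"
  shows "AE x in lebesgue_on \<Omega>. g x = 0"
proof -
  have Om: "\<Omega> \<in> sets lebesgue" using assms(1) by auto
  have gm: "g \<in> borel_measurable (lebesgue_on \<Omega>)" using g by auto
  have box0: "(LINT x|lebesgue_on \<Omega>. g x * indicat_real (box c d) x) = 0"
    if "cbox c d \<subseteq> \<Omega>" for c d :: "real^'n"
  proof -
    have "(\<lambda>n. LINT x|lebesgue_on \<Omega>. g x * box_bump (real (Suc n)) c d x) \<longlonglongrightarrow>
        (LINT x|lebesgue_on \<Omega>. g x * indicat_real (box c d) x)"
    proof (rule integral_dominated_convergence[where w = "\<lambda>x. \<bar>g x\<bar>"])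
      have "indicat_real (box c d) \<in> borel_measurable (lebesgue_on \<Omega>)"
        by (intro measurable_restrict_space1 measurable_completion) simp
      then show "(\<lambda>x. g x * indicat_real (box c d) x) \<in> borel_measurable (lebesgue_on \<Omega>)"
        using gm by measurable
      have "box_bump (real (Suc n)) c d \<in> borel_measurable (lebesgue_on \<Omega>)" for n
        using smooth_borel[OF box_bump_smooth] by (intro measurable_restrict_space1 measurable_completion) simp
      then show "(\<lambda>x. g x * box_bump (real (Suc n)) c d x) \<in> borel_measurable (lebesgue_on \<Omega>)" for n
        using gm by measurable
      show "AE x in lebesgue_on \<Omega>. (\<lambda>n. g x * box_bump (real (Suc n)) c d x) \<longlonglongrightarrow> g x * indicat_real (box c d) x"
        by (intro AE_I2 tendsto_mult tendsto_const box_bump_tendsto)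
      show "AE x in lebesgue_on \<Omega>. norm (g x * box_bump (real (Suc n)) c d x) \<le> \<bar>g x\<bar>" for n
        by (intro AE_I2) (simp add: abs_mult mult_left_le box_bump_nonneg box_bump_le_1 del: of_nat_Suc)
    qed (use g in auto)
    moreover have "(LINT x|lebesgue_on \<Omega>. g x * box_bump (real (Suc n)) c d x) = 0" for n
      using ort[OF test_function_box_bump[of "real (Suc n)", OF _ that]] unfolding l2_inner_def by simp
    ultimately show ?thesis by (simp add: LIMSEQ_const_iff)
  qed
  have local: "AE x in lebesgue. x \<in> box a b \<longrightarrow> g x = 0" if ab: "cbox a b \<subseteq> \<Omega>" for a b :: "real^'n"
  proof -
    define gB where "gB x = (if x \<in> \<Omega> then g x * indicat_real (box a b) x else 0)" for x
    have ind: "indicat_real (box c d) \<in> borel_measurable (lebesgue_on \<Omega>)" for c d :: "real^'n"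
      by (intro measurable_restrict_space1 measurable_completion) simp
    have "integrable (lebesgue_on \<Omega>) (\<lambda>x. g x * indicat_real (box a b) x)"
    proof (rule Bochner_Integration.integrable_bound[OF g])
      show "(\<lambda>x. g x * indicat_real (box a b) x) \<in> borel_measurable (lebesgue_on \<Omega>)"
        by (intro borel_measurable_times gm ind)
    qed (auto simp: indicator_def)
    then have gBi: "integrable lebesgue gB"
      unfolding gB_def[abs_def] Lebesgue_Measure.integrable_restrict_UNIV[OF Om] .
    \<comment> \<open>The box criterion concerns Borel functions and \<open>lborel\<close>;
      \<open>gB\<close> is only Lebesgue measurable and is exchanged for a Borel
      representative.\<close>
    then obtain g' where g'[measurable]: "g' \<in> borel_measurable lborel" and ae: "AE x in lborel. gB x = g' x"
      using completion_ex_borel_measurable_real[of gB lborel] by auto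
    have ael: "AE x in lebesgue. gB x = g' x" using ae by (simp add: AE_completion)
    have g'l: "g' \<in> borel_measurable lebesgue" by (intro measurable_completion g')
    have "integrable lebesgue g'"
      using integrable_cong_AE[OF _ g'l ael] gBi by auto
    then have g'i: "integrable lborel g'" using integrable_completion g' by blast
    have int: "(LINT x|lborel. g' x * indicat_real (box c d) x) = 0" for c d
    proof -
      have m: "(\<lambda>x. g' x * indicat_real (box c d) x) \<in> borel_measurable lborel" by measurable
      have gBm: "gB \<in> borel_measurable lebesgue" using gBi by auto
      have "(LINT x|lborel. g' x * indicat_real (box c d) x) = (LINT x|lebesgue. g' x * indicat_real (box c d) x)"
        using integral_completion[OF m] by simp
      also have "\<dots> = (LINT x|lebesgue. gB x * indicat_real (box c d) x)"
      proof (rule integral_cong_AE)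
        show "AE x in lebesgue. g' x * indicat_real (box c d) x = gB x * indicat_real (box c d) x"
          using ael by eventually_elim simp
        show "(\<lambda>x. g' x * indicat_real (box c d) x) \<in> borel_measurable lebesgue"
          by (intro measurable_completion m)
        show "(\<lambda>x. gB x * indicat_real (box c d) x) \<in> borel_measurable lebesgue"
          by (intro borel_measurable_times gBm measurable_completion) simp
      qed
      also have "\<dots> = (LINT x|lebesgue_on \<Omega>. g x * indicat_real (box a b \<inter> box c d) x)"
        by (subst Lebesgue_Measure.integral_restrict_UNIV[OF Om, symmetric])
          (auto simp: gB_def indicator_def intro!: Bochner_Integration.integral_cong)
      also have "\<dots> = 0"
      proof -
        obtain e f where ef: "box a b \<inter> box c d = box e f" using box_Int_box[of a b c d] by blast
        show ?thesis
        \<comment> \<open>If the open box is empty, the closed box with the same corners may be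
          nonempty and leave the domain; the integral is then zero trivially.\<close>
        proof (cases "box e f = {}")
          case False
          then have "cbox e f = closure (box e f)" by (simp add: closure_box)
          also have "\<dots> \<subseteq> closure (cbox a b)"
            using ef box_subset_cbox by (intro closure_mono) blast
          finally have "cbox e f \<subseteq> \<Omega>" using ab by simp
          then show ?thesis using box0 ef by simp
        qed (use ef in simp)
      qed
      finally show ?thesis .
    qed
    have "AE x in lborel. g' x = 0"
    proof (rule AE_eq_0_of_box_integrals[OF g'i])
      show "(LINT x:box c d|lborel. g' x) = 0" for c d
        using int[of c d] by (simp add: set_lebesgue_integral_def mult.commute)
      have "integral\<^sup>L lborel g' = (LINT x|lborel. g' x * indicat_real (box a b) x)"
      proof (rule integral_cong_AE)
        show "AE x in lborel. g' x = g' x * indicat_real (box a b) x"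
          using ae by eventually_elim (auto simp: gB_def indicator_def split: if_splits)
      qed auto
      then show "integral\<^sup>L lborel g' = 0" using int by simp
    qed
    then have "AE x in lebesgue. g' x = 0" by (simp add: AE_completion)
    with ael show ?thesis
      by eventually_elim (use ab box_subset_cbox in \<open>auto simp: gB_def indicator_def split: if_splits\<close>)
  qed
  let ?F = "{box a b | a b :: real^'n. cbox a b \<subseteq> \<Omega>}"
  have op: "open B" if "B \<in> ?F" for B
    using that by auto
  obtain F' where F': "F' \<subseteq> ?F" "countable F'" "\<Union>F' = \<Union>?F"
    by (rule Lindelof[OF op])
  have cov: "x \<in> \<Union>F'" if "x \<in> \<Omega>" for x
  proof -
    obtain a b where "cbox a b \<subseteq> \<Omega>" "x \<in> box a b"
      by (rule open_contains_cbox[OF assms(1) \<open>x \<in> \<Omega>\<close>]) blast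
    then show ?thesis unfolding F'(3) by blast
  qed
  have "AE x in lebesgue. \<forall>B\<in>F'. x \<in> B \<longrightarrow> g x = 0"
    unfolding AE_ball_countable[OF F'(2)] using F'(1) local by blast
  then have "AE x in lebesgue. x \<in> \<Omega> \<longrightarrow> g x = 0"
    by eventually_elim (use cov in auto)
  then show ?thesis using Om by (simp add: AE_restrict_space_iff)
qed

section \<open>Sobolev spaces\<close>

lemma finite_lists_length: "finite {is :: 'n::finite list. length is \<le> s}"
  using finite_lists_length_le[of "UNIV :: 'n set" s] by simp

text \<open>The free index set lets one definition give the \<open>L\<^sup>2\<close> form for
  \<open>{[]}\<close>, the seminorm of exact order \<open>j\<close> and the full norm, all as
  semi-inner products on the same space.\<close>

definition sobolev_form :: "(real^'n) set \<Rightarrow> 'n list set \<Rightarrow> (real^'n \<Rightarrow> real) \<Rightarrow> (real^'n \<Rightarrow> real) \<Rightarrow> real" where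
  "sobolev_form \<Omega> A u v = (\<Sum>is\<in>A. l2_inner \<Omega> (weak_deriv \<Omega> is u) (weak_deriv \<Omega> is v))"

abbreviation deriv_energy :: "(real^'n) set \<Rightarrow> nat \<Rightarrow> (real^'n \<Rightarrow> real) \<Rightarrow> real" where
  "deriv_energy \<Omega> j u \<equiv> sobolev_form \<Omega> {is. length is = j} u u"

lemma sobolev_norm_eq: "sobolev_norm \<Omega> s u = sqrt (sobolev_form \<Omega> {is. length is \<le> s} u u)"
  by (simp add: sobolev_norm_def sobolev_form_def)

lemma sobolev_form_nonneg: "0 \<le> sobolev_form \<Omega> A u u"
  unfolding sobolev_form_def by (intro sum_nonneg l2_nonneg)

lemma sobolev_form_mono:
  "A \<subseteq> {is. length is \<le> s} \<Longrightarrow> sqrt (sobolev_form \<Omega> A u u) \<le> sobolev_norm \<Omega> s u"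
  unfolding sobolev_norm_eq sobolev_form_def
  by (intro real_sqrt_le_mono sum_mono2 l2_nonneg finite_lists_length) auto

lemma sobolev_norm_nonneg: "0 \<le> sobolev_norm \<Omega> s u"
  by (simp add: sobolev_norm_eq sobolev_form_nonneg)

locale bounded_open =
  fixes \<Omega> :: "(real^'n) set"
  assumes open_domain: "open \<Omega>" and bounded_domain: "bounded \<Omega>"
begin

lemma square_integrable_const: "square_integrable \<Omega> (\<lambda>x. c)"
proof -
  have "\<Omega> \<in> lmeasurable" using bounded_domain open_domain by (intro lmeasurable_open)
  then have "emeasure (lebesgue_on \<Omega>) \<Omega> < \<infinity>"
    by (simp add: emeasure_restrict_space fmeasurable_def del: emeasure_completion)
  then show ?thesis unfolding square_integrable_def
    by (auto intro!: finite_measure.integrable_const finite_measureI)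
qed

lemma square_integrable_imp_integrable:
  assumes "square_integrable \<Omega> u"
  shows "integrable (lebesgue_on \<Omega>) u"
  using square_integrable_mult[OF assms square_integrable_const[of 1]] by simp

text \<open>The difference of two candidates is orthogonal to all test functions once the common
  sign is cancelled, so the fundamental lemma applies.\<close>

lemma weak_deriv_unique:
  assumes "square_integrable \<Omega> g" "is_weak_deriv \<Omega> is u g"
    and "square_integrable \<Omega> g'" "is_weak_deriv \<Omega> is u g'"
  shows "AE x in lebesgue_on \<Omega>. g x = g' x"
proof -
  let ?d = "\<lambda>x. 1 * g x + (-1) * g' x"
  have sq: "square_integrable \<Omega> ?d" by (intro square_integrable_lincomb assms)
  have "AE x in lebesgue_on \<Omega>. ?d x = 0"
  proof (rule fundamental_lemma[OF open_domain square_integrable_imp_integrable[OF sq]])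
    fix \<phi> assume t: "test_function \<Omega> \<phi>"
    have "l2_inner \<Omega> g \<phi> = l2_inner \<Omega> g' \<phi>"
      using assms(2,4) t unfolding is_weak_deriv_def by (metis mult_left_cancel power_eq_0_iff zero_neq_neg_one)
    then show "l2_inner \<Omega> ?d \<phi> = 0"
      by (subst l2_lincomb_left) (auto intro: assms test_function_square_integrable open_domain t)
  qed
  then show ?thesis by eventually_elim simp
qed

lemma weak_deriv:
  assumes "u \<in> sobolev \<Omega> s" "length is \<le> s"
  shows "square_integrable \<Omega> (weak_deriv \<Omega> is u)" "is_weak_deriv \<Omega> is u (weak_deriv \<Omega> is u)"
proof -
  have "\<exists>g. square_integrable \<Omega> g \<and> is_weak_deriv \<Omega> is u g"
    using assms unfolding sobolev_def by auto
  from someI_ex[OF this] show "square_integrable \<Omega> (weak_deriv \<Omega> is u)" "is_weak_deriv \<Omega> is u (weak_deriv \<Omega> is u)"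
    unfolding weak_deriv_def by auto
qed

text \<open>\<open>weak_deriv\<close> is an arbitrary choice, so formulas for it hold only almost
  everywhere; any known candidate determines it in this sense.\<close>

lemma weak_deriv_AE_eq:
  assumes "square_integrable \<Omega> g" "is_weak_deriv \<Omega> is u g"
  shows "square_integrable \<Omega> (weak_deriv \<Omega> is u)" "AE x in lebesgue_on \<Omega>. weak_deriv \<Omega> is u x = g x"
proof -
  have "\<exists>g. square_integrable \<Omega> g \<and> is_weak_deriv \<Omega> is u g" using assms by auto
  from someI_ex[OF this] have *: "square_integrable \<Omega> (weak_deriv \<Omega> is u)" "is_weak_deriv \<Omega> is u (weak_deriv \<Omega> is u)"
    unfolding weak_deriv_def by auto
  then show "square_integrable \<Omega> (weak_deriv \<Omega> is u)" by simp
  show "AE x in lebesgue_on \<Omega>. weak_deriv \<Omega> is u x = g x"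
    by (rule weak_deriv_unique[OF * assms])
qed

lemma sobolev_square_integrable: "u \<in> sobolev \<Omega> s \<Longrightarrow> square_integrable \<Omega> u"
  by (simp add: sobolev_def)

lemma is_weak_deriv_lincomb:
  assumes "u \<in> sobolev \<Omega> s" "v \<in> sobolev \<Omega> s" "length is \<le> s"
  shows "is_weak_deriv \<Omega> is (\<lambda>x. a * u x + b * v x) (\<lambda>x. a * weak_deriv \<Omega> is u x + b * weak_deriv \<Omega> is v x)"
  unfolding is_weak_deriv_def
proof (intro allI impI)
  fix \<phi> assume t: "test_function \<Omega> \<phi>"
  have sq: "square_integrable \<Omega> \<phi>" "square_integrable \<Omega> (iter_partial is \<phi>)"
    by (intro test_function_square_integrable open_domain test_function_iter_partial t)+
  have "l2_inner \<Omega> u (iter_partial is \<phi>) = (- 1) ^ length is * l2_inner \<Omega> (weak_deriv \<Omega> is u) \<phi>"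
    "l2_inner \<Omega> v (iter_partial is \<phi>) = (- 1) ^ length is * l2_inner \<Omega> (weak_deriv \<Omega> is v) \<phi>"
    using weak_deriv(2)[OF assms(1,3)] weak_deriv(2)[OF assms(2,3)] t unfolding is_weak_deriv_def by auto
  then show "l2_inner \<Omega> (\<lambda>x. a * u x + b * v x) (iter_partial is \<phi>) =
      (- 1) ^ length is * l2_inner \<Omega> (\<lambda>x. a * weak_deriv \<Omega> is u x + b * weak_deriv \<Omega> is v x) \<phi>"
    using sq assms
    by (simp add: l2_lincomb_left sobolev_square_integrable weak_deriv algebra_simps)
qed

lemma sobolev_lincomb:
  assumes "u \<in> sobolev \<Omega> s" "v \<in> sobolev \<Omega> s"
  shows "(\<lambda>x. a * u x + b * v x) \<in> sobolev \<Omega> s"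
  unfolding sobolev_def
proof (intro CollectI conjI allI impI)
  show "square_integrable \<Omega> (\<lambda>x. a * u x + b * v x)"
    by (intro square_integrable_lincomb sobolev_square_integrable[OF assms(1)] sobolev_square_integrable[OF assms(2)])
  fix "is" :: "'n list" assume l: "length is \<le> s"
  show "\<exists>g. square_integrable \<Omega> g \<and> is_weak_deriv \<Omega> is (\<lambda>x. a * u x + b * v x) g"
    using is_weak_deriv_lincomb[OF assms l] square_integrable_lincomb[OF weak_deriv(1)[OF assms(1) l] weak_deriv(1)[OF assms(2) l]]
    by blast
qed

lemma weak_deriv_lincomb:
  assumes "u \<in> sobolev \<Omega> s" "v \<in> sobolev \<Omega> s" "length is \<le> s"
  shows "AE x in lebesgue_on \<Omega>. weak_deriv \<Omega> is (\<lambda>x. a * u x + b * v x) x = a * weak_deriv \<Omega> is u x + b * weak_deriv \<Omega> is v x"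
  by (intro weak_deriv_AE_eq(2) is_weak_deriv_lincomb[OF assms] square_integrable_lincomb
      weak_deriv(1)[OF assms(1,3)] weak_deriv(1)[OF assms(2,3)])

lemma sobolev_semi_inner:
  assumes A: "A \<subseteq> {is. length is \<le> s}"
  shows "semi_inner (sobolev \<Omega> s) (sobolev_form \<Omega> A)"
proof
  fix u v w a b
  assume u: "u \<in> sobolev \<Omega> s" and v: "v \<in> sobolev \<Omega> s"
  show "(\<lambda>x. a * u x + b * v x) \<in> sobolev \<Omega> s" by (rule sobolev_lincomb[OF u v])
  show "sobolev_form \<Omega> A u v = sobolev_form \<Omega> A v u"
    unfolding sobolev_form_def by (simp add: l2_sym)
  assume w: "w \<in> sobolev \<Omega> s"
  have "l2_inner \<Omega> (weak_deriv \<Omega> is (\<lambda>x. a * u x + b * v x)) (weak_deriv \<Omega> is w) =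
      a * l2_inner \<Omega> (weak_deriv \<Omega> is u) (weak_deriv \<Omega> is w) + b * l2_inner \<Omega> (weak_deriv \<Omega> is v) (weak_deriv \<Omega> is w)"
    if "is \<in> A" for "is"
  proof -
    have l: "length is \<le> s" using that A by auto
    have "l2_inner \<Omega> (weak_deriv \<Omega> is (\<lambda>x. a * u x + b * v x)) (weak_deriv \<Omega> is w) =
       l2_inner \<Omega> (\<lambda>x. a * weak_deriv \<Omega> is u x + b * weak_deriv \<Omega> is v x) (weak_deriv \<Omega> is w)"
      by (intro l2_cong_AE weak_deriv_lincomb[OF u v l] weak_deriv(1)[OF sobolev_lincomb[OF u v] l]
          square_integrable_lincomb weak_deriv(1)[OF u l] weak_deriv(1)[OF v l] weak_deriv(1)[OF w l] AE_I2 refl)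
    then show ?thesis by (simp add: l2_lincomb_left weak_deriv(1)[OF _ l] u v w)
  qed
  then show "sobolev_form \<Omega> A (\<lambda>x. a * u x + b * v x) w = a * sobolev_form \<Omega> A u w + b * sobolev_form \<Omega> A v w"
    unfolding sobolev_form_def by (simp add: sum.distrib sum_distrib_left)
qed (rule sobolev_form_nonneg)

lemma sobolev_norm_lincomb:
  "u \<in> sobolev \<Omega> s \<Longrightarrow> v \<in> sobolev \<Omega> s \<Longrightarrow>
   sobolev_norm \<Omega> s (\<lambda>x. a * u x + b * v x) \<le> \<bar>a\<bar> * sobolev_norm \<Omega> s u + \<bar>b\<bar> * sobolev_norm \<Omega> s v"
  unfolding sobolev_norm_eq by (rule semi_inner.seminorm_lincomb[OF sobolev_semi_inner]) auto

lemma sobolev_norm_scale: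
  "u \<in> sobolev \<Omega> s \<Longrightarrow> sobolev_norm \<Omega> s (\<lambda>x. a * u x) = \<bar>a\<bar> * sobolev_norm \<Omega> s u"
  unfolding sobolev_norm_eq by (rule semi_inner.seminorm_scale[OF sobolev_semi_inner]) auto

text \<open>The reversal is inherited from \<open>integration_by_parts\<close>; it does no harm
  because the energies sum over all lists of a given length.\<close>

lemma weak_deriv_test_function:
  assumes "test_function \<Omega> \<phi>"
  shows "is_weak_deriv \<Omega> is \<phi> (iter_partial (rev is) \<phi>)"
  unfolding is_weak_deriv_def
proof (intro allI impI)
  fix \<psi> assume t: "test_function \<Omega> \<psi>"
  have s: "smooth_function \<phi>" by (rule test_function_smooth[OF assms])
  show "l2_inner \<Omega> \<phi> (iter_partial is \<psi>) = (- 1) ^ length is * l2_inner \<Omega> (iter_partial (rev is) \<phi>) \<psi>"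
    using integration_by_parts[OF s test_function_mono[OF t subset_UNIV], of "is"]
    by (simp add: l2_test_function open_domain t s test_function_iter_partial smooth_iter_partial)
qed

lemma test_function_sobolev:
  assumes "test_function \<Omega> \<phi>"
  shows "\<phi> \<in> sobolev \<Omega> s"
  unfolding sobolev_def
  using weak_deriv_test_function[OF assms] test_function_square_integrable[OF open_domain] assms test_function_iter_partial
  by blast

lemma sobolev_form_test_function:
  assumes "test_function \<Omega> \<phi>"
  shows "sobolev_form \<Omega> A \<phi> \<phi> = (\<Sum>is\<in>A. \<integral>x. (iter_partial (rev is) \<phi> x)\<^sup>2 \<partial>lborel)"
  unfolding sobolev_form_def
proof (rule sum.cong[OF refl])
  fix "is"
  have sq: "square_integrable \<Omega> (iter_partial (rev is) \<phi>)"
    by (intro test_function_square_integrable open_domain test_function_iter_partial assms)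
  note w = weak_deriv_AE_eq[OF sq weak_deriv_test_function[OF assms]]
  have "l2_inner \<Omega> (weak_deriv \<Omega> is \<phi>) (weak_deriv \<Omega> is \<phi>) = l2_inner \<Omega> (iter_partial (rev is) \<phi>) (iter_partial (rev is) \<phi>)"
    by (intro l2_cong_AE w sq)
  then show "l2_inner \<Omega> (weak_deriv \<Omega> is \<phi>) (weak_deriv \<Omega> is \<phi>) = (\<integral>x. (iter_partial (rev is) \<phi> x)\<^sup>2 \<partial>lborel)"
    by (simp add: l2_test_function open_domain assms test_function_iter_partial smooth_iter_partial
        test_function_smooth[OF assms] power2_eq_square)
qed

lemma sobolev_norm_zero: "sobolev_norm \<Omega> s (\<lambda>x. 0) = 0"
  using sobolev_norm_scale[OF test_function_sobolev[OF test_function_zero], of s 0] by simp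

lemma test_function_sobolev0:
  assumes "test_function \<Omega> \<phi>"
  shows "\<phi> \<in> sobolev0 \<Omega> s"
  unfolding sobolev0_def using assms test_function_sobolev[OF assms]
  by (auto intro!: exI[of _ "\<lambda>_. \<phi>"] simp: sobolev_norm_zero)

lemma zero_sobolev0: "(\<lambda>x. 0) \<in> sobolev0 \<Omega> s"
  by (intro test_function_sobolev0 test_function_zero)

lemma sobolev0_sobolev: "u \<in> sobolev0 \<Omega> s \<Longrightarrow> u \<in> sobolev \<Omega> s"
  by (simp add: sobolev0_def)

lemma sobolev0_square_integrable: "u \<in> sobolev0 \<Omega> s \<Longrightarrow> square_integrable \<Omega> u"
  using sobolev0_sobolev sobolev_square_integrable by blast

lemma sobolev0_lincomb:
  assumes "u \<in> sobolev0 \<Omega> s" "v \<in> sobolev0 \<Omega> s"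
  shows "(\<lambda>x. a * u x + b * v x) \<in> sobolev0 \<Omega> s"
proof -
  obtain \<phi> \<psi> where t: "\<And>n. test_function \<Omega> (\<phi> n)" "\<And>n. test_function \<Omega> (\<psi> n)"
    and lim: "(\<lambda>n. sobolev_norm \<Omega> s (\<lambda>x. \<phi> n x - u x)) \<longlonglongrightarrow> 0" "(\<lambda>n. sobolev_norm \<Omega> s (\<lambda>x. \<psi> n x - v x)) \<longlonglongrightarrow> 0"
    using assms unfolding sobolev0_def by blast
  have d: "(\<lambda>x. \<phi> n x - u x) \<in> sobolev \<Omega> s" "(\<lambda>x. \<psi> n x - v x) \<in> sobolev \<Omega> s" for n
    using sobolev_lincomb[OF test_function_sobolev[OF t(1)] sobolev0_sobolev[OF assms(1)], of 1 n "-1"]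
      sobolev_lincomb[OF test_function_sobolev[OF t(2)] sobolev0_sobolev[OF assms(2)], of 1 n "-1"] by auto
  have "(\<lambda>n. sobolev_norm \<Omega> s (\<lambda>x. (a * \<phi> n x + b * \<psi> n x) - (a * u x + b * v x))) \<longlonglongrightarrow> 0"
  proof (rule Lim_null_comparison)
    show "\<forall>\<^sub>F n in sequentially. norm (sobolev_norm \<Omega> s (\<lambda>x. (a * \<phi> n x + b * \<psi> n x) - (a * u x + b * v x)))
      \<le> \<bar>a\<bar> * sobolev_norm \<Omega> s (\<lambda>x. \<phi> n x - u x) + \<bar>b\<bar> * sobolev_norm \<Omega> s (\<lambda>x. \<psi> n x - v x)"
      using sobolev_norm_lincomb[OF d, of a _ b] by (auto simp: sobolev_norm_nonneg algebra_simps)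
    show "(\<lambda>n. \<bar>a\<bar> * sobolev_norm \<Omega> s (\<lambda>x. \<phi> n x - u x) + \<bar>b\<bar> * sobolev_norm \<Omega> s (\<lambda>x. \<psi> n x - v x)) \<longlonglongrightarrow> 0"
      using tendsto_add[OF tendsto_mult_right_zero[OF lim(1), of "\<bar>a\<bar>"] tendsto_mult_right_zero[OF lim(2), of "\<bar>b\<bar>"]] by simp
  qed
  then show ?thesis unfolding sobolev0_def
    using sobolev_lincomb assms sobolev0_sobolev test_function_lincomb[OF t]
    by (auto intro!: exI[of _ "\<lambda>n x. a * \<phi> n x + b * \<psi> n x"])
qed

lemma sobolev0_sum:
  assumes "finite A" "\<And>a. a \<in> A \<Longrightarrow> f a \<in> sobolev0 \<Omega> s"
  shows "(\<lambda>x. \<Sum>a\<in>A. c a * f a x) \<in> sobolev0 \<Omega> s"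
  using assms
proof (induction A rule: finite_induct)
  case (insert y A)
  then have "(\<lambda>x. c y * f y x + 1 * (\<Sum>a\<in>A. c a * f a x)) \<in> sobolev0 \<Omega> s"
    by (intro sobolev0_lincomb) auto
  then show ?case using insert by simp
qed (simp add: zero_sobolev0)

lemma sobolev_form_Nil:
  assumes "u \<in> sobolev \<Omega> s"
  shows "sobolev_form \<Omega> {[]} u u = l2_inner \<Omega> u u"
proof -
  have sq: "square_integrable \<Omega> u" by (rule sobolev_square_integrable[OF assms])
  have "is_weak_deriv \<Omega> [] u u" by (simp add: is_weak_deriv_def)
  note w = weak_deriv_AE_eq[OF sq this]
  show ?thesis unfolding sobolev_form_def by (simp add: l2_cong_AE[OF w(1) sq w(1) sq w(2) w(2)])
qed

lemma l2_le_sobolev_norm: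
  assumes "u \<in> sobolev \<Omega> s"
  shows "sqrt (l2_inner \<Omega> u u) \<le> sobolev_norm \<Omega> s u"
  using sobolev_form_mono[of "{[]}" s \<Omega> u] sobolev_form_Nil[OF assms] by simp

lemma l2_cauchy_schwarz:
  "square_integrable \<Omega> u \<Longrightarrow> square_integrable \<Omega> v \<Longrightarrow>
   \<bar>l2_inner \<Omega> u v\<bar> \<le> sqrt (l2_inner \<Omega> u u) * sqrt (l2_inner \<Omega> v v)"
  by (rule semi_inner.cauchy_schwarz[OF l2_semi_inner]) auto

text \<open>A single sequence serves all partial seminorms and all \<open>L\<^sup>2\<close> pairings
  at once, since each of them is controlled by the full norm of the difference.\<close>

lemma sobolev0_approximation:
  assumes u: "u \<in> sobolev0 \<Omega> s"
  obtains \<phi> where "\<And>n. test_function \<Omega> (\<phi> n)"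
    "\<And>A. A \<subseteq> {is. length is \<le> s} \<Longrightarrow> (\<lambda>n. sqrt (sobolev_form \<Omega> A (\<phi> n) (\<phi> n))) \<longlonglongrightarrow> sqrt (sobolev_form \<Omega> A u u)"
    "\<And>w. square_integrable \<Omega> w \<Longrightarrow> (\<lambda>n. l2_inner \<Omega> (\<phi> n) w) \<longlonglongrightarrow> l2_inner \<Omega> u w"
proof -
  obtain \<phi> where t: "\<And>n. test_function \<Omega> (\<phi> n)"
    and lim: "(\<lambda>n. sobolev_norm \<Omega> s (\<lambda>x. \<phi> n x - u x)) \<longlonglongrightarrow> 0"
    using assms unfolding sobolev0_def by blast
  have us: "u \<in> sobolev \<Omega> s" by (rule sobolev0_sobolev[OF u])
  have d: "(\<lambda>x. \<phi> n x - u x) \<in> sobolev \<Omega> s" for n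
    using sobolev_lincomb[OF test_function_sobolev[OF t] us, of 1 n "-1"] by simp
  show ?thesis
  proof (rule that[OF t])
    fix A :: "'n list set" assume A: "A \<subseteq> {is. length is \<le> s}"
    have "(\<lambda>n. sqrt (sobolev_form \<Omega> A (\<lambda>x. \<phi> n x - u x) (\<lambda>x. \<phi> n x - u x))) \<longlonglongrightarrow> 0"
      by (rule Lim_null_comparison[OF _ lim])
        (auto simp: sobolev_form_nonneg sobolev_form_mono[OF A])
    then show "(\<lambda>n. sqrt (sobolev_form \<Omega> A (\<phi> n) (\<phi> n))) \<longlonglongrightarrow> sqrt (sobolev_form \<Omega> A u u)"
      by (intro semi_inner.seminorm_tendsto[OF sobolev_semi_inner[OF A]] us test_function_sobolev t)
  next
    fix w assume w: "square_integrable \<Omega> w"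
    have "(\<lambda>n. l2_inner \<Omega> (\<phi> n) w - l2_inner \<Omega> u w) \<longlonglongrightarrow> 0"
    proof (rule Lim_null_comparison)
      have "\<bar>l2_inner \<Omega> (\<phi> n) w - l2_inner \<Omega> u w\<bar> \<le> sobolev_norm \<Omega> s (\<lambda>x. \<phi> n x - u x) * sqrt (l2_inner \<Omega> w w)" for n
      proof -
        have "l2_inner \<Omega> (\<phi> n) w - l2_inner \<Omega> u w = l2_inner \<Omega> (\<lambda>x. \<phi> n x - u x) w"
          using l2_lincomb_left[OF sobolev_square_integrable[OF test_function_sobolev[OF t]] sobolev_square_integrable[OF us] w, of 1 n "-1"]
          by simp
        also have "\<bar>\<dots>\<bar> \<le> sqrt (l2_inner \<Omega> (\<lambda>x. \<phi> n x - u x) (\<lambda>x. \<phi> n x - u x)) * sqrt (l2_inner \<Omega> w w)"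
          by (intro l2_cauchy_schwarz sobolev_square_integrable[OF d] w)
        also have "\<dots> \<le> sobolev_norm \<Omega> s (\<lambda>x. \<phi> n x - u x) * sqrt (l2_inner \<Omega> w w)"
          by (intro mult_right_mono l2_le_sobolev_norm d) (simp add: l2_nonneg)
        finally show ?thesis .
      qed
      then show "\<forall>\<^sub>F n in sequentially. norm (l2_inner \<Omega> (\<phi> n) w - l2_inner \<Omega> u w)
         \<le> sobolev_norm \<Omega> s (\<lambda>x. \<phi> n x - u x) * sqrt (l2_inner \<Omega> w w)" by simp
      show "(\<lambda>n. sobolev_norm \<Omega> s (\<lambda>x. \<phi> n x - u x) * sqrt (l2_inner \<Omega> w w)) \<longlonglongrightarrow> 0"
        by (rule tendsto_mult_left_zero[OF lim])
    qed
    then show "(\<lambda>n. l2_inner \<Omega> (\<phi> n) w) \<longlonglongrightarrow> l2_inner \<Omega> u w" by (simp add: LIM_zero_iff)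
  qed
qed

subsection \<open>Interpolation\<close>

lemma sobolev_form_test_function_order:
  assumes "test_function \<Omega> \<phi>"
  shows "deriv_energy \<Omega> j \<phi> = (\<Sum>is | length is = j. \<integral>x. (iter_partial is \<phi> x)\<^sup>2 \<partial>lborel)"
  unfolding sobolev_form_test_function[OF assms]
  by (rule sum.reindex_bij_witness[of _ rev rev]) auto

text \<open>Integration by parts turns the square of a first derivative of \<open>f\<close> into the
  pairing of \<open>f\<close> with the pure second derivative in the same direction. Cauchy-Schwarz
  is applied to these integrals and then to the sum over all derivatives.\<close>

lemma interpolation_test_function:
  assumes t: "test_function \<Omega> \<phi>"
  shows "deriv_energy \<Omega> (Suc j) \<phi> \<le>
    sqrt (real CARD('n)) * (sqrt (deriv_energy \<Omega> j \<phi>) *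
      sqrt (deriv_energy \<Omega> (Suc (Suc j)) \<phi>))"
proof -
  define I where "I f = (\<integral>x. (f x)\<^sup>2 \<partial>lborel)" for f :: "real^'n \<Rightarrow> real"
  define P where "P = {js :: 'n list. length js = j} \<times> (UNIV :: 'n set)"
  have fin: "finite {js :: 'n list. length js = k}" for k
    by (rule finite_subset[OF _ finite_lists_length[of k]]) auto
  have finP: "finite P" unfolding P_def using fin by auto
  have ti: "test_function \<Omega> (iter_partial js \<phi>)" for js by (rule test_function_iter_partial[OF t])
  have Inn: "0 \<le> I f" for f unfolding I_def by simp
  have "deriv_energy \<Omega> (Suc j) \<phi> = (\<Sum>is | length is = Suc j. I (iter_partial is \<phi>))"
    unfolding sobolev_form_test_function_order[OF t] I_def ..
  also have "\<dots> = (\<Sum>(js, i)\<in>P. I (iter_partial (i # js) \<phi>))"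
    unfolding P_def
    by (rule sum.reindex_bij_witness[of _ "\<lambda>(js, i). i # js" "\<lambda>is. (tl is, hd is)"])
       (auto simp: length_Suc_conv)
  also have "\<dots> \<le> (\<Sum>(js, i)\<in>P. \<bar>sqrt (I (iter_partial js \<phi>))\<bar> * \<bar>sqrt (I (iter_partial (i # i # js) \<phi>))\<bar>)"
  proof (rule sum_mono, clarify)
    fix js :: "'n list" and i
    let ?f = "iter_partial js \<phi>" and ?g = "iter_partial (i # i # js) \<phi>"
    have "I (iter_partial (i # js) \<phi>) = (\<integral>x. partial i ?f x * partial i ?f x \<partial>lborel)"
      unfolding I_def iter_partial_Cons by (simp add: power2_eq_square)
    also have "\<dots> = - (\<integral>x. partial i (partial i ?f) x * ?f x \<partial>lborel)"
      by (rule integration_by_parts_partial[OF smooth_partial[OF test_function_smooth[OF ti]] test_function_mono[OF ti subset_UNIV]])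
    also have "\<dots> = - l2_inner \<Omega> ?g ?f"
      using l2_test_function[OF open_domain ti[of js] test_function_smooth[OF ti[of "i # i # js"]]] by (simp add: iter_partial_Cons)
    also have "\<dots> \<le> sqrt (l2_inner \<Omega> ?g ?g) * sqrt (l2_inner \<Omega> ?f ?f)"
      using l2_cauchy_schwarz[OF test_function_square_integrable[OF open_domain ti[of "i # i # js"]] test_function_square_integrable[OF open_domain ti[of js]]]
      by linarith
    also have "\<dots> = sqrt (I ?g) * sqrt (I ?f)"
      unfolding I_def by (simp add: l2_test_function[OF open_domain ti test_function_smooth[OF ti]] power2_eq_square)
    finally show "I (iter_partial (i # js) \<phi>) \<le> \<bar>sqrt (I ?f)\<bar> * \<bar>sqrt (I ?g)\<bar>"
      using Inn by (simp add: mult.commute)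
  qed
  also have "\<dots> = (\<Sum>p\<in>P. \<bar>sqrt (I (iter_partial (fst p) \<phi>))\<bar> * \<bar>sqrt (I (iter_partial (snd p # snd p # fst p) \<phi>))\<bar>)"
    by (simp add: case_prod_unfold)
  also have "\<dots> \<le> L2_set (\<lambda>p. sqrt (I (iter_partial (fst p) \<phi>))) P * L2_set (\<lambda>p. sqrt (I (iter_partial (snd p # snd p # fst p) \<phi>))) P"
    by (rule L2_set_mult_ineq)
  also have "L2_set (\<lambda>p. sqrt (I (iter_partial (fst p) \<phi>))) P = sqrt (\<Sum>(js, i)\<in>P. I (iter_partial js \<phi>))"
    unfolding L2_set_def using Inn by (simp add: case_prod_unfold)
  \<comment> \<open>Each \<open>js\<close> is paired with every direction \<open>i\<close>; this is
    the origin of the factor \<open>CARD('n)\<close>.\<close>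
  also have "(\<Sum>(js, i)\<in>P. I (iter_partial js \<phi>)) = real CARD('n) * deriv_energy \<Omega> j \<phi>"
    unfolding P_def sum.cartesian_product[symmetric] sobolev_form_test_function_order[OF t] I_def
    by (simp add: sum_distrib_left)
  also have "L2_set (\<lambda>p. sqrt (I (iter_partial (snd p # snd p # fst p) \<phi>))) P = sqrt (\<Sum>p\<in>P. I (iter_partial (snd p # snd p # fst p) \<phi>))"
    unfolding L2_set_def using Inn by simp
  also have "(\<Sum>p\<in>P. I (iter_partial (snd p # snd p # fst p) \<phi>)) = (\<Sum>is\<in>(\<lambda>p. snd p # snd p # fst p) ` P. I (iter_partial is \<phi>))"
    by (subst sum.reindex) (auto simp: inj_on_def)
  finally have "deriv_energy \<Omega> (Suc j) \<phi> \<le>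
      sqrt (real CARD('n) * deriv_energy \<Omega> j \<phi>) *
      sqrt (\<Sum>is\<in>(\<lambda>p. snd p # snd p # fst p) ` P. I (iter_partial is \<phi>))" .
  \<comment> \<open>So far only lists beginning with a repeated direction occur; the remaining
    derivatives of order \<open>j + 2\<close> are added to reach the full energy.\<close>
  also have "\<dots> \<le> sqrt (real CARD('n) * deriv_energy \<Omega> j \<phi>) *
      sqrt (\<Sum>is | length is = Suc (Suc j). I (iter_partial is \<phi>))"
    by (intro mult_left_mono real_sqrt_le_mono sum_mono2 fin Inn)
      (auto simp: P_def sobolev_form_nonneg)
  finally show ?thesis
    unfolding sobolev_form_test_function_order[OF t, of "Suc (Suc j)"] I_def by (simp add: real_sqrt_mult mult.assoc)
qed

lemma interpolation:
  assumes u: "u \<in> sobolev0 \<Omega> s" and j: "Suc (Suc j) \<le> s"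
  shows "deriv_energy \<Omega> (Suc j) u \<le>
    sqrt (real CARD('n)) * (sqrt (deriv_energy \<Omega> j u) *
      sqrt (deriv_energy \<Omega> (Suc (Suc j)) u))"
proof -
  obtain \<phi> where t: "\<And>n. test_function \<Omega> (\<phi> n)" and
    lim: "\<And>A. A \<subseteq> {is. length is \<le> s} \<Longrightarrow> (\<lambda>n. sqrt (sobolev_form \<Omega> A (\<phi> n) (\<phi> n))) \<longlonglongrightarrow> sqrt (sobolev_form \<Omega> A u u)"
    using sobolev0_approximation[OF u] by metis
  have l: "(\<lambda>n. sqrt (deriv_energy \<Omega> k (\<phi> n))) \<longlonglongrightarrow> sqrt (deriv_energy \<Omega> k u)"
    if "k \<le> s" for k using that by (intro lim) auto
  have "(sqrt (deriv_energy \<Omega> (Suc j) u))\<^sup>2 \<le>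
    sqrt (real CARD('n)) * (sqrt (deriv_energy \<Omega> j u) *
      sqrt (deriv_energy \<Omega> (Suc (Suc j)) u))"
  proof (rule LIMSEQ_le)
    show "(\<lambda>n. (sqrt (deriv_energy \<Omega> (Suc j) (\<phi> n)))\<^sup>2) \<longlonglongrightarrow> (sqrt (deriv_energy \<Omega> (Suc j) u))\<^sup>2"
      by (intro tendsto_power l) (use j in auto)
    show "(\<lambda>n. sqrt (real CARD('n)) * (sqrt (deriv_energy \<Omega> j (\<phi> n)) *
      sqrt (deriv_energy \<Omega> (Suc (Suc j)) (\<phi> n)))) \<longlonglongrightarrow>
      sqrt (real CARD('n)) * (sqrt (deriv_energy \<Omega> j u) *
      sqrt (deriv_energy \<Omega> (Suc (Suc j)) u))"
      by (intro tendsto_mult tendsto_const l) (use j in auto)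
    show "\<exists>N. \<forall>n\<ge>N. (sqrt (deriv_energy \<Omega> (Suc j) (\<phi> n)))\<^sup>2 \<le> sqrt (real CARD('n)) * (sqrt (deriv_energy \<Omega> j (\<phi> n)) *
      sqrt (deriv_energy \<Omega> (Suc (Suc j)) (\<phi> n)))"
      using interpolation_test_function[OF t] by (simp add: sobolev_form_nonneg)
  qed
  then show ?thesis by (simp add: sobolev_form_nonneg)
qed

text \<open>The interpolation inequality is log-convexity up to the factor \<open>\<kappa>\<close>:
  a bound for the ratio of consecutive orders passes to the next pair. The Poincare hypothesis
  starts the chain at order 0, and multiplying the \<open>s\<close> ratios gives
  \<open>\<epsilon> ^ s\<close>.\<close>

lemma l2_le_power_sobolev_norm:
  assumes u: "u \<in> sobolev0 \<Omega> s" and s: "1 \<le> s" and \<epsilon>: "0 \<le> \<epsilon>"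
    and poincare: "sqrt (l2_inner \<Omega> u u) \<le> \<epsilon> * sqrt (deriv_energy \<Omega> 1 u)"
  shows "sqrt (l2_inner \<Omega> u u) \<le> sqrt (real CARD('n)) ^ (s * s) * \<epsilon> ^ s * sobolev_norm \<Omega> s u"
proof -
  define a where "a j = sqrt (deriv_energy \<Omega> j u)" for j
  define \<kappa> where "\<kappa> = sqrt (real CARD('n))"
  have \<kappa>: "1 \<le> \<kappa>" unfolding \<kappa>_def by (simp add: Suc_leI)
  have ann: "0 \<le> a j" for j unfolding a_def by (simp add: sobolev_form_nonneg)
  have "{is :: 'n list. length is = 0} = {[]}" by auto
  then have a0: "a 0 = sqrt (l2_inner \<Omega> u u)"
    unfolding a_def using sobolev_form_Nil[OF sobolev0_sobolev[OF u]] by simp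
  have conv: "(a (Suc j))\<^sup>2 \<le> \<kappa> * (a j * a (Suc (Suc j)))" if "Suc (Suc j) \<le> s" for j
    using interpolation[OF u that] unfolding a_def \<kappa>_def by (simp add: sobolev_form_nonneg)
  have step: "a j \<le> \<kappa> ^ j * \<epsilon> * a (Suc j)" if "j < s" for j
    using that
  proof (induction j)
    case 0
    then show ?case using poincare a0 by (simp add: a_def)
  next
    case (Suc j)
    have "a (Suc j) * a (Suc j) \<le> \<kappa> * (a j * a (Suc (Suc j)))"
      using conv[of j] Suc.prems by (simp add: power2_eq_square)
    also have "\<dots> \<le> \<kappa> * ((\<kappa> ^ j * \<epsilon> * a (Suc j)) * a (Suc (Suc j)))"
      using Suc \<kappa> ann by (intro mult_left_mono mult_right_mono) auto
    also have "\<dots> = a (Suc j) * (\<kappa> ^ Suc j * \<epsilon> * a (Suc (Suc j)))" by (simp add: mult_ac)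
    \<comment> \<open>A factor \<open>a (Suc j)\<close> is cancelled; where it is zero, the claim is
      trivial.\<close>
    finally show ?case
      using ann[of "Suc j"] ann[of "Suc (Suc j)"] \<epsilon> \<kappa>
      by (cases "a (Suc j) = 0") (auto simp: mult_le_cancel_left)
  qed
  have "a 0 \<le> (\<kappa> ^ s) ^ j * \<epsilon> ^ j * a j" if "j \<le> s" for j
    using that
  proof (induction j)
    case (Suc j)
    have "a 0 \<le> (\<kappa> ^ s) ^ j * \<epsilon> ^ j * a j" using Suc by simp
    also have "\<dots> \<le> (\<kappa> ^ s) ^ j * \<epsilon> ^ j * (\<kappa> ^ s * \<epsilon> * a (Suc j))"
    proof (intro mult_left_mono)
      have "a j \<le> \<kappa> ^ j * \<epsilon> * a (Suc j)" using step Suc by simp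
      \<comment> \<open>The varying powers of \<open>\<kappa>\<close> are all replaced by
        \<open>\<kappa> ^ s\<close>, which accounts for the exponent \<open>s * s\<close> of the
        result.\<close>
      also have "\<dots> \<le> \<kappa> ^ s * \<epsilon> * a (Suc j)"
        using \<kappa> \<epsilon> ann Suc.prems by (intro mult_right_mono power_increasing) auto
      finally show "a j \<le> \<kappa> ^ s * \<epsilon> * a (Suc j)" .
    qed (use \<kappa> \<epsilon> in auto)
    also have "\<dots> = (\<kappa> ^ s) ^ Suc j * \<epsilon> ^ Suc j * a (Suc j)" by (simp add: mult_ac)
    finally show ?case .
  qed simp
  from this[of s] have "a 0 \<le> \<kappa> ^ (s * s) * \<epsilon> ^ s * a s" by (simp add: power_mult)
  also have "\<dots> \<le> \<kappa> ^ (s * s) * \<epsilon> ^ s * sobolev_norm \<Omega> s u"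
    unfolding a_def using \<kappa> \<epsilon> by (intro mult_left_mono sobolev_form_mono) auto
  finally show ?thesis using a0 \<kappa>_def by simp
qed

end

section \<open>The Poincare inequality on convex cells\<close>

text \<open>The Jacobian is the power \<open>DIM('a)\<close> of \<open>c\<close>, and
  \<open>c\<close> is at least 1/2. This is the source of the power of 2 in the Poincare
  constant.\<close>

lemma nn_integral_affine_le:
  fixes h :: "'a::euclidean_space \<Rightarrow> ennreal"
  assumes [measurable]: "h \<in> borel_measurable borel" and c: "1/2 \<le> c"
  shows "(\<integral>\<^sup>+y. h (a + c *\<^sub>R y) \<partial>lborel) \<le> 2 ^ DIM('a) * (\<integral>\<^sup>+y. h y \<partial>lborel)"
proof -
  have c0: "c \<noteq> 0" using c by auto
  have "(\<integral>\<^sup>+y. h y \<partial>lborel) = (\<integral>\<^sup>+y. h y \<partial>density (distr lborel borel (\<lambda>x. a + c *\<^sub>R x)) (\<lambda>_. ennreal (\<bar>c\<bar> ^ DIM('a))))"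
    using lborel_affine[OF c0, of a] by simp
  also have "\<dots> = ennreal (\<bar>c\<bar> ^ DIM('a)) * (\<integral>\<^sup>+y. h (a + c *\<^sub>R y) \<partial>lborel)"
    by (simp add: nn_integral_density nn_integral_distr nn_integral_cmult)
  finally have eq: "(\<integral>\<^sup>+y. h y \<partial>lborel) = ennreal (\<bar>c\<bar> ^ DIM('a)) * (\<integral>\<^sup>+y. h (a + c *\<^sub>R y) \<partial>lborel)" .
  have "1 \<le> (2 * \<bar>c\<bar>) ^ DIM('a)" using c by (intro one_le_power) auto
  then have "ennreal 1 \<le> ennreal (2 ^ DIM('a) * \<bar>c\<bar> ^ DIM('a))"
    by (intro ennreal_leI) (simp add: power_mult_distrib)
  also have "\<dots> = 2 ^ DIM('a) * ennreal (\<bar>c\<bar> ^ DIM('a))"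
    by (simp add: ennreal_mult ennreal_power[symmetric])
  finally have "1 * (\<integral>\<^sup>+y. h (a + c *\<^sub>R y) \<partial>lborel) \<le> (2 ^ DIM('a) * ennreal (\<bar>c\<bar> ^ DIM('a))) * (\<integral>\<^sup>+y. h (a + c *\<^sub>R y) \<partial>lborel)"
    by (intro mult_right_mono) auto
  then show ?thesis unfolding eq by (simp add: mult.assoc)
qed

text \<open>On each segment, use the endpoint that is farther away as integration variable.\<close>

lemma nn_integral_segments_le:
  fixes G :: "'a::euclidean_space \<Rightarrow> ennreal"
  assumes G[measurable]: "G \<in> borel_measurable borel" and U[measurable]: "U \<in> sets borel" and "convex U"
  shows "(\<integral>\<^sup>+x. indicator U x * (\<integral>\<^sup>+y. indicator U y * (\<integral>\<^sup>+t. indicator {0..1} t * G (x + t *\<^sub>R (y - x)) \<partial>lborel) \<partial>lborel) \<partial>lborel)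
    \<le> 2 ^ DIM('a) * emeasure lborel U * (\<integral>\<^sup>+x. indicator U x * G x \<partial>lborel)"
proof -
  define F where "F x y t = indicator U x * (indicator U y * (indicator {0..1} t * G (x + t *\<^sub>R (y - x))))" for x y and t :: real
  define I where "I = (\<integral>\<^sup>+x. indicator U x * G x \<partial>lborel)"
  have Fm[measurable]: "(\<lambda>(x, y, t). F x y t) \<in> borel_measurable (lborel \<Otimes>\<^sub>M lborel \<Otimes>\<^sub>M lborel)"
    unfolding F_def by measurable
  have bound: "(\<integral>\<^sup>+y. indicator U x * (indicator U y * G (x + t *\<^sub>R (y - x))) \<partial>lborel) \<le> indicator U x * (2 ^ DIM('a) * I)"
    if "1/2 \<le> t" "t \<le> 1" for x t
  proof (cases "x \<in> U")
    case True
    have "(\<integral>\<^sup>+y. indicator U x * (indicator U y * G (x + t *\<^sub>R (y - x))) \<partial>lborel) \<le>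
      (\<integral>\<^sup>+y. indicator U ((1 - t) *\<^sub>R x + t *\<^sub>R y) * G ((1 - t) *\<^sub>R x + t *\<^sub>R y) \<partial>lborel)"
    proof (rule nn_integral_mono)
      fix y
      have e: "x + t *\<^sub>R (y - x) = (1 - t) *\<^sub>R x + t *\<^sub>R y" by (simp add: algebra_simps)
      \<comment> \<open>Convexity keeps the point of the segment in \<open>U\<close>, so the
        indicator of \<open>U\<close> at that point may be inserted before the substitution.\<close>
      have "(1 - t) *\<^sub>R x + t *\<^sub>R y \<in> U" if "y \<in> U"
        using \<open>convex U\<close> True that \<open>1/2 \<le> t\<close> \<open>t \<le> 1\<close> by (intro convexD) auto
      then show "indicator U x * (indicator U y * G (x + t *\<^sub>R (y - x))) \<le>
        indicator U ((1 - t) *\<^sub>R x + t *\<^sub>R y) * G ((1 - t) *\<^sub>R x + t *\<^sub>R y)"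
        unfolding e by (auto simp: indicator_def)
    qed
    also have "\<dots> \<le> 2 ^ DIM('a) * I"
      unfolding I_def by (rule nn_integral_affine_le[OF _ that(1)]) measurable
    finally show ?thesis using True by simp
  qed simp
  have K: "(\<integral>\<^sup>+x. (\<integral>\<^sup>+y. F x y t \<partial>lborel) \<partial>lborel) \<le> indicator {0..1} t * (2 ^ DIM('a) * emeasure lborel U * I)" for t
  proof -
    consider "t \<notin> {0..1}" | "1/2 \<le> t" "t \<le> 1" | "0 \<le> t" "t \<le> 1/2" by fastforce
    then show ?thesis
    proof cases
      case 2
      have "(\<integral>\<^sup>+x. (\<integral>\<^sup>+y. F x y t \<partial>lborel) \<partial>lborel) \<le> (\<integral>\<^sup>+x. indicator U x * (2 ^ DIM('a) * I) \<partial>lborel)"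
        using bound[OF 2] 2 by (intro nn_integral_mono) (simp add: F_def)
      also have "\<dots> = emeasure lborel U * (2 ^ DIM('a) * I)"
        by (subst nn_integral_multc) auto
      finally show ?thesis using 2 by (simp add: mult_ac)
    next
      case 3
      have "(\<integral>\<^sup>+x. (\<integral>\<^sup>+y. F x y t \<partial>lborel) \<partial>lborel) = (\<integral>\<^sup>+y. (\<integral>\<^sup>+x. F x y t \<partial>lborel) \<partial>lborel)"
        by (rule lborel_pair.Fubini'[symmetric]) (unfold F_def, measurable)
      also have "\<dots> \<le> (\<integral>\<^sup>+y. indicator U y * (2 ^ DIM('a) * I) \<partial>lborel)"
      proof (rule nn_integral_mono)
        fix y
        \<comment> \<open>Read from the other endpoint, the segment has parameter
          \<open>1 - t\<close>, which is at least 1/2 in this case.\<close>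
        have "F x y t = indicator U y * (indicator U x * G (y + (1 - t) *\<^sub>R (x - y)))" for x
          using 3 by (simp add: F_def algebra_simps)
        then show "(\<integral>\<^sup>+x. F x y t \<partial>lborel) \<le> indicator U y * (2 ^ DIM('a) * I)"
          using bound[of "1 - t" y] 3 by simp
      qed
      also have "\<dots> = emeasure lborel U * (2 ^ DIM('a) * I)"
        by (subst nn_integral_multc) auto
      finally show ?thesis using 3 by (simp add: mult_ac)
    qed (simp add: F_def)
  qed
  have "(\<integral>\<^sup>+x. indicator U x * (\<integral>\<^sup>+y. indicator U y * (\<integral>\<^sup>+t. indicator {0..1} t * G (x + t *\<^sub>R (y - x)) \<partial>lborel) \<partial>lborel) \<partial>lborel)
    = (\<integral>\<^sup>+x. (\<integral>\<^sup>+y. (\<integral>\<^sup>+t. F x y t \<partial>lborel) \<partial>lborel) \<partial>lborel)"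
    unfolding F_def
    by (simp add: nn_integral_cmult[symmetric] del: nn_integral_indicator_singleton')
  also have "\<dots> = (\<integral>\<^sup>+x. (\<integral>\<^sup>+t. (\<integral>\<^sup>+y. F x y t \<partial>lborel) \<partial>lborel) \<partial>lborel)"
    by (intro nn_integral_cong lborel_pair.Fubini'[symmetric]) (unfold F_def, measurable)
  also have "\<dots> = (\<integral>\<^sup>+t. (\<integral>\<^sup>+x. (\<integral>\<^sup>+y. F x y t \<partial>lborel) \<partial>lborel) \<partial>lborel)"
    by (intro lborel_pair.Fubini'[symmetric]) (unfold F_def, measurable)
  also have "\<dots> \<le> (\<integral>\<^sup>+t. indicator {0..1::real} t * (2 ^ DIM('a) * emeasure lborel U * I) \<partial>lborel)"
    by (intro nn_integral_mono K)
  also have "\<dots> = 2 ^ DIM('a) * emeasure lborel U * I"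
    by (subst nn_integral_multc) auto
  finally show ?thesis unfolding I_def .
qed

text \<open>Jensen's inequality on the unit interval, obtained from the nonnegative variance of
  \<open>f\<close> about its mean \<open>F 1 - F 0\<close>.\<close>

lemma square_increment_le:
  fixes F f :: "real \<Rightarrow> real"
  assumes D: "\<And>t. (F has_real_derivative f t) (at t)" and f: "continuous_on UNIV f"
  shows "ennreal ((F 1 - F 0)\<^sup>2) \<le> (\<integral>\<^sup>+t. indicator {0..1} t * ennreal ((f t)\<^sup>2) \<partial>lborel)"
proof -
  define c where "c = F 1 - F 0"
  have cont: "isCont f x" for x using f by (simp add: continuous_on_eq_continuous_at)
  have i1: "integrable lborel (\<lambda>t. f t * indicator {0..1} t)"
    by (rule borel_integrable_atLeastAtMost) (rule cont)
  have i2: "integrable lborel (\<lambda>t. (f t)\<^sup>2 * indicator {0..1} t)"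
    by (rule borel_integrable_atLeastAtMost) (intro continuous_intros cont)
  have i3: "integrable lborel (\<lambda>t. indicator {0..1::real} t :: real)"
    by (rule integrable_real_indicator) auto
  have c: "(\<integral>t. f t * indicator {0..1} t \<partial>lborel) = c"
    unfolding c_def by (rule integral_FTC_Icc_real) (auto intro: D cont)
  have "0 \<le> (\<integral>t. (f t - c)\<^sup>2 * indicator {0..1} t \<partial>lborel)"
    by (intro integral_nonneg_AE AE_I2) simp
  also have "(\<lambda>t. (f t - c)\<^sup>2 * indicator {0..1} t) =
     (\<lambda>t. (f t)\<^sup>2 * indicator {0..1} t - (2 * c) * (f t * indicator {0..1} t) + c\<^sup>2 * indicator {0..1} t)"
    by (auto simp: power2_diff algebra_simps)
  also have "(\<integral>t. (f t)\<^sup>2 * indicator {0..1} t - (2 * c) * (f t * indicator {0..1} t) + c\<^sup>2 * indicator {0..1} t \<partial>lborel) =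
     (\<integral>t. (f t)\<^sup>2 * indicator {0..1} t \<partial>lborel) - (2 * c) * c + c\<^sup>2 * 1"
    using i1 i2 i3 c by (simp del: integral_mult_right_zero)
  finally have "c\<^sup>2 \<le> (\<integral>t. (f t)\<^sup>2 * indicator {0..1} t \<partial>lborel)" by (simp add: power2_eq_square)
  then have "ennreal (c\<^sup>2) \<le> ennreal (\<integral>t. (f t)\<^sup>2 * indicator {0..1} t \<partial>lborel)" by (rule ennreal_leI)
  also have "\<dots> = (\<integral>\<^sup>+t. ennreal ((f t)\<^sup>2 * indicator {0..1} t) \<partial>lborel)"
    by (rule nn_integral_eq_integral[symmetric]) (use i2 in auto)
  also have "\<dots> = (\<integral>\<^sup>+t. indicator {0..1} t * ennreal ((f t)\<^sup>2) \<partial>lborel)"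
    by (intro nn_integral_cong) (auto simp: indicator_def)
  finally show ?thesis unfolding c_def .
qed

definition grad_square :: "(real^'n \<Rightarrow> real) \<Rightarrow> real^'n \<Rightarrow> real" where
  "grad_square \<phi> x = (\<Sum>i\<in>UNIV. (partial i \<phi> x)\<^sup>2)"

lemma grad_square_nonneg: "0 \<le> grad_square \<phi> x"
  unfolding grad_square_def by (intro sum_nonneg) auto

lemma smooth_square_increment_le:
  assumes s: "smooth_function \<phi>"
  shows "ennreal ((\<phi> x - \<phi> y)\<^sup>2) \<le> ennreal ((dist x y)\<^sup>2) * (\<integral>\<^sup>+t. indicator {0..1} t * ennreal (grad_square \<phi> (x + t *\<^sub>R (y - x))) \<partial>lborel)"
proof -
  define f where "f t = (\<Sum>i\<in>UNIV. (y - x) $ i * partial i \<phi> (x + t *\<^sub>R (y - x)))" for t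
  have c: "continuous_on UNIV f"
    unfolding f_def
    by (intro continuous_intros continuous_on_compose2[OF smooth_continuous[OF smooth_partial[OF s], of UNIV]]) auto
  have b: "(f t)\<^sup>2 \<le> (dist x y)\<^sup>2 * grad_square \<phi> (x + t *\<^sub>R (y - x))" for t
  proof -
    have "(f t)\<^sup>2 \<le> (\<Sum>i\<in>UNIV. ((y - x) $ i)\<^sup>2) * (\<Sum>i\<in>UNIV. (partial i \<phi> (x + t *\<^sub>R (y - x)))\<^sup>2)"
      unfolding f_def by (rule Cauchy_Schwarz_ineq_sum)
    also have "(\<Sum>i\<in>UNIV. ((y - x) $ i)\<^sup>2) = (dist x y)\<^sup>2"
      by (simp add: dist_norm norm_vec_def L2_set_def sum_nonneg power2_commute)
    finally show ?thesis unfolding grad_square_def .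
  qed
  have gm: "(\<lambda>t. indicator {0..1} t * ennreal (grad_square \<phi> (x + t *\<^sub>R (y - x)))) \<in> borel_measurable lborel"
  proof -
    have [measurable]: "partial i \<phi> \<in> borel_measurable borel" for i
      by (rule smooth_borel[OF smooth_partial[OF s]])
    show ?thesis unfolding grad_square_def by measurable
  qed
  have "ennreal ((\<phi> (x + 1 *\<^sub>R (y - x)) - \<phi> (x + 0 *\<^sub>R (y - x)))\<^sup>2) \<le> (\<integral>\<^sup>+t. indicator {0..1} t * ennreal ((f t)\<^sup>2) \<partial>lborel)"
    by (rule square_increment_le[OF _ c]) (unfold f_def, rule smooth_line_derivative[OF s])
  also have "\<dots> \<le> (\<integral>\<^sup>+t. ennreal ((dist x y)\<^sup>2) * (indicator {0..1} t * ennreal (grad_square \<phi> (x + t *\<^sub>R (y - x)))) \<partial>lborel)"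
    using b by (intro nn_integral_mono)
      (auto simp: indicator_def ennreal_mult[symmetric] grad_square_nonneg intro!: ennreal_leI)
  also have "\<dots> = ennreal ((dist x y)\<^sup>2) * (\<integral>\<^sup>+t. indicator {0..1} t * ennreal (grad_square \<phi> (x + t *\<^sub>R (y - x))) \<partial>lborel)"
    by (rule nn_integral_cmult[OF gm])
  finally show ?thesis by (simp add: power2_commute)
qed

lemma test_function_grad_square:
  assumes "test_function \<Omega> \<phi>"
  shows "test_function \<Omega> (grad_square \<phi>)"
proof -
  have "test_function \<Omega> (\<lambda>x. \<Sum>i\<in>UNIV. 1 * (partial i \<phi> x * partial i \<phi> x))"
    by (intro test_function_sum test_function_mult test_function_partial
        test_function_smooth[OF test_function_partial[OF assms]] assms) auto
  then show ?thesis unfolding grad_square_def[abs_def] by (simp add: power2_eq_square)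
qed

text \<open>Integrate the squared difference of two values of \<open>\<phi>\<close> over pairs of
  points of \<open>U\<close>. Expanding gives twice the volume times the second moment, minus twice
  the squared first moment; the segment estimate bounds it by the gradient, points of
  \<open>U\<close> being at most \<open>2 * r\<close> apart. Halving leaves
  \<open>2 * r\<^sup>2\<close>.\<close>

lemma poincare_open_convex:
  fixes \<phi> :: "real^'n \<Rightarrow> real"
  assumes t: "test_function \<Omega> \<phi>" and U: "open U" "convex U" "U \<subseteq> cball z r"
  shows "measure lborel U * (\<integral>x. indicator U x * (\<phi> x)\<^sup>2 \<partial>lborel) \<le>
    (\<integral>x. indicator U x * \<phi> x \<partial>lborel)\<^sup>2 +
    2 ^ CARD('n) * (2 * r\<^sup>2) * measure lborel U * (\<integral>x. indicator U x * grad_square \<phi> x \<partial>lborel)"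
proof -
  define m where "m = measure lborel U"
  define a where "a = (\<integral>x. indicator U x * (\<phi> x)\<^sup>2 \<partial>lborel)"
  define b where "b = (\<integral>x. indicator U x * \<phi> x \<partial>lborel)"
  define g where "g = (\<integral>x. indicator U x * grad_square \<phi> x \<partial>lborel)"
  have Um[measurable]: "U \<in> sets borel" using U by auto
  have fin: "emeasure lborel U < \<infinity>"
    using emeasure_mono[OF U(3), of lborel] emeasure_lborel_cball_finite[of z r]
    by (simp add: less_top top_unique)
  have em: "emeasure lborel U = ennreal m" unfolding m_def using fin by (simp add: emeasure_eq_ennreal_measure)
  have t2: "test_function \<Omega> (\<lambda>x. (\<phi> x)\<^sup>2)"
    unfolding power2_eq_square by (intro test_function_mult t test_function_smooth[OF t])
  have tg: "test_function \<Omega> (grad_square \<phi>)" by (rule test_function_grad_square[OF t])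
  have ii: "integrable lborel (\<lambda>x. indicator U x * f x)" if "test_function \<Omega> f" for f :: "real^'n \<Rightarrow> real"
    using integrable_mult_indicator[OF _ test_function_integrable[OF that], of U] by simp
  have ic: "integrable lborel (\<lambda>x. indicator U x :: real)"
    using fin by (intro integrable_real_indicator) auto
  have diff: "integrable lborel (\<lambda>y. indicator U y * (\<phi> x - \<phi> y)\<^sup>2)"
    "(\<integral>y. indicator U y * (\<phi> x - \<phi> y)\<^sup>2 \<partial>lborel) = m * (\<phi> x)\<^sup>2 - 2 * b * \<phi> x + a" for x
  proof -
    have e: "(\<lambda>y. indicator U y * (\<phi> x - \<phi> y)\<^sup>2) = (\<lambda>y. (\<phi> x)\<^sup>2 * indicator U y - (2 * \<phi> x) * (indicator U y * \<phi> y) + indicator U y * (\<phi> y)\<^sup>2)"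
      by (auto simp: power2_diff algebra_simps)
    show "integrable lborel (\<lambda>y. indicator U y * (\<phi> x - \<phi> y)\<^sup>2)"
      unfolding e using ii[OF t] ii[OF t2] ic by (intro Bochner_Integration.integrable_add Bochner_Integration.integrable_diff integrable_mult_right)
    have "(\<integral>y. indicator U y * (\<phi> x - \<phi> y)\<^sup>2 \<partial>lborel) = (\<phi> x)\<^sup>2 * m - (2 * \<phi> x) * b + a"
      unfolding e a_def b_def m_def using ii[OF t] ii[OF t2] ic
      by (subst Bochner_Integration.integral_add Bochner_Integration.integral_diff; simp)+
    then show "(\<integral>y. indicator U y * (\<phi> x - \<phi> y)\<^sup>2 \<partial>lborel) = m * (\<phi> x)\<^sup>2 - 2 * b * \<phi> x + a"
      by (simp add: mult_ac)
  qed
  have inn: "0 \<le> m * (\<phi> x)\<^sup>2 - 2 * b * \<phi> x + a" for x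
    unfolding diff(2)[symmetric] by (intro integral_nonneg_AE AE_I2) simp
  have inner: "(\<integral>\<^sup>+y. indicator U y * ennreal ((\<phi> x - \<phi> y)\<^sup>2) \<partial>lborel) = ennreal (m * (\<phi> x)\<^sup>2 - 2 * b * \<phi> x + a)" for x
  proof -
    have "(\<integral>\<^sup>+y. indicator U y * ennreal ((\<phi> x - \<phi> y)\<^sup>2) \<partial>lborel) = (\<integral>\<^sup>+y. ennreal (indicator U y * (\<phi> x - \<phi> y)\<^sup>2) \<partial>lborel)"
      by (intro nn_integral_cong) (auto simp: indicator_def)
    also have "\<dots> = ennreal (\<integral>y. indicator U y * (\<phi> x - \<phi> y)\<^sup>2 \<partial>lborel)"
      by (rule nn_integral_eq_integral[OF diff(1)]) auto
    finally show ?thesis unfolding diff(2) .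
  qed
  have double_integral: "(\<integral>\<^sup>+x. indicator U x * (\<integral>\<^sup>+y. indicator U y * ennreal ((\<phi> x - \<phi> y)\<^sup>2) \<partial>lborel) \<partial>lborel) = ennreal (2 * (m * a - b\<^sup>2))"
  proof -
    have e: "(\<lambda>x. indicator U x * (m * (\<phi> x)\<^sup>2 - 2 * b * \<phi> x + a)) =
      (\<lambda>x. m * (indicator U x * (\<phi> x)\<^sup>2) - (2 * b) * (indicator U x * \<phi> x) + a * indicator U x)"
      by (auto simp: algebra_simps)
    have i: "integrable lborel (\<lambda>x. indicator U x * (m * (\<phi> x)\<^sup>2 - 2 * b * \<phi> x + a))"
      unfolding e using ii[OF t] ii[OF t2] ic by (intro Bochner_Integration.integrable_add Bochner_Integration.integrable_diff integrable_mult_right)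
    have "(\<integral>\<^sup>+x. indicator U x * (\<integral>\<^sup>+y. indicator U y * ennreal ((\<phi> x - \<phi> y)\<^sup>2) \<partial>lborel) \<partial>lborel) =
      (\<integral>\<^sup>+x. ennreal (indicator U x * (m * (\<phi> x)\<^sup>2 - 2 * b * \<phi> x + a)) \<partial>lborel)"
      unfolding inner by (intro nn_integral_cong) (auto simp: indicator_def)
    also have "\<dots> = ennreal (\<integral>x. indicator U x * (m * (\<phi> x)\<^sup>2 - 2 * b * \<phi> x + a) \<partial>lborel)"
      by (rule nn_integral_eq_integral[OF i]) (auto simp: inn)
    also have "(\<integral>x. indicator U x * (m * (\<phi> x)\<^sup>2 - 2 * b * \<phi> x + a) \<partial>lborel) = m * a - (2 * b) * b + a * m"
      unfolding e unfolding a_def b_def m_def using ii[OF t] ii[OF t2] ic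
      by (subst Bochner_Integration.integral_add Bochner_Integration.integral_diff; simp)+
    finally show ?thesis by (simp add: algebra_simps power2_eq_square)
  qed
  have "ennreal (2 * (m * a - b\<^sup>2)) \<le>
    (\<integral>\<^sup>+x. indicator U x * (\<integral>\<^sup>+y. indicator U y * (\<integral>\<^sup>+t. indicator {0..1} t * ennreal ((2 * r)\<^sup>2 * grad_square \<phi> (x + t *\<^sub>R (y - x))) \<partial>lborel) \<partial>lborel) \<partial>lborel)"
    unfolding double_integral[symmetric]
  proof (intro nn_integral_mono)
    fix x
    have "indicator U y * ennreal ((\<phi> x - \<phi> y)\<^sup>2) \<le>
      indicator U y * (\<integral>\<^sup>+t. indicator {0..1} t * ennreal ((2 * r)\<^sup>2 * grad_square \<phi> (x + t *\<^sub>R (y - x))) \<partial>lborel)"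
      if x: "x \<in> U" for y
    proof (cases "y \<in> U")
      case True
      have "dist x y \<le> dist x z + dist z y" by (rule dist_triangle)
      moreover have "dist z x \<le> r" "dist z y \<le> r" using U(3) x True by auto
      ultimately have "dist x y \<le> 2 * r" by (simp add: dist_commute)
      then have d: "(dist x y)\<^sup>2 \<le> (2 * r)\<^sup>2" by (intro power_mono) auto
      have gm: "(\<lambda>t. indicator {0..1} t * ennreal (grad_square \<phi> (x + t *\<^sub>R (y - x)))) \<in> borel_measurable lborel"
      proof -
        have [measurable]: "grad_square \<phi> \<in> borel_measurable borel" by (rule test_function_borel[OF tg])
        show ?thesis by measurable
      qed
      have "ennreal ((\<phi> x - \<phi> y)\<^sup>2) \<le> ennreal ((dist x y)\<^sup>2) * (\<integral>\<^sup>+t. indicator {0..1} t * ennreal (grad_square \<phi> (x + t *\<^sub>R (y - x))) \<partial>lborel)"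
        by (rule smooth_square_increment_le[OF test_function_smooth[OF t]])
      also have "\<dots> \<le> ennreal ((2 * r)\<^sup>2) * (\<integral>\<^sup>+t. indicator {0..1} t * ennreal (grad_square \<phi> (x + t *\<^sub>R (y - x))) \<partial>lborel)"
        using d by (intro mult_right_mono ennreal_leI) auto
      also have "\<dots> = (\<integral>\<^sup>+t. ennreal ((2 * r)\<^sup>2) * (indicator {0..1} t * ennreal (grad_square \<phi> (x + t *\<^sub>R (y - x)))) \<partial>lborel)"
        by (rule nn_integral_cmult[OF gm, symmetric])
      also have "\<dots> = (\<integral>\<^sup>+t. indicator {0..1} t * ennreal ((2 * r)\<^sup>2 * grad_square \<phi> (x + t *\<^sub>R (y - x))) \<partial>lborel)"
        by (intro nn_integral_cong) (simp add: ennreal_mult grad_square_nonneg mult_ac)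
      finally show ?thesis using True by simp
    qed simp
    then show "indicator U x * (\<integral>\<^sup>+y. indicator U y * ennreal ((\<phi> x - \<phi> y)\<^sup>2) \<partial>lborel) \<le>
      indicator U x * (\<integral>\<^sup>+y. indicator U y * (\<integral>\<^sup>+t. indicator {0..1} t * ennreal ((2 * r)\<^sup>2 * grad_square \<phi> (x + t *\<^sub>R (y - x))) \<partial>lborel) \<partial>lborel)"
      by (cases "x \<in> U") (auto intro!: nn_integral_mono)
  qed
  also have "\<dots> \<le> 2 ^ DIM(real^'n) * emeasure lborel U * (\<integral>\<^sup>+x. indicator U x * ennreal ((2 * r)\<^sup>2 * grad_square \<phi> x) \<partial>lborel)"
  proof (rule nn_integral_segments_le[OF _ Um U(2)])
    have [measurable]: "grad_square \<phi> \<in> borel_measurable borel" by (rule test_function_borel[OF tg])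
    show "(\<lambda>x. ennreal ((2 * r)\<^sup>2 * grad_square \<phi> x)) \<in> borel_measurable borel" by measurable
  qed
  also have "(\<integral>\<^sup>+x. indicator U x * ennreal ((2 * r)\<^sup>2 * grad_square \<phi> x) \<partial>lborel) = (\<integral>\<^sup>+x. ennreal ((2 * r)\<^sup>2 * (indicator U x * grad_square \<phi> x)) \<partial>lborel)"
    by (intro nn_integral_cong) (auto simp: indicator_def)
  also have "\<dots> = ennreal ((2 * r)\<^sup>2 * g)"
    unfolding g_def
    by (subst nn_integral_eq_integral) (use ii[OF tg] in \<open>auto intro!: AE_I2 mult_nonneg_nonneg grad_square_nonneg\<close>)
  also have "2 ^ DIM(real^'n) * emeasure lborel U * ennreal ((2 * r)\<^sup>2 * g) = ennreal (2 ^ CARD('n) * m * ((2 * r)\<^sup>2 * g))"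
  proof -
    have "0 \<le> g" unfolding g_def by (intro integral_nonneg_AE AE_I2) (simp add: grad_square_nonneg)
    then show ?thesis unfolding em
      by (simp add: ennreal_mult ennreal_power[symmetric] m_def)
  qed
  finally have "ennreal (2 * (m * a - b\<^sup>2)) \<le> ennreal (2 ^ CARD('n) * m * ((2 * r)\<^sup>2 * g))" .
  moreover have "0 \<le> 2 ^ CARD('n) * m * ((2 * r)\<^sup>2 * g)"
    unfolding m_def g_def by (intro mult_nonneg_nonneg integral_nonneg_AE AE_I2) (auto simp: grad_square_nonneg)
  ultimately have "2 * (m * a - b\<^sup>2) \<le> 2 ^ CARD('n) * m * ((2 * r)\<^sup>2 * g)"
    by (simp add: ennreal_le_iff)
  then show ?thesis unfolding a_def[symmetric] b_def[symmetric] m_def[symmetric] g_def[symmetric]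
    by (simp add: algebra_simps power2_eq_square)
qed

section \<open>Partitions into convex cells\<close>

text \<open>One level of the hierarchy in isolation; the radii are later \<open>h ^ l\<close> and
  \<open>\<delta> * h ^ l\<close>. Measurability of the cells and their finite number are derived
  below.\<close>

locale cell_partition = bounded_open \<Omega> for \<Omega> :: "(real^'n) set" +
  fixes P :: "(real^'n) set set" and r \<rho> :: real
  assumes partition: "partition_on \<Omega> P" and radius_pos: "0 < \<rho>"
    and cell_convex: "T \<in> P \<Longrightarrow> convex T"
    and cell_outer: "T \<in> P \<Longrightarrow> \<exists>y. T \<subseteq> cball y r"
    and cell_inner: "T \<in> P \<Longrightarrow> \<exists>y. ball y \<rho> \<subseteq> T"
begin

definition vol :: "(real^'n) set \<Rightarrow> real" where "vol T = measure lebesgue T"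

abbreviation ind :: "(real^'n) set \<Rightarrow> real^'n \<Rightarrow> real" where "ind T \<equiv> indicat_real T"

lemma cell_subset: "T \<in> P \<Longrightarrow> T \<subseteq> \<Omega>"
  using partition by (auto simp: partition_on_def)

lemma cells_disjoint: "T \<in> P \<Longrightarrow> T' \<in> P \<Longrightarrow> x \<in> T \<Longrightarrow> x \<in> T' \<Longrightarrow> T = T'"
  using partition by (auto simp: partition_on_def disjoint_def)

lemma cell_exists: "x \<in> \<Omega> \<Longrightarrow> \<exists>T\<in>P. x \<in> T"
  using partition by (auto simp: partition_on_def)

lemma cell_lmeasurable: "T \<in> P \<Longrightarrow> T \<in> lmeasurable"
  by (intro measurable_convex cell_convex bounded_subset[OF bounded_domain cell_subset])

lemma domain_lmeasurable: "\<Omega> \<in> lmeasurable"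
  using bounded_domain open_domain by (rule lmeasurable_open)

text \<open>Stated for finite subfamilies because the finiteness of \<open>P\<close> is itself
  deduced from this volume bound.\<close>

lemma sum_vol_le:
  assumes "finite F" "F \<subseteq> P"
  shows "(\<Sum>T\<in>F. vol T) \<le> vol \<Omega>" and "\<Union>F = \<Omega> \<Longrightarrow> (\<Sum>T\<in>F. vol T) = vol \<Omega>"
proof -
  have eq: "measure lebesgue (\<Union>T\<in>F. T) = (\<Sum>T\<in>F. measure lebesgue T)"
  proof (rule measure_finite_Union[OF assms(1)])
    show "(\<lambda>T. T) ` F \<subseteq> sets lebesgue" using cell_lmeasurable assms(2) by blast
    show "disjoint_family_on (\<lambda>T. T) F"
      using assms(2) cells_disjoint unfolding disjoint_family_on_def by blast
    show "emeasure lebesgue T \<noteq> \<infinity>" if "T \<in> F" for T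
      using fmeasurableD2[OF cell_lmeasurable] assms(2) that by auto
  qed
  have "measure lebesgue (\<Union>T\<in>F. T) \<le> measure lebesgue \<Omega>"
  proof (rule measure_mono_fmeasurable)
    show "(\<Union>T\<in>F. T) \<subseteq> \<Omega>" using assms(2) cell_subset by blast
    show "(\<Union>T\<in>F. T) \<in> sets lebesgue" using assms cell_lmeasurable by (intro sets.finite_UN) auto
  qed (rule domain_lmeasurable)
  then show "(\<Sum>T\<in>F. vol T) \<le> vol \<Omega>" unfolding vol_def eq .
  show "\<Union>F = \<Omega> \<Longrightarrow> (\<Sum>T\<in>F. vol T) = vol \<Omega>" unfolding vol_def eq[symmetric] by simp
qed

lemma vol_ge: "T \<in> P \<Longrightarrow> unit_ball_vol (real CARD('n)) * \<rho> ^ CARD('n) \<le> vol T"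
proof -
  assume T: "T \<in> P"
  obtain y where y: "ball y \<rho> \<subseteq> T" using cell_inner[OF T] by blast
  have "measure lebesgue (ball y \<rho>) \<le> measure lebesgue T"
    by (rule measure_mono_fmeasurable[OF y _ cell_lmeasurable[OF T]]) simp
  then show ?thesis using radius_pos content_ball[of \<rho> y] by (simp add: vol_def)
qed

lemma vol_pos: "T \<in> P \<Longrightarrow> 0 < vol T"
  by (rule less_le_trans[OF _ vol_ge]) (use radius_pos in simp_all)

lemma outer_radius_pos: "T \<in> P \<Longrightarrow> 0 < r"
proof -
  assume T: "T \<in> P"
  obtain y z where y: "ball y \<rho> \<subseteq> T" and z: "T \<subseteq> cball z r" using cell_inner[OF T] cell_outer[OF T] by blast
  have "0 < vol T" by (rule vol_pos[OF T])
  moreover have "vol T \<le> measure lebesgue (cball z r)"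
    unfolding vol_def using cell_lmeasurable[OF T] by (intro measure_mono_fmeasurable[OF z]) auto
  ultimately have "0 < measure lebesgue (cball z r)" by linarith
  then show ?thesis using content_cball_gt_0_iff[of z r] by simp
qed

lemma vol_le: "T \<in> P \<Longrightarrow> vol T \<le> unit_ball_vol (real CARD('n)) * r ^ CARD('n)"
proof -
  assume T: "T \<in> P"
  obtain z where z: "T \<subseteq> cball z r" using cell_outer[OF T] by blast
  have "vol T \<le> measure lebesgue (cball z r)"
    unfolding vol_def using cell_lmeasurable[OF T] by (intro measure_mono_fmeasurable[OF z]) auto
  then show ?thesis using outer_radius_pos[OF T] content_cball[of r z] by simp
qed

lemma card_subset_le:
  assumes "finite F" "F \<subseteq> P"
  shows "real (card F) * (unit_ball_vol (real CARD('n)) * \<rho> ^ CARD('n)) \<le> vol \<Omega>"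
proof -
  have "(\<Sum>T\<in>F. unit_ball_vol (real CARD('n)) * \<rho> ^ CARD('n)) \<le> (\<Sum>T\<in>F. vol T)"
    using assms by (intro sum_mono vol_ge) auto
  then show ?thesis using sum_vol_le(1)[OF assms] by simp
qed

text \<open>Disjoint cells, each containing a ball of radius \<open>\<rho>\<close>, have to fit into
  a domain of finite volume, which bounds the size of every finite subfamily.\<close>

lemma finite_cells: "finite P"
proof -
  have p: "0 < unit_ball_vol (real CARD('n)) * \<rho> ^ CARD('n)" using radius_pos by simp
  have "card F \<le> nat \<lceil>vol \<Omega> / (unit_ball_vol (real CARD('n)) * \<rho> ^ CARD('n))\<rceil>" if "F \<subseteq> P" "finite F" for F
  proof -
    have "real (card F) \<le> vol \<Omega> / (unit_ball_vol (real CARD('n)) * \<rho> ^ CARD('n))"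
      using card_subset_le[OF that(2,1)] p by (simp add: pos_le_divide_eq)
    then show ?thesis by linarith
  qed
  then show ?thesis using finite_if_finite_subsets_card_bdd by blast
qed

lemma card_cells_le: "real (card P) * (unit_ball_vol (real CARD('n)) * \<rho> ^ CARD('n)) \<le> vol \<Omega>"
  by (rule card_subset_le[OF finite_cells order_refl])

lemma vol_domain_le: "vol \<Omega> \<le> real (card P) * (unit_ball_vol (real CARD('n)) * r ^ CARD('n))"
proof -
  have "vol \<Omega> = (\<Sum>T\<in>P. vol T)"
    using sum_vol_le(2)[OF finite_cells order_refl] partition by (simp add: partition_on_def)
  also have "\<dots> \<le> (\<Sum>T\<in>P. unit_ball_vol (real CARD('n)) * r ^ CARD('n))" by (intro sum_mono vol_le)
  finally show ?thesis by simp
qed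

lemma cell_sum_eq:
  assumes T: "T \<in> P" and "\<And>T'. T' \<in> P \<Longrightarrow> T' \<noteq> T \<Longrightarrow> g T' = (0::real)"
  shows "(\<Sum>T'\<in>P. g T') = g T"
proof -
  have "(\<Sum>T'\<in>P. g T') = g T + (\<Sum>T'\<in>P - {T}. g T')" by (rule sum.remove[OF finite_cells T])
  also have "(\<Sum>T'\<in>P - {T}. g T') = 0" by (rule sum.neutral) (use assms in auto)
  finally show ?thesis by simp
qed

section \<open>Step functions on the cells\<close>

lemma sum_ind: "x \<in> T \<Longrightarrow> T \<in> P \<Longrightarrow> (\<Sum>T'\<in>P. c T' * ind T' x) = c T"
  by (subst cell_sum_eq[of T]) (auto simp: indicator_def dest: cells_disjoint)

lemma sum_ind_1: "x \<in> \<Omega> \<Longrightarrow> (\<Sum>T\<in>P. ind T x) = 1"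
  using cell_exists[of x] sum_ind[of x _ "\<lambda>_. 1"] by auto

lemma ind_measurable: "T \<in> P \<Longrightarrow> ind T \<in> borel_measurable (lebesgue_on \<Omega>)"
  using cell_lmeasurable by (intro measurable_restrict_space1 borel_measurable_indicator) auto

lemma ind_square_integrable: "T \<in> P \<Longrightarrow> square_integrable \<Omega> (ind T)"
proof -
  assume T: "T \<in> P"
  have "integrable (lebesgue_on \<Omega>) (ind T)"
    by (rule Bochner_Integration.integrable_bound[OF square_integrable_imp_integrable[OF square_integrable_const[of 1]] ind_measurable[OF T]])
      (auto simp: indicator_def)
  moreover have "(\<lambda>x. (ind T x)\<^sup>2) = ind T" by (auto simp: indicator_def)
  ultimately show ?thesis unfolding square_integrable_def using ind_measurable[OF T] by simp
qed

lemma integral_cell: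
  assumes T: "T \<in> P"
  shows "(LINT x|lebesgue_on \<Omega>. ind T x) = vol T"
proof -
  have "(LINT x|lebesgue_on \<Omega>. ind T x) = (LINT x|lebesgue_on \<Omega>. (if x \<in> T then 1 else 0))"
    by (intro Bochner_Integration.integral_cong) (auto simp: indicator_def)
  also have "\<dots> = (LINT x|lebesgue_on T. 1)"
    using T cell_subset cell_lmeasurable domain_lmeasurable by (intro integral_restrict) auto
  also have "\<dots> = vol T"
    using cell_lmeasurable[OF T] by (simp add: vol_def measure_restrict_space)
  finally show ?thesis .
qed

lemma l2_ind:
  assumes "T \<in> P" "T' \<in> P"
  shows "l2_inner \<Omega> (ind T) (ind T') = (if T = T' then vol T else 0)"
proof (cases "T = T'")
  case True
  have "l2_inner \<Omega> (ind T) (ind T') = (LINT x|lebesgue_on \<Omega>. ind T x)"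
    unfolding l2_inner_def using True by (intro Bochner_Integration.integral_cong) (auto simp: indicator_def)
  then show ?thesis unfolding integral_cell[OF assms(1)] using True by simp
next
  case False
  then have "l2_inner \<Omega> (ind T) (ind T') = (LINT x|lebesgue_on \<Omega>. 0)"
    unfolding l2_inner_def
    by (intro Bochner_Integration.integral_cong) (use cells_disjoint assms in \<open>auto simp: indicator_def\<close>)
  then show ?thesis using False by simp
qed

lemma l2_sum_ind:
  "l2_inner \<Omega> (\<lambda>x. \<Sum>T\<in>P. c T * ind T x) (\<lambda>x. \<Sum>T\<in>P. d T * ind T x) = (\<Sum>T\<in>P. c T * d T * vol T)"
proof -
  have "l2_inner \<Omega> (\<lambda>x. \<Sum>T\<in>P. c T * ind T x) (\<lambda>x. \<Sum>T\<in>P. d T * ind T x) =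
    (\<Sum>T\<in>P. c T * l2_inner \<Omega> (ind T) (\<lambda>x. \<Sum>T\<in>P. d T * ind T x))"
    by (rule l2_sum_left[OF finite_cells ind_square_integrable square_integrable_sum[OF finite_cells ind_square_integrable]])
  also have "\<dots> = (\<Sum>T\<in>P. c T * (\<Sum>T'\<in>P. d T' * l2_inner \<Omega> (ind T) (ind T')))"
    by (intro sum.cong refl arg_cong2[where f = "(*)"] l2_sum_right finite_cells ind_square_integrable)
  also have "\<dots> = (\<Sum>T\<in>P. c T * (d T * vol T))"
  proof (rule sum.cong[OF refl])
    fix T assume "T \<in> P"
    then have "(\<Sum>T'\<in>P. d T' * l2_inner \<Omega> (ind T) (ind T')) = d T * vol T"
      by (subst cell_sum_eq[of T]) (auto simp: l2_ind)
    then show "c T * (\<Sum>T'\<in>P. d T' * l2_inner \<Omega> (ind T) (ind T')) = c T * (d T * vol T)" by simp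
  qed
  finally show ?thesis by (simp add: mult.assoc)
qed

text \<open>A cell may contain any part of its frontier. By convexity the frontier is a null set, so
  the cell can be replaced by an open convex set, to which \<open>poincare_open_convex\<close>
  applies.\<close>

lemma integral_cell_interior:
  assumes T: "T \<in> P" and f: "f \<in> borel_measurable borel"
  shows "(LINT x|lebesgue_on \<Omega>. ind T x * f x) = (\<integral>x. ind (interior T) x * f x \<partial>lborel)"
proof -
  let ?U = "interior T"
  have fl: "f \<in> borel_measurable lebesgue" using f by (intro measurable_completion) simp
  have Tm: "T \<in> sets lebesgue" using cell_lmeasurable[OF T] by auto
  have neg: "negligible (T - ?U)"
    by (rule negligible_subset[OF negligible_convex_frontier[OF cell_convex[OF T]]])
      (use closure_subset in \<open>auto simp: frontier_def\<close>)
  then have ae: "AE x in lebesgue. x \<notin> T - ?U"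
    by (intro AE_not_in) (simp add: negligible_iff_null_sets[symmetric])
  have "(LINT x|lebesgue_on \<Omega>. ind T x * f x) = (LINT x|lebesgue. (if x \<in> \<Omega> then ind T x * f x else 0))"
    by (rule Lebesgue_Measure.integral_restrict_UNIV[OF fmeasurableD[OF domain_lmeasurable], symmetric])
  also have "(\<lambda>x. if x \<in> \<Omega> then ind T x * f x else 0) = (\<lambda>x. ind T x * f x)"
    using cell_subset[OF T] by (intro ext) (auto split: split_indicator)
  also have "(LINT x|lebesgue. ind T x * f x) = (LINT x|lebesgue. ind ?U x * f x)"
  proof (rule integral_cong_AE)
    show "AE x in lebesgue. ind T x * f x = ind ?U x * f x"
      using ae by eventually_elim (use interior_subset in \<open>auto simp: indicator_def\<close>)
    show "(\<lambda>x. ind T x * f x) \<in> borel_measurable lebesgue"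
      by (intro borel_measurable_times borel_measurable_indicator Tm fl)
    show "(\<lambda>x. ind ?U x * f x) \<in> borel_measurable lebesgue"
      by (intro borel_measurable_times borel_measurable_indicator fl) simp
  qed
  also have "\<dots> = (\<integral>x. ind ?U x * f x \<partial>lborel)"
    using f by (intro integral_completion borel_measurable_times borel_measurable_indicator) auto
  finally show ?thesis .
qed

lemma vol_interior: "T \<in> P \<Longrightarrow> measure lborel (interior T) = vol T"
proof -
  assume T: "T \<in> P"
  have "measure lebesgue (interior T) = vol T"
    unfolding vol_def using cell_subset[OF T] bounded_domain bounded_subset
    by (intro measure_interior negligible_convex_frontier cell_convex[OF T]) blast
  then show ?thesis by simp
qed

lemma poincare_cell:
  assumes T: "T \<in> P" and t: "test_function \<Omega> \<phi>"
  shows "(LINT x|lebesgue_on \<Omega>. ind T x * (\<phi> x)\<^sup>2) \<le>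
     (l2_inner \<Omega> \<phi> (ind T))\<^sup>2 / vol T +
     2 ^ CARD('n) * (2 * r\<^sup>2) * (LINT x|lebesgue_on \<Omega>. ind T x * grad_square \<phi> x)"
proof -
  obtain z where z: "T \<subseteq> cball z r" using cell_outer[OF T] by blast
  have m: "\<phi> \<in> borel_measurable borel" "(\<lambda>x. (\<phi> x)\<^sup>2) \<in> borel_measurable borel" "grad_square \<phi> \<in> borel_measurable borel"
    using test_function_borel[OF t] test_function_borel[OF test_function_grad_square[OF t]] by auto
  have "l2_inner \<Omega> (ind T) \<phi> = (\<integral>x. ind (interior T) x * \<phi> x \<partial>lborel)"
    unfolding l2_inner_def by (rule integral_cell_interior[OF T m(1)])
  then have l: "l2_inner \<Omega> \<phi> (ind T) = (\<integral>x. ind (interior T) x * \<phi> x \<partial>lborel)"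
    by (rule trans[OF l2_sym])
  have "vol T * (LINT x|lebesgue_on \<Omega>. ind T x * (\<phi> x)\<^sup>2) \<le>
     (l2_inner \<Omega> \<phi> (ind T))\<^sup>2 +
     2 ^ CARD('n) * (2 * r\<^sup>2) * vol T * (LINT x|lebesgue_on \<Omega>. ind T x * grad_square \<phi> x)"
    using poincare_open_convex[OF t open_interior convex_interior[OF cell_convex[OF T]] subset_trans[OF interior_subset z]]
    unfolding vol_interior[OF T] integral_cell_interior[OF T m(2)] integral_cell_interior[OF T m(3)] l .
  then show ?thesis using vol_pos[OF T] by (simp add: field_simps)
qed

lemma integral_cells:
  assumes "integrable (lebesgue_on \<Omega>) f"
  shows "(\<Sum>T\<in>P. LINT x|lebesgue_on \<Omega>. ind T x * f x) = (LINT x|lebesgue_on \<Omega>. f x)"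
proof -
  have i: "integrable (lebesgue_on \<Omega>) (\<lambda>x. ind T x * f x)" if "T \<in> P" for T
    by (rule Bochner_Integration.integrable_bound[OF assms
          borel_measurable_times[OF ind_measurable[OF that] borel_measurable_integrable[OF assms]]])
      (auto simp: indicator_def)
  have "(\<Sum>T\<in>P. LINT x|lebesgue_on \<Omega>. ind T x * f x) = (LINT x|lebesgue_on \<Omega>. (\<Sum>T\<in>P. ind T x * f x))"
    by (rule Bochner_Integration.integral_sum[symmetric]) (rule i)
  also have "\<dots> = (LINT x|lebesgue_on \<Omega>. f x)"
    by (intro Bochner_Integration.integral_cong) (auto simp: sum_distrib_right[symmetric] sum_ind_1)
  finally show ?thesis .
qed

text \<open>The mean values stay in the bound because test functions that approximate a function
  with mean zero on the cells need not share this property; these terms disappear only in the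
  limit.\<close>

lemma poincare_test_function:
  assumes t: "test_function \<Omega> \<phi>"
  shows "l2_inner \<Omega> \<phi> \<phi> \<le> (\<Sum>T\<in>P. (l2_inner \<Omega> \<phi> (ind T))\<^sup>2 / vol T) +
     2 ^ CARD('n) * (2 * r\<^sup>2) * deriv_energy \<Omega> 1 \<phi>"
proof -
  have sq: "square_integrable \<Omega> \<phi>" by (rule test_function_square_integrable[OF open_domain t])
  have tg: "test_function \<Omega> (grad_square \<phi>)" by (rule test_function_grad_square[OF t])
  have "l2_inner \<Omega> \<phi> \<phi> = (\<Sum>T\<in>P. LINT x|lebesgue_on \<Omega>. ind T x * (\<phi> x)\<^sup>2)"
    using integral_cells[of "\<lambda>x. (\<phi> x)\<^sup>2"] sq unfolding square_integrable_def l2_inner_def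
    by (simp add: power2_eq_square)
  also have "\<dots> \<le> (\<Sum>T\<in>P. (l2_inner \<Omega> \<phi> (ind T))\<^sup>2 / vol T +
     2 ^ CARD('n) * (2 * r\<^sup>2) * (LINT x|lebesgue_on \<Omega>. ind T x * grad_square \<phi> x))"
    by (intro sum_mono poincare_cell t)
  also have "\<dots> = (\<Sum>T\<in>P. (l2_inner \<Omega> \<phi> (ind T))\<^sup>2 / vol T) +
     2 ^ CARD('n) * (2 * r\<^sup>2) * (LINT x|lebesgue_on \<Omega>. grad_square \<phi> x)"
    using integral_cells[OF square_integrable_imp_integrable[OF test_function_square_integrable[OF open_domain tg]]]
    by (simp add: sum.distrib sum_distrib_left[symmetric])
  also have "(LINT x|lebesgue_on \<Omega>. grad_square \<phi> x) = deriv_energy \<Omega> 1 \<phi>"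
  proof -
    have "(LINT x|lebesgue_on \<Omega>. grad_square \<phi> x) = (\<integral>x. grad_square \<phi> x \<partial>lborel)"
      by (rule integral_lebesgue_on_open(1)[OF open_domain test_function_borel[OF tg] test_function_eq_0[OF tg]])
    also have "\<dots> = (\<Sum>i\<in>UNIV. \<integral>x. (partial i \<phi> x)\<^sup>2 \<partial>lborel)"
      unfolding grad_square_def
    proof (rule Bochner_Integration.integral_sum)
      fix i
      have "test_function \<Omega> (\<lambda>x. (partial i \<phi> x)\<^sup>2)"
        unfolding power2_eq_square by (intro test_function_mult test_function_partial t smooth_partial test_function_smooth[OF t])
      then show "integrable lborel (\<lambda>x. (partial i \<phi> x)\<^sup>2)" by (rule test_function_integrable)
    qed
    also have "\<dots> = (\<Sum>is | length is = 1. \<integral>x. (iter_partial is \<phi> x)\<^sup>2 \<partial>lborel)"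
      by (rule sum.reindex_bij_witness[of _ hd "\<lambda>i. [i]"])
        (auto simp: iter_partial_Cons length_Suc_conv)
    finally show ?thesis by (simp add: sobolev_form_test_function_order[OF t])
  qed
  finally show ?thesis .
qed

lemma poincare:
  assumes u: "u \<in> sobolev0 \<Omega> s" and s: "1 \<le> s" and mean: "\<And>T. T \<in> P \<Longrightarrow> l2_inner \<Omega> u (ind T) = 0"
  shows "l2_inner \<Omega> u u \<le> 2 ^ CARD('n) * (2 * r\<^sup>2) * deriv_energy \<Omega> 1 u"
proof (rule sobolev0_approximation[OF u])
  fix \<phi>
  assume t: "\<And>n. test_function \<Omega> (\<phi> n)"
    and lim: "\<And>A. A \<subseteq> {is. length is \<le> s} \<Longrightarrow> (\<lambda>n. sqrt (sobolev_form \<Omega> A (\<phi> n) (\<phi> n))) \<longlonglongrightarrow> sqrt (sobolev_form \<Omega> A u u)"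
    and lim2: "\<And>w. square_integrable \<Omega> w \<Longrightarrow> (\<lambda>n. l2_inner \<Omega> (\<phi> n) w) \<longlonglongrightarrow> l2_inner \<Omega> u w"
  have l: "(\<lambda>n. sobolev_form \<Omega> A (\<phi> n) (\<phi> n)) \<longlonglongrightarrow> sobolev_form \<Omega> A u u" if "A \<subseteq> {is. length is \<le> s}" for A
    using tendsto_power[OF lim[OF that], of 2] by (simp add: sobolev_form_nonneg)
  have nz: "vol T \<noteq> 0" if "T \<in> P" for T using vol_pos[OF that] by simp
  have "sobolev_form \<Omega> {[]} u u \<le> (\<Sum>T\<in>P. (l2_inner \<Omega> u (ind T))\<^sup>2 / vol T) +
     2 ^ CARD('n) * (2 * r\<^sup>2) * deriv_energy \<Omega> 1 u"
  proof (rule LIMSEQ_le)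
    show "(\<lambda>n. sobolev_form \<Omega> {[]} (\<phi> n) (\<phi> n)) \<longlonglongrightarrow> sobolev_form \<Omega> {[]} u u" by (rule l) simp
    show "(\<lambda>n. (\<Sum>T\<in>P. (l2_inner \<Omega> (\<phi> n) (ind T))\<^sup>2 / vol T) +
       2 ^ CARD('n) * (2 * r\<^sup>2) * deriv_energy \<Omega> 1 (\<phi> n)) \<longlonglongrightarrow>
      (\<Sum>T\<in>P. (l2_inner \<Omega> u (ind T))\<^sup>2 / vol T) + 2 ^ CARD('n) * (2 * r\<^sup>2) * deriv_energy \<Omega> 1 u"
    proof (rule tendsto_add)
      show "(\<lambda>n. \<Sum>T\<in>P. (l2_inner \<Omega> (\<phi> n) (ind T))\<^sup>2 / vol T) \<longlonglongrightarrow> (\<Sum>T\<in>P. (l2_inner \<Omega> u (ind T))\<^sup>2 / vol T)"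
        by (rule tendsto_sum, rule tendsto_divide[OF tendsto_power[OF lim2[OF ind_square_integrable]] tendsto_const nz])
      show "(\<lambda>n. 2 ^ CARD('n) * (2 * r\<^sup>2) * deriv_energy \<Omega> 1 (\<phi> n)) \<longlonglongrightarrow>
        2 ^ CARD('n) * (2 * r\<^sup>2) * deriv_energy \<Omega> 1 u"
        by (rule tendsto_mult[OF tendsto_const l]) (use s in auto)
    qed
    show "\<exists>N. \<forall>n\<ge>N. sobolev_form \<Omega> {[]} (\<phi> n) (\<phi> n) \<le> (\<Sum>T\<in>P. (l2_inner \<Omega> (\<phi> n) (ind T))\<^sup>2 / vol T) +
       2 ^ CARD('n) * (2 * r\<^sup>2) * deriv_energy \<Omega> 1 (\<phi> n)"
      unfolding sobolev_form_Nil[OF test_function_sobolev[OF t]]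
      by (intro exI allI impI poincare_test_function t)
  qed
  then show ?thesis using mean sobolev_form_Nil[OF sobolev0_sobolev[OF u]] by simp
qed

lemma l2_le_of_mean_zero:
  assumes u: "u \<in> sobolev0 \<Omega> s" and s: "1 \<le> s" and r: "0 \<le> r"
    and mean: "\<And>T. T \<in> P \<Longrightarrow> l2_inner \<Omega> u (ind T) = 0"
  shows "sqrt (l2_inner \<Omega> u u) \<le> sqrt (real CARD('n)) ^ (s * s) * (sqrt (2 * 2 ^ CARD('n)) * r) ^ s * sobolev_norm \<Omega> s u"
proof (rule l2_le_power_sobolev_norm[OF u s])
  have "sqrt (l2_inner \<Omega> u u) \<le> sqrt (2 ^ CARD('n) * (2 * r\<^sup>2) * deriv_energy \<Omega> 1 u)"
    by (intro real_sqrt_le_mono poincare[OF u s mean])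
  also have "\<dots> = sqrt (2 * 2 ^ CARD('n)) * r * sqrt (deriv_energy \<Omega> 1 u)"
    using r by (simp add: real_sqrt_mult mult_ac)
  finally show "sqrt (l2_inner \<Omega> u u) \<le> sqrt (2 * 2 ^ CARD('n)) * r * sqrt (deriv_energy \<Omega> 1 u)" .
qed (use r in simp)

end

subsection \<open>Bump functions in the cells\<close>

definition unit_bump :: "real^'n \<Rightarrow> real" where
  "unit_bump = box_bump 1 (\<chi> i. -1) (\<chi> i. 1)"

lemma test_function_unit_bump: "test_function UNIV unit_bump"
  unfolding unit_bump_def by (rule test_function_box_bump) auto

lemma unit_bump_eq_0:
  fixes x :: "real^'n"
  assumes "1 \<le> \<bar>x $ i\<bar>"
  shows "unit_bump x = 0"
proof -
  have "x \<notin> box (\<chi> i. -1) (\<chi> i. 1)"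
    using assms by (auto simp: mem_box_cart intro!: exI[of _ i])
  then show ?thesis unfolding unit_bump_def by (intro box_bump_eq_0) auto
qed

lemma iter_partial_unit_bump_eq_0:
  fixes x :: "real^'n"
  assumes "1 < \<bar>x $ i\<bar>"
  shows "iter_partial is unit_bump x = 0"
proof (rule iter_partial_eq_0_outside)
  show "closed (cbox (\<chi> i. -1) (\<chi> i. 1) :: (real^'n) set)" by (rule closed_cbox)
  show "unit_bump y = 0" if y: "y \<notin> cbox (\<chi> i. -1) (\<chi> i. 1)" for y :: "real^'n"
  proof -
    obtain j where "\<not> (- 1 \<le> y $ j \<and> y $ j \<le> 1)" using y by (auto simp: mem_box_cart)
    then show ?thesis by (intro unit_bump_eq_0[of _ j]) linarith
  qed
  show "x \<notin> cbox (\<chi> i. -1) (\<chi> i. 1)" using assms by (auto simp: mem_box_cart intro!: exI[of _ i])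
qed

text \<open>The type argument carries the dimension, the only thing on which this constant
  depends.\<close>

definition bump_mass :: "'n::finite itself \<Rightarrow> real" where
  "bump_mass _ = (\<integral>x. unit_bump (x :: real^'n) \<partial>lborel)"

text \<open>The squared Sobolev norm of the reference bump in the form of
  \<open>sobolev_form_test_function\<close>; the added 1 makes positivity immediate.\<close>

definition bump_energy :: "'n::finite itself \<Rightarrow> nat \<Rightarrow> real" where
  "bump_energy _ s = 1 + (\<Sum>is | length is \<le> s. \<integral>x. (iter_partial (rev is) unit_bump (x :: real^'n))\<^sup>2 \<partial>lborel)"

lemma bump_energy_pos: "0 < bump_energy TYPE('n::finite) s"
  unfolding bump_energy_def by (intro add_pos_nonneg sum_nonneg integral_nonneg_AE) auto

text \<open>A zero integral would force the bump to vanish almost everywhere, although it is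
  positive on a nonempty open cube.\<close>

lemma bump_mass_pos: "0 < bump_mass TYPE('n::finite)"
proof -
  let ?B = "box (\<chi> i. -1) (\<chi> i. 1) :: (real^'n) set"
  have i: "integrable lborel (unit_bump :: real^'n \<Rightarrow> real)" by (rule test_function_integrable[OF test_function_unit_bump])
  have nn: "0 \<le> unit_bump x" for x :: "real^'n" unfolding unit_bump_def by (rule box_bump_nonneg)
  have "0 \<le> bump_mass TYPE('n)" unfolding bump_mass_def by (intro integral_nonneg_AE AE_I2 nn)
  moreover have "bump_mass TYPE('n) \<noteq> 0"
  proof
    assume "bump_mass TYPE('n) = 0"
    then have "AE x in lborel. unit_bump (x :: real^'n) = 0"
      unfolding bump_mass_def using integral_nonneg_eq_0_iff_AE[OF i] nn by simp
    then have "AE x in lborel. x \<notin> ?B"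
      by eventually_elim (use box_bump_pos[of 1 _ "\<chi> i. -1" "\<chi> i. 1"] in \<open>force simp: unit_bump_def\<close>)
    then have "negligible ?B"
      by (simp add: AE_iff_null_sets[symmetric] negligible_iff_null_sets null_sets_completionI)
    moreover have "0 \<in> ?B" by (simp add: mem_box_cart)
    ultimately show False using open_not_negligible[of ?B] by auto
  qed
  ultimately show ?thesis by simp
qed

lemma lborel_integral_scale:
  fixes f :: "real^'n \<Rightarrow> real"
  assumes f: "f \<in> borel_measurable borel" and \<theta>: "0 < \<theta>"
  shows "(\<integral>x. f ((1/\<theta>) *\<^sub>R (x - y)) \<partial>lborel) = \<theta> ^ CARD('n) * (\<integral>x. f x \<partial>lborel)"
proof -
  have c: "1 / \<theta> \<noteq> 0" using \<theta> by simp
  let ?t = "- (1/\<theta>) *\<^sub>R y"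
  have "(\<integral>x. f x \<partial>lborel) = (\<integral>x. f x \<partial>density (distr lborel borel (\<lambda>x. ?t + (1/\<theta>) *\<^sub>R x)) (\<lambda>_. ennreal (\<bar>1/\<theta>\<bar> ^ DIM(real^'n))))"
    using lborel_affine[OF c, of ?t] by simp
  also have "\<dots> = (\<integral>x. (1/\<theta>) ^ CARD('n) * f (?t + (1/\<theta>) *\<^sub>R x) \<partial>lborel)"
    using f \<theta> by (subst integral_density) (auto simp: integral_distr)
  also have "\<dots> = (1/\<theta>) ^ CARD('n) * (\<integral>x. f ((1/\<theta>) *\<^sub>R (x - y)) \<partial>lborel)"
    by (simp add: algebra_simps)
  finally show ?thesis using \<theta> by (simp add: field_simps)
qed

definition bump_at :: "real \<Rightarrow> real^'n \<Rightarrow> real^'n \<Rightarrow> real" where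
  "bump_at \<theta> y = (\<lambda>x. unit_bump ((1/\<theta>) *\<^sub>R (x - y)))"

lemma bump_at_smooth: "smooth_function (bump_at \<theta> y)"
  unfolding bump_at_def by (rule smooth_scale[OF test_function_smooth[OF test_function_unit_bump]])

lemma iter_partial_bump_at_eq_0:
  fixes x :: "real^'n"
  assumes "0 < \<theta>" "real CARD('n) * \<theta> < dist x y"
  shows "iter_partial is (bump_at \<theta> y) x = 0"
proof -
  \<comment> \<open>The bump lives in a cube of half side \<open>\<theta>\<close>. Bounding the
    Euclidean norm by the sum of the coordinates puts this cube into the ball of radius
    \<open>CARD('n) * \<theta>\<close>.\<close>
  have "\<exists>i. \<theta> < \<bar>(x - y) $ i\<bar>"
  proof (rule ccontr)
    assume "\<nexists>i. \<theta> < \<bar>(x - y) $ i\<bar>"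
    then have "(\<Sum>i\<in>UNIV. \<bar>(x - y) $ i\<bar>) \<le> (\<Sum>i\<in>(UNIV :: 'n set). \<theta>)" by (intro sum_mono) (simp add: not_less)
    moreover have "norm (x - y) \<le> (\<Sum>i\<in>UNIV. \<bar>(x - y) $ i\<bar>)" by (rule norm_le_l1_cart)
    ultimately show False using assms by (simp add: dist_norm)
  qed
  then obtain i where "\<theta> < \<bar>(x - y) $ i\<bar>" by blast
  then have "1 < \<bar>((1/\<theta>) *\<^sub>R (x - y)) $ i\<bar>" using assms(1) by (simp add: abs_mult field_simps)
  then have "iter_partial is unit_bump ((1/\<theta>) *\<^sub>R (x - y)) = 0" by (rule iter_partial_unit_bump_eq_0)
  then show ?thesis
    unfolding bump_at_def by (simp add: iter_partial_scale[OF test_function_smooth[OF test_function_unit_bump]])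
qed

lemma test_function_bump_at:
  fixes y :: "real^'n"
  assumes "0 < \<theta>" "cball y (real CARD('n) * \<theta>) \<subseteq> \<Omega>"
  shows "test_function \<Omega> (bump_at \<theta> y)"
  unfolding test_function_def
proof (intro conjI exI)
  show "compact (cball y (real CARD('n) * \<theta>))" by simp
  show "\<forall>x. x \<notin> cball y (real CARD('n) * \<theta>) \<longrightarrow> bump_at \<theta> y x = 0"
    using iter_partial_bump_at_eq_0[OF assms(1), of _ y "[]"] by (auto simp: dist_commute)
qed (use assms bump_at_smooth in auto)

lemma integral_bump_at: "0 < \<theta> \<Longrightarrow> (\<integral>x. bump_at \<theta> y x \<partial>lborel) = \<theta> ^ CARD('n) * bump_mass TYPE('n)" for y :: "real^'n"
  unfolding bump_at_def bump_mass_def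
  by (rule lborel_integral_scale[OF test_function_borel[OF test_function_unit_bump]])

text \<open>Each derivative of the rescaled bump costs a factor \<open>1 / \<theta>\<close> and the
  volume contributes \<open>\<theta> ^ CARD('n)\<close>. As \<open>\<theta>\<close> is at most 1,
  the power on the left compensates any number of derivatives up to \<open>s\<close>.\<close>

lemma integral_iter_partial_bump_at:
  fixes y :: "real^'n"
  assumes "0 < \<theta>" "\<theta> \<le> 1" "length is \<le> s"
  shows "\<theta> ^ (2 * s) * (\<integral>x. (iter_partial is (bump_at \<theta> y) x)\<^sup>2 \<partial>lborel) \<le>
    \<theta> ^ CARD('n) * (\<integral>x. (iter_partial is unit_bump (x :: real^'n))\<^sup>2 \<partial>lborel)"
proof -
  let ?g = "iter_partial is (unit_bump :: real^'n \<Rightarrow> real)"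
  let ?I = "\<integral>x. (?g x)\<^sup>2 \<partial>lborel"
  have m: "(\<lambda>x. (?g x)\<^sup>2) \<in> borel_measurable borel"
    by (intro borel_measurable_power test_function_borel[OF test_function_iter_partial[OF test_function_unit_bump]])
  have "(\<integral>x. (iter_partial is (bump_at \<theta> y) x)\<^sup>2 \<partial>lborel) = (\<integral>x. ((1/\<theta>) ^ length is)\<^sup>2 * (?g ((1/\<theta>) *\<^sub>R (x - y)))\<^sup>2 \<partial>lborel)"
    unfolding bump_at_def
    by (simp only: iter_partial_scale[OF test_function_smooth[OF test_function_unit_bump]] power_mult_distrib)
  also have "\<dots> = ((1/\<theta>) ^ length is)\<^sup>2 * (\<theta> ^ CARD('n) * ?I)"
    using lborel_integral_scale[OF m assms(1), of y] by simp
  finally have e: "\<theta> ^ (2 * s) * (\<integral>x. (iter_partial is (bump_at \<theta> y) x)\<^sup>2 \<partial>lborel) =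
     (\<theta> ^ (2 * s) * ((1/\<theta>) ^ length is)\<^sup>2) * (\<theta> ^ CARD('n) * ?I)" by simp
  have "\<theta> ^ (2 * s) \<le> \<theta> ^ (2 * length is)" using assms by (intro power_decreasing) auto
  then have "\<theta> ^ (2 * s) * ((1/\<theta>) ^ length is)\<^sup>2 \<le> \<theta> ^ (2 * length is) * ((1/\<theta>) ^ length is)\<^sup>2"
    by (intro mult_right_mono) auto
  also have "\<dots> = 1" using assms(1) by (simp add: power_mult[symmetric] power_one_over mult.commute)
  finally have "(\<theta> ^ (2 * s) * ((1/\<theta>) ^ length is)\<^sup>2) * (\<theta> ^ CARD('n) * ?I) \<le> 1 * (\<theta> ^ CARD('n) * ?I)"
    using assms(1) by (intro mult_right_mono mult_nonneg_nonneg integral_nonneg_AE) auto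
  then show ?thesis unfolding e by simp
qed

context cell_partition
begin

text \<open>\<open>v\<close> adds up one bump per cell, with the coefficients of the step function
  itself. Disjoint supports turn both the pairing and the squared Sobolev norm into multiples of the
  sum of the squared coefficients, without cross terms.\<close>

lemma dual_pairing_lower_bound:
  assumes \<theta>: "0 < \<theta>" "\<theta> \<le> 1" "real CARD('n) * \<theta> < \<rho>"
  obtains v where "v \<in> sobolev0 \<Omega> s"
    "l2_inner \<Omega> (\<lambda>x. \<Sum>T\<in>P. c T * ind T x) v = (\<Sum>T\<in>P. (c T)\<^sup>2) * \<theta> ^ CARD('n) * bump_mass TYPE('n)"
    "\<theta> ^ (2 * s) * (sobolev_norm \<Omega> s v)\<^sup>2 \<le> (\<Sum>T\<in>P. (c T)\<^sup>2) * \<theta> ^ CARD('n) * bump_energy TYPE('n) s"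
proof -
  obtain y where y: "\<And>T. T \<in> P \<Longrightarrow> ball (y T) \<rho> \<subseteq> T" using cell_inner by metis
  define \<phi> where "\<phi> T = bump_at \<theta> (y T)" for T
  have zero: "iter_partial is (\<phi> T) x = 0" if "T \<in> P" "x \<notin> T" for T x "is"
  proof -
    have "x \<notin> ball (y T) \<rho>" using y[OF that(1)] that(2) by blast
    then show ?thesis unfolding \<phi>_def using \<theta> by (intro iter_partial_bump_at_eq_0) (auto simp: dist_commute)
  qed
  have zero0: "\<phi> T x = 0" if "T \<in> P" "x \<notin> T" for T x using zero[OF that, of "[]"] by simp
  have tT: "test_function \<Omega> (\<phi> T)" if "T \<in> P" for T
  proof -
    have "cball (y T) (real CARD('n) * \<theta>) \<subseteq> ball (y T) \<rho>" using \<theta> by auto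
    then show ?thesis unfolding \<phi>_def using y[OF that] cell_subset[OF that] \<theta> by (intro test_function_bump_at) auto
  qed
  have sT: "smooth_function (\<phi> T)" if "T \<in> P" for T by (rule test_function_smooth[OF tT[OF that]])
  define v where "v = (\<lambda>x. \<Sum>T\<in>P. c T * \<phi> T x)"
  have tv: "test_function \<Omega> v" unfolding v_def by (rule test_function_sum[OF finite_cells tT])
  let ?A = "\<Sum>T\<in>P. (c T)\<^sup>2"
  show ?thesis
  proof (rule that)
    show "v \<in> sobolev0 \<Omega> s" by (rule test_function_sobolev0[OF tv])
    have int: "l2_inner \<Omega> (ind T) (\<phi> T') = (if T = T' then \<theta> ^ CARD('n) * bump_mass TYPE('n) else 0)"
      if "T \<in> P" "T' \<in> P" for T T'
    proof -
      have "l2_inner \<Omega> (ind T) (\<phi> T') = (LINT x|lebesgue_on \<Omega>. (if T = T' then \<phi> T' x else 0))"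
        unfolding l2_inner_def
      proof (intro Bochner_Integration.integral_cong refl)
        fix x
        show "ind T x * \<phi> T' x = (if T = T' then \<phi> T' x else 0)"
          using zero0[OF that(2), of x] cells_disjoint[OF that, of x]
          by (cases "x \<in> T"; cases "x \<in> T'") auto
      qed
      moreover have "(LINT x|lebesgue_on \<Omega>. \<phi> T' x) = \<theta> ^ CARD('n) * bump_mass TYPE('n)"
        using integral_lebesgue_on_open(1)[OF open_domain test_function_borel[OF tT[OF that(2)]] test_function_eq_0[OF tT[OF that(2)]]]
          integral_bump_at[OF \<theta>(1), of "y T'"] unfolding \<phi>_def by simp
      ultimately show ?thesis by simp
    qed
    have "l2_inner \<Omega> (\<lambda>x. \<Sum>T\<in>P. c T * ind T x) v = (\<Sum>T\<in>P. c T * l2_inner \<Omega> (ind T) v)"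
      by (rule l2_sum_left[OF finite_cells ind_square_integrable test_function_square_integrable[OF open_domain tv]])
    also have "\<dots> = (\<Sum>T\<in>P. c T * (c T * (\<theta> ^ CARD('n) * bump_mass TYPE('n))))"
    proof (rule sum.cong[OF refl])
      fix T assume T: "T \<in> P"
      have "l2_inner \<Omega> (ind T) v = (\<Sum>T'\<in>P. c T' * l2_inner \<Omega> (ind T) (\<phi> T'))"
        unfolding v_def
        by (rule l2_sum_right[OF finite_cells test_function_square_integrable[OF open_domain tT] ind_square_integrable[OF T]])
      also have "\<dots> = c T * l2_inner \<Omega> (ind T) (\<phi> T)"
        by (rule cell_sum_eq[OF T]) (simp add: int T)
      finally show "c T * l2_inner \<Omega> (ind T) v = c T * (c T * (\<theta> ^ CARD('n) * bump_mass TYPE('n)))"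
        by (simp add: int[OF T T])
    qed
    also have "\<dots> = ?A * \<theta> ^ CARD('n) * bump_mass TYPE('n)"
      by (simp add: sum_distrib_left sum_distrib_right power2_eq_square mult_ac)
    finally show "l2_inner \<Omega> (\<lambda>x. \<Sum>T\<in>P. c T * ind T x) v = ?A * \<theta> ^ CARD('n) * bump_mass TYPE('n)" .
    have e: "(\<integral>x. (iter_partial is v x)\<^sup>2 \<partial>lborel) = (\<Sum>T\<in>P. (c T)\<^sup>2 * (\<integral>x. (iter_partial is (\<phi> T) x)\<^sup>2 \<partial>lborel))" for "is"
    proof -
      have pt: "(iter_partial is v x)\<^sup>2 = (\<Sum>T\<in>P. (c T)\<^sup>2 * (iter_partial is (\<phi> T) x)\<^sup>2)" for x
      proof -
        have iv: "iter_partial is v x = (\<Sum>T\<in>P. c T * iter_partial is (\<phi> T) x)"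
          unfolding v_def by (simp add: iter_partial_sum[OF finite_cells sT])
        show ?thesis
        proof (cases "\<exists>T\<in>P. x \<in> T")
          case True
          then obtain T where T: "T \<in> P" "x \<in> T" by blast
          have z: "iter_partial is (\<phi> T') x = 0" if "T' \<in> P" "T' \<noteq> T" for T'
            using zero[OF that(1)] cells_disjoint[OF T(1) that(1) T(2)] that(2) by blast
          show ?thesis unfolding iv
            by (subst (1 2) cell_sum_eq[OF T(1)]) (auto simp: z power_mult_distrib)
        next
          case False
          then show ?thesis unfolding iv using zero by (simp add: sum.neutral)
        qed
      qed
      have "integrable lborel (\<lambda>x. (c T)\<^sup>2 * (iter_partial is (\<phi> T) x)\<^sup>2)" if "T \<in> P" for T
      proof (rule integrable_mult_right)
        have "test_function \<Omega> (\<lambda>x. (iter_partial is (\<phi> T) x)\<^sup>2)"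
          unfolding power2_eq_square
          by (intro test_function_mult test_function_iter_partial tT that smooth_iter_partial sT)
        then show "integrable lborel (\<lambda>x. (iter_partial is (\<phi> T) x)\<^sup>2)" by (rule test_function_integrable)
      qed
      then show ?thesis unfolding pt by (subst Bochner_Integration.integral_sum) auto
    qed
    let ?E = "\<lambda>is. \<integral>x. (iter_partial (rev is) unit_bump (x :: real^'n))\<^sup>2 \<partial>lborel"
    have "\<theta> ^ (2 * s) * (sobolev_norm \<Omega> s v)\<^sup>2 = \<theta> ^ (2 * s) * (\<Sum>is | length is \<le> s. \<Sum>T\<in>P. (c T)\<^sup>2 * (\<integral>x. (iter_partial (rev is) (\<phi> T) x)\<^sup>2 \<partial>lborel))"
      unfolding sobolev_norm_eq real_sqrt_pow2[OF sobolev_form_nonneg] unfolding sobolev_form_test_function[OF tv] e ..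
    also have "\<dots> = (\<Sum>is | length is \<le> s. \<Sum>T\<in>P. (c T)\<^sup>2 * (\<theta> ^ (2 * s) * (\<integral>x. (iter_partial (rev is) (\<phi> T) x)\<^sup>2 \<partial>lborel)))"
      by (simp add: sum_distrib_left mult_ac)
    also have "\<dots> \<le> (\<Sum>is | length is \<le> s. \<Sum>T\<in>P. (c T)\<^sup>2 * (\<theta> ^ CARD('n) * ?E is))"
      unfolding \<phi>_def using \<theta> by (intro sum_mono mult_left_mono integral_iter_partial_bump_at) auto
    also have "\<dots> = ?A * \<theta> ^ CARD('n) * (\<Sum>is | length is \<le> s. ?E is)"
      by (simp add: sum_distrib_left sum_distrib_right mult_ac)
    also have "\<dots> \<le> ?A * \<theta> ^ CARD('n) * bump_energy TYPE('n) s"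
      unfolding bump_energy_def using \<theta> by (intro mult_left_mono mult_nonneg_nonneg sum_nonneg) auto
    finally show "\<theta> ^ (2 * s) * (sobolev_norm \<Omega> s v)\<^sup>2 \<le> ?A * \<theta> ^ CARD('n) * bump_energy TYPE('n) s" .
  qed
qed

lemma l2_step_function_le:
  "l2_inner \<Omega> (\<lambda>x. \<Sum>T\<in>P. c T * ind T x) (\<lambda>x. \<Sum>T\<in>P. c T * ind T x) \<le>
    (\<Sum>T\<in>P. (c T)\<^sup>2) * (unit_ball_vol (real CARD('n)) * r ^ CARD('n))"
  unfolding l2_sum_ind sum_distrib_right
  by (intro sum_mono) (auto simp: power2_eq_square intro!: mult_left_mono vol_le)

end

section \<open>Bounds for the energy form\<close>

lemma (in semi_inner) sum_closed:
  assumes "finite A" "\<And>a. a \<in> A \<Longrightarrow> f a \<in> S" "w \<in> S"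
  shows "(\<lambda>x. \<Sum>a\<in>A. c a * f a x) \<in> S"
  using assms
proof (induction A rule: finite_induct)
  case empty
  then show ?case using lincomb_closed[of w w 0 0] by simp
next
  case (insert y A)
  then have "(\<lambda>x. c y * f y x + 1 * (\<Sum>a\<in>A. c a * f a x)) \<in> S"
    by (intro lincomb_closed) auto
  then show ?case using insert by simp
qed

lemma (in semi_inner) sum_left:
  assumes "finite A" "\<And>a. a \<in> A \<Longrightarrow> f a \<in> S" "w \<in> S"
  shows "B (\<lambda>x. \<Sum>a\<in>A. c a * f a x) w = (\<Sum>a\<in>A. c a * B (f a) w)"
  using assms
proof (induction A rule: finite_induct)
  case empty
  then show ?case using lincomb_left[of w w w 0 0] by simp
next
  case (insert y A)
  then have "B (\<lambda>x. c y * f y x + 1 * (\<Sum>a\<in>A. c a * f a x)) w =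
     c y * B (f y) w + 1 * B (\<lambda>x. \<Sum>a\<in>A. c a * f a x) w"
    by (intro lincomb_left sum_closed) auto
  then show ?case using insert by simp
qed

locale admissible_operator = bounded_open \<Omega> for \<Omega> :: "(real^'n) set" +
  fixes s :: nat and \<L> :: "'n sobolev_op"
  assumes admissible: "admissible_op \<Omega> s \<L>"
begin

abbreviation "H \<equiv> sobolev0 \<Omega> s"
abbreviation "nrm \<equiv> sobolev_norm \<Omega> s"

lemma operator_dual: "u \<in> H \<Longrightarrow> \<L> u \<in> sobolev_dual \<Omega> s"
  using admissible by (simp add: admissible_op_def linear_op_def)

text \<open>Self-adjointness and positivity make Cauchy-Schwarz available for the energy.\<close>

sublocale energy: semi_inner H \<L>
proof
  fix u v w a b assume "u \<in> H" "v \<in> H" "w \<in> H"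
  then show "\<L> (\<lambda>x. a * u x + b * v x) w = a * \<L> u w + b * \<L> v w"
    using admissible by (simp add: admissible_op_def linear_op_def)
qed (use sobolev0_lincomb admissible in \<open>auto simp: admissible_op_def self_adjoint_op_def positive_op_def\<close>)

lemma dual_scale: "F \<in> sobolev_dual \<Omega> s \<Longrightarrow> u \<in> H \<Longrightarrow> F (\<lambda>x. a * u x) = a * F u"
proof -
  assume "F \<in> sobolev_dual \<Omega> s" "u \<in> H"
  then have "F (\<lambda>x. a * u x + 0 * u x) = a * F u + 0 * F u" unfolding sobolev_dual_def by blast
  then show ?thesis by simp
qed

lemma scale_H: "u \<in> H \<Longrightarrow> (\<lambda>x. a * u x) \<in> H"
  using sobolev0_lincomb[of u s u a 0] by simp

lemma nrm_scale: "u \<in> H \<Longrightarrow> nrm (\<lambda>x. a * u x) = \<bar>a\<bar> * nrm u"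
  by (rule sobolev_norm_scale[OF sobolev0_sobolev])

section \<open>Dual norms, operator norms and coercivity\<close>

lemma unit_ball_nonempty: "{u \<in> H. nrm u \<le> 1} \<noteq> {}"
  using zero_sobolev0 sobolev_norm_zero by force

lemma dual_bounded_above:
  assumes "F \<in> sobolev_dual \<Omega> s"
  shows "bdd_above ((\<lambda>u. \<bar>F u\<bar>) ` {u \<in> H. nrm u \<le> 1})"
proof -
  obtain B where B: "\<And>u. u \<in> H \<Longrightarrow> \<bar>F u\<bar> \<le> B * nrm u"
    using assms unfolding sobolev_dual_def by blast
  have "\<bar>F u\<bar> \<le> \<bar>B\<bar>" if "u \<in> H" "nrm u \<le> 1" for u
  proof -
    have "\<bar>F u\<bar> \<le> B * nrm u" by (rule B[OF that(1)])
    also have "\<dots> \<le> \<bar>B\<bar> * nrm u" using sobolev_norm_nonneg by (intro mult_right_mono) auto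
    also have "\<dots> \<le> \<bar>B\<bar>" using that(2) by (simp add: mult_left_le)
    finally show ?thesis .
  qed
  then show ?thesis by (intro bdd_aboveI[of _ "\<bar>B\<bar>"]) auto
qed

lemma dual_norm_bound:
  assumes F: "F \<in> sobolev_dual \<Omega> s" and u: "u \<in> H"
  shows "\<bar>F u\<bar> \<le> dual_norm \<Omega> s F * nrm u"
proof (cases "nrm u = 0")
  case True
  \<comment> \<open>A function of norm zero cannot be normalised; the boundedness of
    \<open>F\<close> forces \<open>F u = 0\<close> instead.\<close>
  obtain B where "\<And>u. u \<in> H \<Longrightarrow> \<bar>F u\<bar> \<le> B * nrm u"
    using F unfolding sobolev_dual_def by blast
  from this[OF u] show ?thesis using True by simp
next
  case False
  then have p: "0 < nrm u" using sobolev_norm_nonneg[of \<Omega> s u] by simp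
  let ?u = "\<lambda>x. inverse (nrm u) * u x"
  have "\<bar>F ?u\<bar> \<le> dual_norm \<Omega> s F"
    unfolding dual_norm_def
    by (rule cSUP_upper[OF _ dual_bounded_above[OF F]]) (use scale_H[OF u] nrm_scale[OF u] p in simp)
  then have "\<bar>F u\<bar> / nrm u \<le> dual_norm \<Omega> s F"
    unfolding dual_scale[OF F u] using p by (simp add: abs_mult divide_inverse mult.commute)
  then show ?thesis using p by (simp add: pos_divide_le_eq)
qed

lemma dual_norm_nonneg:
  assumes F: "F \<in> sobolev_dual \<Omega> s"
  shows "0 \<le> dual_norm \<Omega> s F"
proof -
  have "\<bar>F (\<lambda>x. 0)\<bar> \<le> dual_norm \<Omega> s F"
    unfolding dual_norm_def
    by (rule cSUP_upper[OF _ dual_bounded_above[OF F]]) (simp add: zero_sobolev0 sobolev_norm_zero)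
  then show ?thesis by linarith
qed

lemma dual_norm_le:
  assumes "\<And>v. v \<in> H \<Longrightarrow> nrm v \<le> 1 \<Longrightarrow> \<bar>F v\<bar> \<le> C"
  shows "dual_norm \<Omega> s F \<le> C"
  unfolding dual_norm_def by (rule cSUP_least[OF unit_ball_nonempty]) (use assms in auto)

text \<open>The bound \<open>B\<close> from \<open>bounded_op\<close> is purely qualitative: it
  makes the supremum in \<open>op_norm\<close> one over a bounded set and covers functions of norm
  zero. The constant of the conclusion is the operator norm itself.\<close>

lemma op_norm_bound:
  assumes u: "u \<in> H"
  shows "dual_norm \<Omega> s (\<L> u) \<le> op_norm \<Omega> s \<L> * nrm u"
proof -
  obtain B where B: "\<And>u. u \<in> H \<Longrightarrow> dual_norm \<Omega> s (\<L> u) \<le> B * nrm u"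
    using admissible unfolding admissible_op_def bounded_op_def by blast
  show ?thesis
  proof (cases "nrm u = 0")
    case True
    then show ?thesis using B[OF u] by simp
  next
    case False
    then have p: "0 < nrm u" using sobolev_norm_nonneg[of \<Omega> s u] by simp
    let ?u = "\<lambda>x. inverse (nrm u) * u x"
    have u': "?u \<in> H" by (rule scale_H[OF u])
    have "dual_norm \<Omega> s (\<L> v) \<le> \<bar>B\<bar>" if "v \<in> H" "nrm v \<le> 1" for v
    proof -
      have "dual_norm \<Omega> s (\<L> v) \<le> B * nrm v" by (rule B[OF that(1)])
      also have "\<dots> \<le> \<bar>B\<bar> * nrm v" using sobolev_norm_nonneg by (intro mult_right_mono) auto
      also have "\<dots> \<le> \<bar>B\<bar>" using that(2) by (simp add: mult_left_le)
      finally show ?thesis .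
    qed
    then have bdd: "bdd_above ((\<lambda>u. dual_norm \<Omega> s (\<L> u)) ` {u \<in> H. nrm u \<le> 1})"
      by (intro bdd_aboveI[of _ "\<bar>B\<bar>"]) auto
    have a: "dual_norm \<Omega> s (\<L> ?u) \<le> op_norm \<Omega> s \<L>"
      unfolding op_norm_def
      by (rule cSUP_upper[OF _ bdd]) (use u' nrm_scale[OF u] p in simp)
    have "dual_norm \<Omega> s (\<L> u) \<le> nrm u * dual_norm \<Omega> s (\<L> ?u)"
    proof (rule dual_norm_le)
      fix v assume v: "v \<in> H" "nrm v \<le> 1"
      have "\<L> ?u v = inverse (nrm u) * \<L> u v"
        using energy.lincomb_left[OF u u v(1), of "inverse (nrm u)" 0] by simp
      then have "\<bar>\<L> u v\<bar> = nrm u * \<bar>\<L> ?u v\<bar>" using p by (simp add: abs_mult)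
      also have "\<dots> \<le> nrm u * (dual_norm \<Omega> s (\<L> ?u) * nrm v)"
        using p by (intro mult_left_mono dual_norm_bound operator_dual u' v) auto
      also have "\<dots> \<le> nrm u * (dual_norm \<Omega> s (\<L> ?u) * 1)"
        using p v by (intro mult_left_mono dual_norm_nonneg operator_dual u') auto
      finally show "\<bar>\<L> u v\<bar> \<le> nrm u * dual_norm \<Omega> s (\<L> ?u)" by simp
    qed
    also have "\<dots> \<le> nrm u * op_norm \<Omega> s \<L>" using a p by simp
    finally show ?thesis by (simp add: mult.commute)
  qed
qed

text \<open>The absolute value and the added 1 keep the later constants positive for every real
  argument, while \<open>opn\<close> and \<open>inv_opn\<close> still dominate the two
  norms.\<close>

definition "opn = \<bar>op_norm \<Omega> s \<L>\<bar> + 1"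
definition "inv_opn = \<bar>inverse_op_norm \<Omega> s \<L>\<bar> + 1"

lemma opn_pos: "0 < opn" and inv_opn_pos: "0 < inv_opn"
  by (auto simp: opn_def inv_opn_def)

lemma energy_le:
  assumes v: "v \<in> H"
  shows "\<L> v v \<le> opn * (nrm v)\<^sup>2"
proof -
  have "\<L> v v \<le> dual_norm \<Omega> s (\<L> v) * nrm v"
    using dual_norm_bound[OF operator_dual[OF v] v] by linarith
  also have "\<dots> \<le> (op_norm \<Omega> s \<L> * nrm v) * nrm v"
    by (intro mult_right_mono op_norm_bound v sobolev_norm_nonneg)
  also have "\<dots> \<le> (opn * nrm v) * nrm v"
    by (intro mult_right_mono sobolev_norm_nonneg) (simp add: opn_def)
  finally show ?thesis by (simp add: power2_eq_square mult.assoc)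
qed

text \<open>Cauchy-Schwarz in the energy, rather than the operator norm bound for \<open>v\<close>,
  brings the root of the energy of \<open>v\<close> to the right-hand side; coercivity depends on
  this.\<close>

lemma dual_norm_operator_le:
  assumes v: "v \<in> H"
  shows "dual_norm \<Omega> s (\<L> v) \<le> sqrt opn * sqrt (\<L> v v)"
proof (rule dual_norm_le)
  fix w assume w: "w \<in> H" "nrm w \<le> 1"
  have "\<L> w w \<le> opn * (nrm w)\<^sup>2" by (rule energy_le[OF w(1)])
  also have "\<dots> \<le> opn * 1"
    using w sobolev_norm_nonneg[of \<Omega> s w] opn_pos by (intro mult_left_mono power_le_one) auto
  finally have "sqrt (\<L> w w) \<le> sqrt opn" by simp
  then have "sqrt (\<L> v v) * sqrt (\<L> w w) \<le> sqrt (\<L> v v) * sqrt opn"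
    by (intro mult_left_mono) (simp_all add: energy.nonneg[OF v])
  then show "\<bar>\<L> v w\<bar> \<le> sqrt opn * sqrt (\<L> v v)"
    using energy.cauchy_schwarz[OF v w(1)] by (simp add: mult.commute)
qed

lemma inverse_op:
  assumes F: "F \<in> sobolev_dual \<Omega> s"
  shows "inverse_op \<Omega> s \<L> F \<in> H" "\<And>v. v \<in> H \<Longrightarrow> \<L> (inverse_op \<Omega> s \<L> F) v = F v"
proof -
  have "\<exists>u. u \<in> H \<and> (\<forall>v\<in>H. \<L> u v = F v)"
    using admissible F unfolding admissible_op_def invertible_op_def by blast
  from someI_ex[OF this] show "inverse_op \<Omega> s \<L> F \<in> H" "\<And>v. v \<in> H \<Longrightarrow> \<L> (inverse_op \<Omega> s \<L> F) v = F v"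
    unfolding inverse_op_def by auto
qed

text \<open>\<open>inverse_op\<close> picks an arbitrary preimage, so applied to
  \<open>\<L> v\<close> it recovers \<open>v\<close> only modulo functions of norm zero. Normalising
  by \<open>D\<close> makes the supremum in \<open>inverse_op_norm\<close> applicable.\<close>

lemma inverse_norm_bound:
  assumes v: "v \<in> H"
  shows "nrm v \<le> inv_opn * dual_norm \<Omega> s (\<L> v)"
proof -
  obtain B where B: "\<And>u. u \<in> H \<Longrightarrow> nrm u \<le> B * dual_norm \<Omega> s (\<L> u)"
    using admissible unfolding admissible_op_def invertible_op_def by blast
  define D where "D = dual_norm \<Omega> s (\<L> v)"
  show ?thesis
  proof (cases "D = 0")
    case True
    then show ?thesis using B[OF v] by (simp add: D_def)
  next
    case False
    then have D: "0 < D" unfolding D_def using dual_norm_nonneg[OF operator_dual[OF v]] by simp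
    let ?w = "\<lambda>x. inverse D * v x"
    have w: "?w \<in> H" by (rule scale_H[OF v])
    have Fd: "\<L> ?w \<in> sobolev_dual \<Omega> s" by (rule operator_dual[OF w])
    have Lw: "\<L> ?w z = inverse D * \<L> v z" if "z \<in> H" for z
      using energy.lincomb_left[OF v v that, of "inverse D" 0] by simp
    have d1: "dual_norm \<Omega> s (\<L> ?w) \<le> 1"
    proof (rule dual_norm_le)
      fix z assume z: "z \<in> H" "nrm z \<le> 1"
      have "\<bar>\<L> v z\<bar> \<le> D * nrm z" unfolding D_def by (rule dual_norm_bound[OF operator_dual[OF v] z(1)])
      also have "\<dots> \<le> D" using z D by (simp add: mult_left_le)
      finally show "\<bar>\<L> ?w z\<bar> \<le> 1" unfolding Lw[OF z(1)] using D by (simp add: abs_mult field_simps)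
    qed
    have bd: "nrm (inverse_op \<Omega> s \<L> F) \<le> \<bar>B\<bar>" if F: "F \<in> sobolev_dual \<Omega> s" "dual_norm \<Omega> s F \<le> 1" for F
    proof -
      let ?u = "inverse_op \<Omega> s \<L> F"
      have "dual_norm \<Omega> s (\<L> ?u) \<le> 1"
      proof (rule dual_norm_le)
        fix z assume z: "z \<in> H" "nrm z \<le> 1"
        have "\<bar>F z\<bar> \<le> dual_norm \<Omega> s F * nrm z" by (rule dual_norm_bound[OF F(1) z(1)])
        also have "\<dots> \<le> 1" using z F(2) sobolev_norm_nonneg dual_norm_nonneg[OF F(1)] by (intro mult_le_one) auto
        finally show "\<bar>\<L> ?u z\<bar> \<le> 1" by (simp add: inverse_op(2)[OF F(1) z(1)])
      qed
      then have "B * dual_norm \<Omega> s (\<L> ?u) \<le> \<bar>B\<bar> * 1"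
        using dual_norm_nonneg[OF operator_dual[OF inverse_op(1)[OF F(1)]]] by (intro mult_mono) auto
      then show ?thesis using B[OF inverse_op(1)[OF F(1)]] by simp
    qed
    let ?u = "inverse_op \<Omega> s \<L> (\<L> ?w)"
    have "nrm ?u \<le> inverse_op_norm \<Omega> s \<L>"
      unfolding inverse_op_norm_def
      by (rule cSUP_upper) (use Fd d1 bd in \<open>auto intro!: bdd_aboveI[of _ "\<bar>B\<bar>"]\<close>)
    then have nu: "nrm ?u \<le> inv_opn" by (simp add: inv_opn_def)
    have u: "?u \<in> H" by (rule inverse_op(1)[OF Fd])
    \<comment> \<open>The difference between \<open>v\<close> and the rescaled preimage of its own
      image is annihilated by the operator, so the qualitative bound \<open>B\<close> gives it norm
      zero.\<close>
    let ?z = "\<lambda>x. 1 * v x + (- D) * ?u x"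
    have z: "?z \<in> H" by (rule sobolev0_lincomb[OF v u])
    have "dual_norm \<Omega> s (\<L> ?z) \<le> 0"
    proof (rule dual_norm_le)
      fix y assume y: "y \<in> H"
      show "\<bar>\<L> ?z y\<bar> \<le> 0"
        using D unfolding energy.lincomb_left[OF v u y] inverse_op(2)[OF Fd y] Lw[OF y] by simp
    qed
    then have "dual_norm \<Omega> s (\<L> ?z) = 0"
      using dual_norm_nonneg[OF operator_dual[OF z]] by linarith
    then have z0: "nrm ?z \<le> 0" using B[OF z] by simp
    have "nrm (\<lambda>x. 1 * ?z x + D * ?u x) \<le> \<bar>1\<bar> * nrm ?z + \<bar>D\<bar> * nrm ?u"
      by (rule sobolev_norm_lincomb[OF sobolev0_sobolev[OF z] sobolev0_sobolev[OF u]])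
    then have "nrm v \<le> D * nrm ?u" using z0 D by simp
    also have "\<dots> \<le> D * inv_opn" using nu D by simp
    finally show ?thesis unfolding D_def by (simp add: mult.commute)
  qed
qed

lemma coercive:
  assumes v: "v \<in> H"
  shows "nrm v \<le> inv_opn * sqrt opn * sqrt (\<L> v v)"
proof -
  have "nrm v \<le> inv_opn * dual_norm \<Omega> s (\<L> v)" by (rule inverse_norm_bound[OF v])
  also have "\<dots> \<le> inv_opn * (sqrt opn * sqrt (\<L> v v))"
    using inv_opn_pos by (intro mult_left_mono dual_norm_operator_le v) auto
  finally show ?thesis by (simp add: mult.assoc)
qed

text \<open>For the root \<open>E\<close> of the energy the estimates combine to
  \<open>E * E \<le> c * E\<close>, and one \<open>E\<close> cancels. Only the inequality
  \<open>e\<close> ties \<open>f\<close> to \<open>v\<close>; later \<open>f\<close> differs from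
  the data for which \<open>v\<close> is the solution.\<close>

lemma energy_upper_bound:
  assumes v: "v \<in> H" and f: "square_integrable \<Omega> f" and e: "\<L> v v \<le> l2_inner \<Omega> f v"
    and \<kappa>: "0 \<le> \<kappa>" "sqrt (l2_inner \<Omega> v v) \<le> \<kappa> * nrm v"
  shows "\<L> v v \<le> opn * inv_opn\<^sup>2 * \<kappa>\<^sup>2 * l2_inner \<Omega> f f"
proof -
  define E where "E = sqrt (\<L> v v)"
  define c where "c = sqrt (l2_inner \<Omega> f f) * \<kappa> * (inv_opn * sqrt opn)"
  have E: "0 \<le> E" "\<L> v v = E\<^sup>2" unfolding E_def using energy.nonneg[OF v] by auto
  have c: "0 \<le> c" unfolding c_def using \<kappa> inv_opn_pos opn_pos by (simp add: l2_nonneg)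
  have "E\<^sup>2 \<le> sqrt (l2_inner \<Omega> f f) * sqrt (l2_inner \<Omega> v v)"
    using e l2_cauchy_schwarz[OF f sobolev0_square_integrable[OF v]] E by linarith
  also have "\<dots> \<le> sqrt (l2_inner \<Omega> f f) * (\<kappa> * (inv_opn * sqrt opn * E))"
    unfolding E_def using \<kappa> coercive[OF v]
    by (intro mult_left_mono order_trans[OF \<kappa>(2)]) (auto simp: l2_nonneg)
  finally have "E * E \<le> c * E" unfolding c_def by (simp add: power2_eq_square mult_ac)
  then have "E \<le> c" using E c by (cases "E = 0") auto
  then have "E\<^sup>2 \<le> c\<^sup>2" using E by (intro power_mono) auto
  also have "c\<^sup>2 = opn * inv_opn\<^sup>2 * \<kappa>\<^sup>2 * l2_inner \<Omega> f f"
    unfolding c_def power_mult_distrib using opn_pos by (simp add: l2_nonneg)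
  finally show ?thesis using E by simp
qed

text \<open>Any competitor \<open>v\<close> bounds the energy of \<open>u\<close> from below; a good
  one has a large pairing with \<open>f\<close> and a small norm, as the sums of bumps do.\<close>

lemma energy_lower_bound:
  assumes u: "u \<in> H" and v: "v \<in> H" and e: "\<L> u v = l2_inner \<Omega> f v"
  shows "(l2_inner \<Omega> f v)\<^sup>2 \<le> \<L> u u * (opn * (nrm v)\<^sup>2)"
proof -
  have "(\<L> u v)\<^sup>2 \<le> \<L> u u * \<L> v v" by (rule energy.cauchy_schwarz_square[OF u v])
  also have "\<dots> \<le> \<L> u u * (opn * (nrm v)\<^sup>2)"
    by (intro mult_left_mono energy_le v energy.nonneg u)
  finally show ?thesis using e by simp
qed

definition solution :: "(real^'n \<Rightarrow> real) \<Rightarrow> real^'n \<Rightarrow> real" where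
  "solution f = inverse_op \<Omega> s \<L> (\<lambda>v. l2_inner \<Omega> f v)"

lemma solution:
  assumes f: "square_integrable \<Omega> f"
  shows "solution f \<in> H" "\<And>v. v \<in> H \<Longrightarrow> \<L> (solution f) v = l2_inner \<Omega> f v"
proof -
  have "(\<lambda>v. l2_inner \<Omega> f v) \<in> sobolev_dual \<Omega> s"
    unfolding sobolev_dual_def
  proof (intro CollectI conjI ballI allI exI)
    fix u v a b assume "u \<in> H" "v \<in> H"
    then show "l2_inner \<Omega> f (\<lambda>x. a * u x + b * v x) = a * l2_inner \<Omega> f u + b * l2_inner \<Omega> f v"
      by (intro l2_lincomb_right sobolev0_square_integrable f)
  next
    fix u assume u: "u \<in> H"
    have "\<bar>l2_inner \<Omega> f u\<bar> \<le> sqrt (l2_inner \<Omega> f f) * sqrt (l2_inner \<Omega> u u)"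
      by (rule l2_cauchy_schwarz[OF f sobolev0_square_integrable[OF u]])
    also have "\<dots> \<le> sqrt (l2_inner \<Omega> f f) * nrm u"
      by (intro mult_left_mono l2_le_sobolev_norm sobolev0_sobolev u) (simp add: l2_nonneg)
    finally show "\<bar>l2_inner \<Omega> f u\<bar> \<le> sqrt (l2_inner \<Omega> f f) * nrm u" .
  qed
  from inverse_op[OF this] show "solution f \<in> H" "\<And>v. v \<in> H \<Longrightarrow> \<L> (solution f) v = l2_inner \<Omega> f v"
    unfolding solution_def by auto
qed

end

section \<open>The multiresolution basis\<close>

lemma square_integrable_cong:
  assumes "\<And>x. x \<in> \<Omega> \<Longrightarrow> f x = g x"
  shows "square_integrable \<Omega> f \<longleftrightarrow> square_integrable \<Omega> g"
proof -
  have "f \<in> borel_measurable (lebesgue_on \<Omega>) \<longleftrightarrow> g \<in> borel_measurable (lebesgue_on \<Omega>)"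
    by (intro measurable_cong) (simp add: assms)
  moreover have "integrable (lebesgue_on \<Omega>) (\<lambda>x. (f x)\<^sup>2) \<longleftrightarrow> integrable (lebesgue_on \<Omega>) (\<lambda>x. (g x)\<^sup>2)"
    by (intro Bochner_Integration.integrable_cong) (simp_all add: assms)
  ultimately show ?thesis unfolding square_integrable_def by simp
qed

context cell_partition
begin

lemma step_function:
  assumes "\<And>T. T \<in> P \<Longrightarrow> f constant_on T"
  shows "\<exists>c. \<forall>x\<in>\<Omega>. f x = (\<Sum>T\<in>P. c T * ind T x)"
proof -
  have "\<forall>T\<in>P. \<exists>c. \<forall>x\<in>T. f x = c" using assms by (auto simp: constant_on_def)
  then obtain c where c: "\<forall>T\<in>P. \<forall>x\<in>T. f x = c T" by (rule bchoice[THEN exE])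
  have "f x = (\<Sum>T\<in>P. c T * ind T x)" if x: "x \<in> \<Omega>" for x
  proof -
    obtain T where T: "T \<in> P" "x \<in> T" using cell_exists[OF x] by blast
    show ?thesis unfolding sum_ind[OF T(2,1)] using c T by blast
  qed
  then show ?thesis by blast
qed

lemma step_function_square_integrable:
  assumes "\<And>T. T \<in> P \<Longrightarrow> f constant_on T"
  shows "square_integrable \<Omega> f"
proof -
  obtain c where c: "\<forall>x\<in>\<Omega>. f x = (\<Sum>T\<in>P. c T * ind T x)" using step_function[OF assms] by blast
  have "square_integrable \<Omega> (\<lambda>x. \<Sum>T\<in>P. c T * ind T x)"
    by (rule square_integrable_sum[OF finite_cells ind_square_integrable])
  then show ?thesis using square_integrable_cong[of \<Omega> f "\<lambda>x. \<Sum>T\<in>P. c T * ind T x"] c by simp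
qed

lemma ind_sum_constant_on: "T \<in> P \<Longrightarrow> (\<lambda>x. \<Sum>T\<in>P. c T * ind T x) constant_on T"
  unfolding constant_on_def using sum_ind[of _ T c] by blast

lemma l2_sum_ind_ind:
  assumes T: "T \<in> P"
  shows "l2_inner \<Omega> (\<lambda>x. \<Sum>T\<in>P. c T * ind T x) (ind T) = c T * vol T"
proof -
  have "l2_inner \<Omega> (\<lambda>x. \<Sum>T\<in>P. c T * ind T x) (ind T) = (\<Sum>T'\<in>P. c T' * l2_inner \<Omega> (ind T') (ind T))"
    by (rule l2_sum_left[OF finite_cells ind_square_integrable ind_square_integrable[OF T]])
  also have "\<dots> = c T * l2_inner \<Omega> (ind T) (ind T)"
    by (rule cell_sum_eq[OF T]) (simp add: l2_ind T)
  finally show ?thesis by (simp add: l2_ind T)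
qed

end

locale multiresolution = admissible_operator \<Omega> s \<L> for \<Omega> :: "(real^'n) set" and s \<L> +
  fixes h \<delta> :: real and q :: nat and \<tau> :: "nat \<Rightarrow> (real^'n) set set" and N :: nat
    and lev :: "nat \<Rightarrow> nat" and w :: "nat \<Rightarrow> real^'n \<Rightarrow> real"
  assumes nonempty: "\<Omega> \<noteq> {}" and diam: "diameter \<Omega> = 1" and s_pos: "1 \<le> s"
    and h: "0 < h" "h < 1" and \<delta>: "0 < \<delta>" "\<delta> < 1" and q_pos: "1 \<le> q"
    and nested: "nested_partitions \<Omega> h \<delta> q \<tau>"
    and order: "coarse_to_fine q N lev"
    and basis: "multiresolution_basis \<Omega> q \<tau> N lev w"
begin

lemma cells: "l \<in> {1..q} \<Longrightarrow> cell_partition \<Omega> (\<tau> l) (h ^ l) (\<delta> * h ^ l)"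
  using nested h \<delta> by unfold_locales (auto simp: nested_partitions_def)

lemma lev_range: "i < N \<Longrightarrow> 1 \<le> lev i \<and> lev i \<le> q"
  using order unfolding coarse_to_fine_def by auto

lemma lev_mono: "i \<le> j \<Longrightarrow> j < N \<Longrightarrow> lev i \<le> lev j"
  using order unfolding coarse_to_fine_def by (auto simp: mono_on_def)

lemma V_space_iff: "1 \<le> l \<Longrightarrow> f \<in> V_space \<Omega> \<tau> l \<longleftrightarrow> (\<forall>T\<in>\<tau> l. f constant_on T)"
  by (simp add: V_space_def)

lemma V_space_Suc:
  assumes l: "1 \<le> l" "l < q" and f: "f \<in> V_space \<Omega> \<tau> l"
  shows "f \<in> V_space \<Omega> \<tau> (Suc l)"
proof -
  interpret A: cell_partition \<Omega> "\<tau> l" "h ^ l" "\<delta> * h ^ l" using l by (intro cells) auto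
  interpret B: cell_partition \<Omega> "\<tau> (Suc l)" "h ^ Suc l" "\<delta> * h ^ Suc l" using l by (intro cells) auto
  have "f constant_on T" if T: "T \<in> \<tau> (Suc l)" for T
  proof -
    have "T \<noteq> {}" using B.partition T by (auto simp: partition_on_def)
    then obtain x where x: "x \<in> T" by blast
    obtain S where S: "S \<in> \<tau> l" "x \<in> S" using A.cell_exists B.cell_subset[OF T] x by blast
    obtain U where U: "U \<subseteq> \<tau> (Suc l)" "S = \<Union>U"
      using nested l S(1) unfolding nested_partitions_def by (metis atLeastLessThan_iff)
    obtain T' where T': "T' \<in> U" "x \<in> T'" using U(2) S(2) by blast
    \<comment> \<open>Nestedness describes a parent as a union of children; disjointness identifies
      the child containing \<open>x\<close> with \<open>T\<close>.\<close>
    then have "T' = T" using B.cells_disjoint[of T' T x] U(1) T x by blast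
    then have "T \<subseteq> S" using T'(1) U(2) by blast
    moreover have "f constant_on S" using f S(1) l by (simp add: V_space_iff)
    ultimately show ?thesis by (auto simp: constant_on_def)
  qed
  then show ?thesis by (simp add: V_space_iff)
qed

lemma V_space_mono:
  assumes "1 \<le> l" "l \<le> m" "m \<le> q" "f \<in> V_space \<Omega> \<tau> l"
  shows "f \<in> V_space \<Omega> \<tau> m"
  using assms(2,3)
proof (induction m rule: dec_induct)
  case (step m)
  then show ?case using assms(1) by (intro V_space_Suc) auto
qed (use assms in simp)

lemma V_space_square_integrable:
  assumes "l \<in> {1..q}" "f \<in> V_space \<Omega> \<tau> l"
  shows "square_integrable \<Omega> f"
  using cell_partition.step_function_square_integrable[OF cells[OF assms(1)]] assms by (simp add: V_space_iff)

text \<open>As \<open>lev\<close> is monotone, this is an initial segment of the order. It is empty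
  for level 0, where no orthogonality is available.\<close>

definition idx :: "nat \<Rightarrow> nat set" where "idx l = {i. i < N \<and> lev i \<le> l}"

lemma finite_idx: "finite (idx l)"
  unfolding idx_def by simp

lemma basis_W: "i < N \<Longrightarrow> w i \<in> W_space \<Omega> \<tau> (lev i)"
  using basis lev_range[of i] unfolding multiresolution_basis_def Let_def by auto

lemma basis_V: "i \<in> idx l \<Longrightarrow> l \<le> q \<Longrightarrow> w i \<in> V_space \<Omega> \<tau> l"
  using basis_W[of i] lev_range[of i] V_space_mono[of "lev i" l "w i"]
  unfolding idx_def W_space_def by auto

lemma basis_square_integrable: "i < N \<Longrightarrow> square_integrable \<Omega> (w i)"
  using V_space_square_integrable[of "lev i" "w i"] basis_W[of i] lev_range[of i] unfolding W_space_def by auto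

text \<open>Across levels, the coarser function lies in the \<open>V_space\<close> just below the
  level of the finer one, and \<open>W_space\<close> is orthogonal to it.\<close>

lemma basis_orthonormal:
  assumes i: "i < N" and j: "j < N"
  shows "l2_inner \<Omega> (w i) (w j) = (if i = j then 1 else 0)"
proof -
  have lt: "l2_inner \<Omega> (w i) (w j) = 0" if "i < N" "j < N" "lev i < lev j" for i j
  proof -
    have "w i \<in> V_space \<Omega> \<tau> (lev j - 1)"
      using that lev_range[of j] by (intro basis_V) (auto simp: idx_def)
    then have "l2_inner \<Omega> (w j) (w i) = 0" using basis_W[OF that(2)] unfolding W_space_def by auto
    then show ?thesis by (simp add: l2_sym)
  qed
  consider "lev i < lev j" | "lev j < lev i" | "lev i = lev j" by linarith
  then show ?thesis
  proof cases
    case 1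
    then show ?thesis using lt[OF i j] by auto
  next
    case 2
    then show ?thesis using lt[OF j i] by (auto simp: l2_sym)
  next
    case 3
    then show ?thesis using basis i j lev_range[OF i] unfolding multiresolution_basis_def Let_def by auto
  qed
qed

definition comb :: "(nat \<Rightarrow> real) \<Rightarrow> real^'n \<Rightarrow> real" where
  "comb x = (\<lambda>y. \<Sum>i<N. x i * w i y)"

lemma comb_square_integrable: "square_integrable \<Omega> (comb x)"
  unfolding comb_def by (intro square_integrable_sum basis_square_integrable) auto

lemma l2_comb_left: "square_integrable \<Omega> f \<Longrightarrow> l2_inner \<Omega> (comb x) f = (\<Sum>i<N. x i * l2_inner \<Omega> (w i) f)"
  unfolding comb_def by (intro l2_sum_left basis_square_integrable) auto

lemma l2_comb: "l2_inner \<Omega> (comb x) (comb y) = (\<Sum>i<N. x i * y i)"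
proof -
  have "l2_inner \<Omega> (w i) (comb y) = y i" if i: "i < N" for i
  proof -
    have "l2_inner \<Omega> (comb y) (w i) = (\<Sum>j<N. y j * l2_inner \<Omega> (w j) (w i))"
      by (rule l2_comb_left[OF basis_square_integrable[OF i]])
    also have "\<dots> = (\<Sum>j<N. if j = i then y j else 0)"
      using i by (intro sum.cong) (auto simp: basis_orthonormal)
    also have "\<dots> = y i" using i by simp
    finally show ?thesis by (simp add: l2_sym)
  qed
  then show ?thesis by (simp add: l2_comb_left[OF comb_square_integrable])
qed

text \<open>Subtracting the cell averages of level \<open>l\<close>, which is the orthogonal
  projection, leaves an element of the next \<open>W_space\<close>, and this is spanned by the basis
  functions of level \<open>l + 1\<close>.\<close>

lemma basis_spans:
  assumes "l \<le> q" "f \<in> V_space \<Omega> \<tau> l"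
  shows "\<exists>a. \<forall>x\<in>\<Omega>. f x = (\<Sum>i\<in>idx l. a i * w i x)"
  using assms
proof (induction l arbitrary: f)
  case 0
  have "idx 0 = {}" using lev_range by (force simp: idx_def)
  then show ?case using 0 by (auto simp: V_space_def)
next
  case (Suc l)
  interpret B: cell_partition \<Omega> "\<tau> (Suc l)" "h ^ Suc l" "\<delta> * h ^ Suc l" using Suc.prems by (intro cells) auto
  have fs: "square_integrable \<Omega> f" using Suc.prems by (intro V_space_square_integrable[of "Suc l"]) auto
  have "\<exists>g. g \<in> V_space \<Omega> \<tau> l \<and> (\<lambda>x. f x - g x) \<in> W_space \<Omega> \<tau> (Suc l)"
  \<comment> \<open>\<open>V_space\<close> at level 0 consists of zero only, not of the functions
    constant on the single cell of \<open>\<tau> 0\<close>, so nothing is subtracted.\<close>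
  proof (cases "l = 0")
    case True
    have "l2_inner \<Omega> f g = 0" if "g \<in> V_space \<Omega> \<tau> 0" for g
    proof -
      have "l2_inner \<Omega> f g = l2_inner \<Omega> f (\<lambda>x. 0)"
        by (rule l2_cong) (use that in \<open>auto simp: V_space_def\<close>)
      then show ?thesis by (simp add: l2_inner_def)
    qed
    then show ?thesis using True Suc.prems by (intro exI[of _ "\<lambda>_. 0"]) (auto simp: W_space_def V_space_def)
  next
    case False
    interpret A: cell_partition \<Omega> "\<tau> l" "h ^ l" "\<delta> * h ^ l" using Suc.prems False by (intro cells) auto
    have l1: "1 \<le> l" using False by simp
    define g where "g = (\<lambda>x. \<Sum>T\<in>\<tau> l. (l2_inner \<Omega> f (indicat_real T) / A.vol T) * indicat_real T x)"
    have gV: "g \<in> V_space \<Omega> \<tau> l" 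
      unfolding V_space_iff[OF l1] g_def by (intro ballI A.ind_sum_constant_on)
    have gs: "square_integrable \<Omega> g" using gV Suc.prems False by (intro V_space_square_integrable[of l]) auto
    have "g \<in> V_space \<Omega> \<tau> (Suc l)" using gV Suc.prems False by (intro V_space_Suc) auto
    then have V: "(\<lambda>x. f x - g x) \<in> V_space \<Omega> \<tau> (Suc l)"
      using Suc.prems by (fastforce simp: V_space_iff constant_on_def)
    have "l2_inner \<Omega> (\<lambda>x. f x - g x) k = 0" if k: "k \<in> V_space \<Omega> \<tau> l" for k
    proof -
      obtain d where d: "\<forall>x\<in>\<Omega>. k x = (\<Sum>T\<in>\<tau> l. d T * indicat_real T x)"
        using A.step_function[of k] k unfolding V_space_iff[OF l1] by blast
      have "l2_inner \<Omega> (\<lambda>x. f x - g x) k = l2_inner \<Omega> (\<lambda>x. 1 * f x + (-1) * g x) (\<lambda>x. \<Sum>T\<in>\<tau> l. d T * indicat_real T x)"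
        by (rule l2_cong) (use d in auto)
      also have "\<dots> = (\<Sum>T\<in>\<tau> l. d T * l2_inner \<Omega> (\<lambda>x. 1 * f x + (-1) * g x) (indicat_real T))"
        by (rule l2_sum_right[OF A.finite_cells A.ind_square_integrable square_integrable_lincomb[OF fs gs]])
      also have "\<dots> = 0"
      proof (rule sum.neutral, rule ballI)
        fix T assume T: "T \<in> \<tau> l"
        have "l2_inner \<Omega> (\<lambda>x. 1 * f x + (-1) * g x) (indicat_real T) = l2_inner \<Omega> f (indicat_real T) - l2_inner \<Omega> g (indicat_real T)"
          unfolding l2_lincomb_left[OF fs gs A.ind_square_integrable[OF T]] by simp
        also have "l2_inner \<Omega> g (indicat_real T) = l2_inner \<Omega> f (indicat_real T)"
          unfolding g_def A.l2_sum_ind_ind[OF T] using A.vol_pos[OF T] by simp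
        finally show "d T * l2_inner \<Omega> (\<lambda>x. 1 * f x + (-1) * g x) (indicat_real T) = 0" by simp
      qed
      finally show ?thesis .
    qed
    then show ?thesis using gV V by (intro exI[of _ g]) (simp add: W_space_def)
  qed
  then obtain g where g: "g \<in> V_space \<Omega> \<tau> l" "(\<lambda>x. f x - g x) \<in> W_space \<Omega> \<tau> (Suc l)" by blast
  have "l \<le> q" using Suc.prems by simp
  then obtain a where a: "\<forall>x\<in>\<Omega>. g x = (\<Sum>i\<in>idx l. a i * w i x)"
    using Suc.IH[OF _ g(1)] by blast
  let ?J = "{i. i < N \<and> lev i = Suc l}"
  have "\<forall>f\<in>W_space \<Omega> \<tau> (Suc l). \<exists>b. \<forall>x\<in>\<Omega>. f x = (\<Sum>i\<in>?J. b i * w i x)"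
    using basis Suc.prems unfolding multiresolution_basis_def Let_def by simp
  from bspec[OF this g(2)] obtain b where b: "\<forall>x\<in>\<Omega>. f x - g x = (\<Sum>i\<in>?J. b i * w i x)"
    by blast
  have un: "idx (Suc l) = idx l \<union> ?J" "idx l \<inter> ?J = {}" by (auto simp: idx_def)
  have "f x = (\<Sum>i\<in>idx (Suc l). (if lev i \<le> l then a i else b i) * w i x)" if x: "x \<in> \<Omega>" for x
  proof -
    have "(\<Sum>i\<in>idx (Suc l). (if lev i \<le> l then a i else b i) * w i x) =
      (\<Sum>i\<in>idx l. (if lev i \<le> l then a i else b i) * w i x) + (\<Sum>i\<in>?J. (if lev i \<le> l then a i else b i) * w i x)"
      unfolding un(1) by (rule sum.union_disjoint) (use finite_idx un(2) in auto)
    also have "(\<Sum>i\<in>idx l. (if lev i \<le> l then a i else b i) * w i x) = g x"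
      unfolding a[rule_format, OF x] by (rule sum.cong) (auto simp: idx_def)
    also have "(\<Sum>i\<in>?J. (if lev i \<le> l then a i else b i) * w i x) = f x - g x"
      unfolding b[rule_format, OF x] by (rule sum.cong) auto
    finally show ?thesis by simp
  qed
  then show ?case by (intro exI[of _ "\<lambda>i. if lev i \<le> l then a i else b i"] ballI)
qed

lemma indicator_V_space:
  assumes l: "l \<in> {1..q}" and T: "T \<in> \<tau> l"
  shows "indicat_real T \<in> V_space \<Omega> \<tau> l"
proof -
  interpret A: cell_partition \<Omega> "\<tau> l" "h ^ l" "\<delta> * h ^ l" by (rule cells[OF l])
  have l1: "1 \<le> l" using l by simp
  show ?thesis
    unfolding V_space_iff[OF l1]
  proof
    fix T' assume T': "T' \<in> \<tau> l"
    have "indicat_real T x = (if T = T' then 1 else 0)" if "x \<in> T'" for x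
      using A.cells_disjoint[OF T T'] that by (auto simp: indicator_def)
    then show "indicat_real T constant_on T'" unfolding constant_on_def by blast
  qed
qed

text \<open>Evaluate the sum of all \<open>\<langle>w\<^sub>i, 1\<^sub>T\<rangle>\<^sup>2 / |T|\<close> with Parseval's identity in both bases.\<close>

lemma card_idx:
  assumes l: "l \<in> {1..q}"
  shows "card (idx l) = card (\<tau> l)"
proof -
  interpret A: cell_partition \<Omega> "\<tau> l" "h ^ l" "\<delta> * h ^ l" by (rule cells[OF l])
  have l1: "1 \<le> l" and lq: "l \<le> q" using l by auto
  let ?p = "\<lambda>i T. l2_inner \<Omega> (w i) (indicat_real T)"
  have 1: "(\<Sum>T\<in>\<tau> l. (?p i T)\<^sup>2 / A.vol T) = 1" if i: "i \<in> idx l" for i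
  proof -
    have iN: "i < N" using i by (simp add: idx_def)
    have "w i \<in> V_space \<Omega> \<tau> l" using i l by (intro basis_V) auto
    then obtain c where c: "\<forall>x\<in>\<Omega>. w i x = (\<Sum>T\<in>\<tau> l. c T * indicat_real T x)"
      using A.step_function[of "w i"] unfolding V_space_iff[OF l1] by blast
    have p: "?p i T = c T * A.vol T" if "T \<in> \<tau> l" for T
      unfolding A.l2_sum_ind_ind[OF that, symmetric] by (rule l2_cong) (use c in auto)
    have "1 = l2_inner \<Omega> (w i) (w i)" by (simp add: basis_orthonormal[OF iN iN])
    also have "\<dots> = l2_inner \<Omega> (\<lambda>x. \<Sum>T\<in>\<tau> l. c T * indicat_real T x) (\<lambda>x. \<Sum>T\<in>\<tau> l. c T * indicat_real T x)"
      by (rule l2_cong) (use c in auto)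
    also have "\<dots> = (\<Sum>T\<in>\<tau> l. (?p i T)\<^sup>2 / A.vol T)"
      unfolding A.l2_sum_ind
    proof (rule sum.cong[OF refl])
      fix T assume T: "T \<in> \<tau> l"
      show "c T * c T * A.vol T = (?p i T)\<^sup>2 / A.vol T"
        unfolding p[OF T] using A.vol_pos[OF T] by (simp add: power2_eq_square)
    qed
    finally show ?thesis by simp
  qed
  have 2: "(\<Sum>i\<in>idx l. (?p i T)\<^sup>2 / A.vol T) = 1" if T: "T \<in> \<tau> l" for T
  proof -
    have V: "indicat_real T \<in> V_space \<Omega> \<tau> l" by (rule indicator_V_space[OF l T])
    obtain a where a: "\<forall>x\<in>\<Omega>. indicat_real T x = (\<Sum>i\<in>idx l. a i * w i x)"
      using basis_spans[OF lq V] by blast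
    define a' where "a' i = (if i \<in> idx l then a i else 0)" for i
    have eq: "indicat_real T x = comb a' x" if x: "x \<in> \<Omega>" for x
      unfolding a[rule_format, OF x] comb_def a'_def
      by (rule sum.mono_neutral_cong_left) (auto simp: idx_def)
    have p: "?p i T = a i" if i: "i \<in> idx l" for i
    proof -
      have "i < N" using i by (simp add: idx_def)
      have "?p i T = l2_inner \<Omega> (comb a') (w i)"
        by (subst l2_sym) (rule l2_cong, use eq in auto)
      also have "\<dots> = (\<Sum>j<N. a' j * l2_inner \<Omega> (w j) (w i))"
        by (rule l2_comb_left[OF basis_square_integrable[OF \<open>i < N\<close>]])
      also have "\<dots> = (\<Sum>j<N. if j = i then a' j else 0)"
        using \<open>i < N\<close> by (intro sum.cong) (auto simp: basis_orthonormal)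
      also have "\<dots> = a i" using \<open>i < N\<close> i by (simp add: a'_def)
      finally show ?thesis .
    qed
    have "A.vol T = l2_inner \<Omega> (indicat_real T) (indicat_real T)" by (simp add: A.l2_ind T)
    also have "\<dots> = l2_inner \<Omega> (comb a') (comb a')" by (rule l2_cong) (use eq in auto)
    also have "\<dots> = (\<Sum>i<N. a' i * a' i)" by (rule l2_comb)
    also have "\<dots> = (\<Sum>i\<in>idx l. (?p i T)\<^sup>2)"
      by (rule sum.mono_neutral_cong_right) (auto simp: idx_def p a'_def power2_eq_square)
    finally show ?thesis using A.vol_pos[OF T] by (simp add: sum_divide_distrib[symmetric])
  qed
  have "real (card (idx l)) = (\<Sum>i\<in>idx l. \<Sum>T\<in>\<tau> l. (?p i T)\<^sup>2 / A.vol T)" by (simp add: 1)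
  also have "\<dots> = (\<Sum>T\<in>\<tau> l. \<Sum>i\<in>idx l. (?p i T)\<^sup>2 / A.vol T)" by (rule sum.swap)
  also have "\<dots> = real (card (\<tau> l))" by (simp add: 2)
  finally show ?thesis by simp
qed

text \<open>The volume is confined by the inner ball of one cell of level 1 and, because the
  diameter is 1, by the unit ball around any point of the domain.\<close>

lemma vol_domain_bounds:
  "unit_ball_vol (real CARD('n)) * (\<delta> * h) ^ CARD('n) \<le> measure lebesgue \<Omega>"
  "measure lebesgue \<Omega> \<le> unit_ball_vol (real CARD('n))"
proof -
  interpret A: cell_partition \<Omega> "\<tau> 1" "h ^ 1" "\<delta> * h ^ 1" using q_pos by (intro cells) auto
  obtain x where x: "x \<in> \<Omega>" using nonempty by blast
  obtain T where T: "T \<in> \<tau> 1" using A.cell_exists[OF x] by blast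
  have "A.vol T \<le> A.vol \<Omega>"
    using A.sum_vol_le(1)[of "{T}"] T by simp
  then show "unit_ball_vol (real CARD('n)) * (\<delta> * h) ^ CARD('n) \<le> measure lebesgue \<Omega>"
    using A.vol_ge[OF T] by (simp add: A.vol_def)
  have "\<Omega> \<subseteq> cball x 1"
    using diameter_bounded_bound[OF bounded_domain x] diam by auto
  then have "measure lebesgue \<Omega> \<le> measure lebesgue (cball x 1)"
    using A.domain_lmeasurable by (intro measure_mono_fmeasurable) auto
  then show "measure lebesgue \<Omega> \<le> unit_ball_vol (real CARD('n))"
    using content_cball[of 1 x] by simp
qed

text \<open>Disjoint inner balls fit into the volume of the domain. The volume of the unit ball
  cancels, here and in the converse bound by the outer balls.\<close>

lemma card_cells_le: "l \<in> {1..q} \<Longrightarrow> real (card (\<tau> l)) * (\<delta> * h ^ l) ^ CARD('n) \<le> 1"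
proof -
  assume l: "l \<in> {1..q}"
  interpret A: cell_partition \<Omega> "\<tau> l" "h ^ l" "\<delta> * h ^ l" by (rule cells[OF l])
  have p: "0 < unit_ball_vol (real CARD('n))" by simp
  have "unit_ball_vol (real CARD('n)) * (real (card (\<tau> l)) * (\<delta> * h ^ l) ^ CARD('n)) \<le> unit_ball_vol (real CARD('n)) * 1"
    using order_trans[OF A.card_cells_le[unfolded A.vol_def] vol_domain_bounds(2)]
    by (simp only: mult.left_commute mult_1_right)
  then show ?thesis using p mult_le_cancel_left_pos[OF p] by blast
qed

lemma card_cells_ge: "l \<in> {1..q} \<Longrightarrow> (\<delta> * h) ^ CARD('n) \<le> real (card (\<tau> l)) * (h ^ l) ^ CARD('n)"
proof -
  assume l: "l \<in> {1..q}"
  interpret A: cell_partition \<Omega> "\<tau> l" "h ^ l" "\<delta> * h ^ l" by (rule cells[OF l])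
  have p: "0 < unit_ball_vol (real CARD('n))" by simp
  have "unit_ball_vol (real CARD('n)) * (\<delta> * h) ^ CARD('n) \<le> unit_ball_vol (real CARD('n)) * (real (card (\<tau> l)) * (h ^ l) ^ CARD('n))"
    using order_trans[OF vol_domain_bounds(1) A.vol_domain_le[unfolded A.vol_def]]
    by (simp only: mult.left_commute)
  then show ?thesis using p mult_le_cancel_left_pos[OF p] by blast
qed

section \<open>The Gram matrix of the basis under the inverse operator\<close>

definition gram :: "nat \<Rightarrow> nat \<Rightarrow> real" where
  "gram i j = l2_inner \<Omega> (w i) (solution (w j))"

text \<open>A preimage of \<open>comb x\<close>, assembled from those of the basis functions because
  \<open>inverse_op\<close> is an arbitrary choice and need not be linear pointwise.\<close>

definition gram_solution :: "(nat \<Rightarrow> real) \<Rightarrow> real^'n \<Rightarrow> real" where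
  "gram_solution x = (\<lambda>y. \<Sum>j<N. x j * solution (w j) y)"

lemma gram_solution_H: "gram_solution x \<in> H"
  unfolding gram_solution_def by (intro sobolev0_sum solution(1) basis_square_integrable) auto

lemma energy_gram_solution: "v \<in> H \<Longrightarrow> \<L> (gram_solution x) v = l2_inner \<Omega> (comb x) v"
  unfolding gram_solution_def
  by (subst energy.sum_left)
    (auto simp: solution basis_square_integrable l2_comb_left sobolev0_square_integrable)

lemma gram_sum: "i < N \<Longrightarrow> (\<Sum>j<N. gram i j * x j) = l2_inner \<Omega> (w i) (gram_solution x)"
  unfolding gram_solution_def gram_def
  by (subst l2_sum_right) (auto simp: basis_square_integrable sobolev0_square_integrable[OF solution(1)] mult.commute)

lemma gram_form: "(\<Sum>i<N. x i * (\<Sum>j<N. gram i j * y j)) = l2_inner \<Omega> (comb x) (gram_solution y)"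
  by (simp add: gram_sum l2_comb_left sobolev0_square_integrable[OF gram_solution_H])

text \<open>The entries of \<open>z\<close> are not controlled, those of \<open>x\<close> are.
  Condition \<open>zx\<close> holds when \<open>z\<close> and \<open>x\<close> differ only where the
  image of \<open>z\<close> vanishes; it turns the energy into a pairing with \<open>comb x\<close>,
  whose norm is that of \<open>x\<close>.\<close>

lemma gram_upper_bound:
  assumes zx: "(\<Sum>i<N. z i * (\<Sum>j<N. gram i j * z j)) = (\<Sum>i<N. x i * (\<Sum>j<N. gram i j * z j))"
    and orth: "\<And>i. i \<in> idx l \<Longrightarrow> (\<Sum>j<N. gram i j * z j) = 0" and l: "l \<le> q"
  shows "(\<Sum>i<N. z i * (\<Sum>j<N. gram i j * z j)) \<le>
    opn * inv_opn\<^sup>2 * (sqrt (real CARD('n)) ^ (s * s) * (sqrt (2 * 2 ^ CARD('n)) * h ^ l) ^ s)\<^sup>2 * (\<Sum>i<N. (x i)\<^sup>2)"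
proof -
  let ?v = "gram_solution z"
  let ?\<kappa> = "sqrt (real CARD('n)) ^ (s * s) * (sqrt (2 * 2 ^ CARD('n)) * h ^ l) ^ s"
  have vH: "?v \<in> H" by (rule gram_solution_H)
  have vs: "square_integrable \<Omega> ?v" by (rule sobolev0_square_integrable[OF vH])
  have e: "\<L> ?v ?v = (\<Sum>i<N. z i * (\<Sum>j<N. gram i j * z j))"
    by (simp add: energy_gram_solution vH gram_form)
  have kap: "sqrt (l2_inner \<Omega> ?v ?v) \<le> ?\<kappa> * nrm ?v"
  \<comment> \<open>Level 0 has no convex cells, hence no Poincare inequality; there the constant is
    at least 1 and the Sobolev norm dominates the \<open>L\<^sup>2\<close> norm.\<close>
  proof (cases "l = 0")
    case True
    have "1 \<le> sqrt (real CARD('n))" by (simp add: Suc_leI)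
    moreover have "(1 :: real) \<le> 2 ^ CARD('n)" by (rule one_le_power) simp
    then have "1 \<le> sqrt (2 * 2 ^ CARD('n))" by (intro real_sqrt_ge_one) linarith
    ultimately have "1 * 1 \<le> ?\<kappa>"
      unfolding True by (intro mult_mono one_le_power) auto
    then have "1 * nrm ?v \<le> ?\<kappa> * nrm ?v" by (intro mult_right_mono sobolev_norm_nonneg) simp
    then show ?thesis using l2_le_sobolev_norm[OF sobolev0_sobolev[OF vH]] by simp
  next
    case False
    then interpret A: cell_partition \<Omega> "\<tau> l" "h ^ l" "\<delta> * h ^ l" using l by (intro cells) auto
    have "l2_inner \<Omega> ?v (indicat_real T) = 0" if T: "T \<in> \<tau> l" for T
    proof -
      have "indicat_real T \<in> V_space \<Omega> \<tau> l"
        using False l T by (intro indicator_V_space) auto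
      then obtain a where a: "\<forall>x\<in>\<Omega>. indicat_real T x = (\<Sum>i\<in>idx l. a i * w i x)"
        using basis_spans[OF l] by blast
      have "l2_inner \<Omega> ?v (indicat_real T) = l2_inner \<Omega> ?v (\<lambda>x. \<Sum>i\<in>idx l. a i * w i x)"
        by (rule l2_cong) (use a in auto)
      also have "\<dots> = (\<Sum>i\<in>idx l. a i * l2_inner \<Omega> ?v (w i))"
        by (rule l2_sum_right[OF finite_idx _ vs]) (auto simp: idx_def basis_square_integrable)
      also have "\<dots> = 0"
      proof (rule sum.neutral, rule ballI)
        fix i assume i: "i \<in> idx l"
        then have "i < N" by (simp add: idx_def)
        then show "a i * l2_inner \<Omega> ?v (w i) = 0"
          using orth[OF i] by (simp add: gram_sum l2_sym)
      qed
      finally show ?thesis .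
    qed
    then show ?thesis using h by (intro A.l2_le_of_mean_zero vH s_pos) auto
  qed
  have "\<L> ?v ?v \<le> opn * inv_opn\<^sup>2 * ?\<kappa>\<^sup>2 * l2_inner \<Omega> (comb x) (comb x)"
    by (rule energy_upper_bound[OF vH comb_square_integrable _ _ kap])
      (use zx e h in \<open>auto simp: gram_form\<close>)
  then show ?thesis unfolding e l2_comb by (simp add: power2_eq_square)
qed

text \<open>The base of the power is the bump radius relative to \<open>h ^ l\<close>. It enters
  with exponent \<open>CARD('n)\<close> through the volume of a bump and with \<open>2 * s\<close>
  through its derivatives.\<close>

definition gram_const :: real where
  "gram_const = (\<delta> / (2 * real CARD('n))) ^ (CARD('n) + 2 * s) * (bump_mass TYPE('n))\<^sup>2 /
     (unit_ball_vol (real CARD('n)) * opn * bump_energy TYPE('n) s)"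

lemma gram_lower_bound:
  assumes l: "l \<in> {1..q}" and x: "\<And>i. i < N \<Longrightarrow> i \<notin> idx l \<Longrightarrow> x i = 0"
  shows "gram_const * (h ^ l) ^ (2 * s) * (\<Sum>i<N. (x i)\<^sup>2) \<le> (\<Sum>i<N. x i * (\<Sum>j<N. gram i j * x j))"
proof -
  interpret A: cell_partition \<Omega> "\<tau> l" "h ^ l" "\<delta> * h ^ l" by (rule cells[OF l])
  define n where "n = CARD('n)"
  define r where "r = h ^ l"
  \<comment> \<open>The factor \<open>2 * n\<close> makes the radius \<open>n * \<theta>\<close> of
    the bump support half the inner radius of a cell.\<close>
  define \<eta> where "\<eta> = \<delta> / (2 * real n)"
  define \<theta> where "\<theta> = \<eta> * r"
  define m where "m = bump_mass TYPE('n)"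
  define J where "J = bump_energy TYPE('n) s"
  define om where "om = unit_ball_vol (real n)"
  have n: "0 < n" by (simp add: n_def)
  have r: "0 < r" "r \<le> 1" unfolding r_def using h by (auto simp: power_le_one)
  have \<eta>: "0 < \<eta>" "\<eta> \<le> 1" unfolding \<eta>_def using \<delta> n by (auto simp: field_simps)
  have \<theta>: "0 < \<theta>" "\<theta> \<le> 1" unfolding \<theta>_def using \<eta> r by (auto intro: mult_le_one)
  have \<theta>n: "real CARD('n) * \<theta> < \<delta> * h ^ l"
    using n r \<delta> unfolding \<theta>_def \<eta>_def r_def[symmetric] n_def[symmetric] by (simp add: field_simps)
  have pos: "0 < m" "0 < J" "0 < om" "0 < opn"
    unfolding m_def J_def om_def by (simp_all add: bump_mass_pos bump_energy_pos opn_pos)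
  let ?u = "gram_solution x" and ?f = "comb x"
  define E where "E = \<L> ?u ?u"
  have uH: "?u \<in> H" by (rule gram_solution_H)
  have E: "E = (\<Sum>i<N. x i * (\<Sum>j<N. gram i j * x j))"
    unfolding E_def by (simp add: energy_gram_solution uH gram_form)
  have E0: "0 \<le> E" unfolding E_def by (rule energy.nonneg[OF uH])
  have "?f constant_on T" if T: "T \<in> \<tau> l" for T
  proof -
    have "\<forall>i\<in>idx l. \<exists>c. \<forall>y\<in>T. w i y = c"
      using basis_V[of _ l] l T by (auto simp: V_space_iff constant_on_def)
    then obtain c where c: "\<And>i y. i \<in> idx l \<Longrightarrow> y \<in> T \<Longrightarrow> w i y = c i" by metis
    have "comb x y = (\<Sum>i<N. x i * c i)" if "y \<in> T" for y
      unfolding comb_def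
    proof (rule sum.cong[OF refl])
      fix i assume "i \<in> {..<N}"
      then show "x i * w i y = x i * c i" using x[of i] c[of i y] that by (cases "i \<in> idx l") auto
    qed
    then show ?thesis unfolding constant_on_def by blast
  qed
  then obtain c where c: "\<forall>y\<in>\<Omega>. ?f y = (\<Sum>T\<in>\<tau> l. c T * indicat_real T y)"
    using A.step_function[of ?f] by blast
  define S where "S = (\<Sum>T\<in>\<tau> l. (c T)\<^sup>2)"
  have S0: "0 \<le> S" unfolding S_def by (intro sum_nonneg) auto
  obtain v where v: "v \<in> H"
    and p: "l2_inner \<Omega> (\<lambda>x. \<Sum>T\<in>\<tau> l. c T * indicat_real T x) v = S * \<theta> ^ n * m"
    and nv: "\<theta> ^ (2 * s) * (nrm v)\<^sup>2 \<le> S * \<theta> ^ n * J"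
    unfolding S_def n_def m_def J_def by (rule A.dual_pairing_lower_bound[OF \<theta> \<theta>n])
  have fv: "l2_inner \<Omega> ?f v = S * \<theta> ^ n * m"
    unfolding p[symmetric] by (rule l2_cong) (use c in auto)
  have "(S * \<theta> ^ n * m)\<^sup>2 \<le> E * (opn * (nrm v)\<^sup>2)"
    unfolding fv[symmetric] E_def by (rule energy_lower_bound[OF uH v energy_gram_solution[OF v]])
  then have "\<theta> ^ (2 * s) * (S * \<theta> ^ n * m)\<^sup>2 \<le> \<theta> ^ (2 * s) * (E * (opn * (nrm v)\<^sup>2))"
    using \<theta> by (intro mult_left_mono) auto
  also have "\<dots> = E * opn * (\<theta> ^ (2 * s) * (nrm v)\<^sup>2)" by (simp add: mult_ac)
  also have "\<dots> \<le> E * opn * (S * \<theta> ^ n * J)" using nv E0 pos by (intro mult_left_mono) auto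
  finally have "(S * \<theta> ^ n) * (\<theta> ^ (2 * s) * (S * \<theta> ^ n * m\<^sup>2)) \<le> (S * \<theta> ^ n) * (E * opn * J)"
    by (simp add: power2_eq_square mult_ac)
  \<comment> \<open>One factor \<open>S * \<theta> ^ n\<close> is cancelled; for
    \<open>S = 0\<close> the left-hand side is zero.\<close>
  then have key: "\<theta> ^ (2 * s) * (S * \<theta> ^ n * m\<^sup>2) \<le> E * opn * J"
    using \<theta> S0 E0 pos by (cases "S = 0") (auto simp: mult_le_cancel_left)
  have "(\<Sum>i<N. (x i)\<^sup>2) = l2_inner \<Omega> ?f ?f" by (simp add: l2_comb power2_eq_square)
  also have "\<dots> = l2_inner \<Omega> (\<lambda>y. \<Sum>T\<in>\<tau> l. c T * indicat_real T y) (\<lambda>y. \<Sum>T\<in>\<tau> l. c T * indicat_real T y)"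
    by (rule l2_cong) (use c in auto)
  also have "\<dots> \<le> S * (om * r ^ n)"
    unfolding S_def om_def n_def r_def by (rule A.l2_step_function_le)
  finally have X: "(\<Sum>i<N. (x i)\<^sup>2) \<le> S * (om * r ^ n)" .
  have gc: "gram_const = \<eta> ^ (n + 2 * s) * m\<^sup>2 / (om * opn * J)"
    unfolding gram_const_def \<eta>_def n_def m_def om_def J_def ..
  have "gram_const * r ^ (2 * s) * (\<Sum>i<N. (x i)\<^sup>2) \<le> gram_const * r ^ (2 * s) * (S * (om * r ^ n))"
    using X r \<eta> pos unfolding gc by (intro mult_left_mono) auto
  also have "\<dots> = \<theta> ^ (2 * s) * (S * \<theta> ^ n * m\<^sup>2) / (opn * J)"
    unfolding gc \<theta>_def using pos by (simp add: power_mult_distrib power_add)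
  also have "\<dots> \<le> E" using key pos by (simp add: pos_divide_le_eq mult.assoc)
  finally show ?thesis unfolding E r_def .
qed

end

section \<open>Matrix norms and the Schur complement\<close>

lemma eucl_norm_vec: "eucl_norm (Matrix.vec N x) = sqrt (\<Sum>i<N. (x i)\<^sup>2)"
  by (simp add: eucl_norm_def scalar_prod_def power2_eq_square atLeast0LessThan)

lemma mult_mat_vec_entries:
  assumes "A \<in> carrier_mat N N"
  shows "A *\<^sub>v Matrix.vec N x = Matrix.vec N (\<lambda>i. \<Sum>j<N. A $$ (i, j) * x j)"
  using assms by (intro eq_vecI) (auto simp: scalar_prod_def atLeast0LessThan)

lemma mat_norm2_le:
  assumes A: "A \<in> carrier_mat N N"
    and le: "\<And>x. (\<Sum>i<N. (x i)\<^sup>2) \<le> 1 \<Longrightarrow> sqrt (\<Sum>i<N. (\<Sum>j<N. A $$ (i, j) * x j)\<^sup>2) \<le> C"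
  shows "mat_norm2 A \<le> C"
  unfolding mat_norm2_def
proof (rule cSUP_least)
  have "Matrix.vec N (\<lambda>_. 0) \<in> {v \<in> carrier_vec (dim_col A). eucl_norm v \<le> 1}"
    using A by (simp add: eucl_norm_vec)
  then show "{v \<in> carrier_vec (dim_col A). eucl_norm v \<le> 1} \<noteq> {}" by blast
next
  fix v assume v: "v \<in> {v \<in> carrier_vec (dim_col A). eucl_norm v \<le> 1}"
  define x where "x i = v $ i" for i
  have vx: "v = Matrix.vec N x" using v A by (intro eq_vecI) (auto simp: x_def)
  have "eucl_norm v \<le> 1" using v by simp
  then have "sqrt (\<Sum>i<N. (x i)\<^sup>2) \<le> 1" by (simp only: vx eucl_norm_vec)
  then show "eucl_norm (A *\<^sub>v v) \<le> C"
    unfolding vx mult_mat_vec_entries[OF A] eucl_norm_vec by (intro le) simp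
qed

lemma mat_norm2_ge:
  assumes A: "A \<in> carrier_mat N N" and x: "(\<Sum>i<N. (x i)\<^sup>2) \<le> 1"
  shows "sqrt (\<Sum>i<N. (\<Sum>j<N. A $$ (i, j) * x j)\<^sup>2) \<le> mat_norm2 A"
proof -
  \<comment> \<open>The Frobenius norm shows that the supremum in \<open>mat_norm2\<close> is over a
    bounded set.\<close>
  have bd: "eucl_norm (A *\<^sub>v v) \<le> sqrt (\<Sum>i<N. \<Sum>j<N. (A $$ (i, j))\<^sup>2)"
    if v: "v \<in> {v \<in> carrier_vec (dim_col A). eucl_norm v \<le> 1}" for v
  proof -
    define y where "y i = v $ i" for i
    have vy: "v = Matrix.vec N y" using v A by (intro eq_vecI) (auto simp: y_def)
    have "eucl_norm v \<le> 1" using v by simp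
    then have "sqrt (\<Sum>i<N. (y i)\<^sup>2) \<le> 1" by (simp only: vy eucl_norm_vec)
    then have y: "(\<Sum>i<N. (y i)\<^sup>2) \<le> 1" by simp
    have "(\<Sum>j<N. A $$ (i, j) * y j)\<^sup>2 \<le> (\<Sum>j<N. (A $$ (i, j))\<^sup>2)" for i
    proof -
      have "(\<Sum>j<N. A $$ (i, j) * y j)\<^sup>2 \<le> (\<Sum>j<N. (A $$ (i, j))\<^sup>2) * (\<Sum>j<N. (y j)\<^sup>2)"
        by (rule Cauchy_Schwarz_ineq_sum)
      also have "\<dots> \<le> (\<Sum>j<N. (A $$ (i, j))\<^sup>2) * 1" by (intro mult_left_mono y sum_nonneg) auto
      finally show ?thesis by simp
    qed
    then show ?thesis
      unfolding vy mult_mat_vec_entries[OF A] eucl_norm_vec by (intro real_sqrt_le_mono sum_mono)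
  qed
  have "eucl_norm (A *\<^sub>v Matrix.vec N x) \<le> mat_norm2 A"
    unfolding mat_norm2_def
  proof (rule cSUP_upper)
    show "bdd_above ((\<lambda>v. eucl_norm (A *\<^sub>v v)) ` {v \<in> carrier_vec (dim_col A). eucl_norm v \<le> 1})"
      using bd by (intro bdd_aboveI[of _ "sqrt (\<Sum>i<N. \<Sum>j<N. (A $$ (i, j))\<^sup>2)"]) auto
  qed (use A x in \<open>simp add: eucl_norm_vec\<close>)
  then show ?thesis unfolding mult_mat_vec_entries[OF A] eucl_norm_vec .
qed

lemma quadratic_form_le_mat_norm2:
  assumes A: "A \<in> carrier_mat N N" and x: "(\<Sum>i<N. (x i)\<^sup>2) \<le> 1"
  shows "(\<Sum>i<N. x i * (\<Sum>j<N. A $$ (i, j) * x j)) \<le> mat_norm2 A"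
proof -
  let ?b = "\<lambda>i. \<Sum>j<N. A $$ (i, j) * x j"
  have "(\<Sum>i<N. x i * ?b i)\<^sup>2 \<le> (\<Sum>i<N. (x i)\<^sup>2) * (\<Sum>i<N. (?b i)\<^sup>2)" by (rule Cauchy_Schwarz_ineq_sum)
  also have "\<dots> \<le> 1 * (\<Sum>i<N. (?b i)\<^sup>2)" by (intro mult_right_mono x sum_nonneg) auto
  finally have "\<bar>\<Sum>i<N. x i * ?b i\<bar> \<le> sqrt (\<Sum>i<N. (?b i)\<^sup>2)" by (simp add: real_le_rsqrt)
  then show ?thesis using mat_norm2_ge[OF assms] by linarith
qed

text \<open>Back substitution for the transposed factor: the last of the equations involves only the
  last unknown, and eliminating it changes the right-hand sides of the others.\<close>

lemma triangular_solve:
  fixes \<l> :: "nat \<Rightarrow> nat \<Rightarrow> real"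
  assumes tri: "\<And>i j. i < j \<Longrightarrow> j < N \<Longrightarrow> \<l> i j = 0" and diag: "\<And>i. i < N \<Longrightarrow> \<l> i i \<noteq> 0" and "k \<le> N"
  shows "\<exists>y. (\<forall>i\<ge>k. y i = 0) \<and> (\<forall>j<k. (\<Sum>i<N. \<l> i j * y i) = t j)"
  using \<open>k \<le> N\<close>
proof (induction k arbitrary: t)
  case 0
  then show ?case by (intro exI[of _ "\<lambda>_. 0"]) auto
next
  case (Suc k)
  define y0 where "y0 = t k / \<l> k k"
  obtain y where y: "\<forall>i\<ge>k. y i = 0" "\<forall>j<k. (\<Sum>i<N. \<l> i j * y i) = t j - \<l> k j * y0"
    using Suc.IH[of "\<lambda>j. t j - \<l> k j * y0"] Suc.prems by auto
  let ?y = "y(k := y0)"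
  have e: "(\<Sum>i<N. \<l> i j * ?y i) = (\<Sum>i<N. \<l> i j * y i) + \<l> k j * y0" for j
  proof -
    have "(\<Sum>i<N. \<l> i j * ?y i) = (\<Sum>i<N. \<l> i j * y i + (if i = k then \<l> i j * y0 else 0))"
      using y(1) by (intro sum.cong) auto
    also have "\<dots> = (\<Sum>i<N. \<l> i j * y i) + (\<Sum>i<N. (if i = k then \<l> i j * y0 else 0))"
      by (rule sum.distrib)
    finally show ?thesis using Suc.prems by simp
  qed
  have "(\<Sum>i<N. \<l> i k * y i) = 0"
  proof (rule sum.neutral, rule ballI)
    fix i
    show "\<l> i k * y i = 0" using tri[of i k] y(1) Suc.prems by (cases "i < k") auto
  qed
  then have "(\<Sum>i<N. \<l> i j * ?y i) = t j" if "j < Suc k" for j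
    using that y(2) diag[of k] Suc.prems unfolding e unfolding y0_def by (cases "j = k") auto
  then show ?case using y(1) by (intro exI[of _ ?y]) auto
qed

lemma gram_matrix_form:
  fixes \<l> \<theta> :: "nat \<Rightarrow> nat \<Rightarrow> real"
  assumes "\<And>i j. i < N \<Longrightarrow> j < N \<Longrightarrow> \<theta> i j = (\<Sum>m\<in>A. \<l> i m * \<l> j m)"
  shows "i < N \<Longrightarrow> (\<Sum>j<N. \<theta> i j * z j) = (\<Sum>m\<in>A. \<l> i m * (\<Sum>j<N. \<l> j m * z j))"
    and "(\<Sum>i<N. y i * (\<Sum>j<N. \<theta> i j * z j)) = (\<Sum>m\<in>A. (\<Sum>i<N. \<l> i m * y i) * (\<Sum>j<N. \<l> j m * z j))"
proof -
  show 1: "(\<Sum>j<N. \<theta> i j * z j) = (\<Sum>m\<in>A. \<l> i m * (\<Sum>j<N. \<l> j m * z j))" if "i < N" for i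
  proof -
    have "(\<Sum>j<N. \<theta> i j * z j) = (\<Sum>j<N. \<Sum>m\<in>A. \<l> i m * (\<l> j m * z j))"
      using assms[OF that] by (intro sum.cong) (auto simp: sum_distrib_right mult.assoc)
    also have "\<dots> = (\<Sum>m\<in>A. \<Sum>j<N. \<l> i m * (\<l> j m * z j))" by (rule sum.swap)
    finally show ?thesis by (simp add: sum_distrib_left)
  qed
  have "(\<Sum>i<N. y i * (\<Sum>j<N. \<theta> i j * z j)) = (\<Sum>i<N. \<Sum>m\<in>A. (\<l> i m * y i) * (\<Sum>j<N. \<l> j m * z j))"
    using 1 by (intro sum.cong) (auto simp: sum_distrib_left mult_ac)
  also have "\<dots> = (\<Sum>m\<in>A. \<Sum>i<N. (\<l> i m * y i) * (\<Sum>j<N. \<l> j m * z j))" by (rule sum.swap)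
  finally show "(\<Sum>i<N. y i * (\<Sum>j<N. \<theta> i j * z j)) = (\<Sum>m\<in>A. (\<Sum>i<N. \<l> i m * y i) * (\<Sum>j<N. \<l> j m * z j))"
    by (simp add: sum_distrib_right)
qed

text \<open>
  The Schur complement minimises the quadratic form over the first \<open>k\<close> entries; the minimiser \<open>z\<close> is
  characterised by the vanishing of the first \<open>k\<close> entries of its image.
\<close>

lemma schur_complement_minimiser:
  fixes \<l> \<theta> :: "nat \<Rightarrow> nat \<Rightarrow> real"
  assumes tri: "\<And>i j. i < j \<Longrightarrow> j < N \<Longrightarrow> \<l> i j = 0" and diag: "\<And>i. i < N \<Longrightarrow> \<l> i i \<noteq> 0" and k: "k \<le> N"
    and \<theta>: "\<And>i j. i < N \<Longrightarrow> j < N \<Longrightarrow> \<theta> i j = (\<Sum>m<N. \<l> i m * \<l> j m)"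
  obtains z where "(\<Sum>m\<in>{k..<N}. (\<Sum>i<N. \<l> i m * x i)\<^sup>2) = (\<Sum>i<N. z i * (\<Sum>j<N. \<theta> i j * z j))"
    "\<forall>i<k. (\<Sum>j<N. \<theta> i j * z j) = 0" "\<forall>i\<ge>k. z i = x i"
proof -
  \<comment> \<open>\<open>y\<close> reproduces the first \<open>k\<close> components of the
    transposed factor applied to \<open>x\<close>; being supported on the first \<open>k\<close>
    indices, it has no influence on the other components.\<close>
  obtain y where y: "\<forall>i\<ge>k. y i = 0" "\<forall>j<k. (\<Sum>i<N. \<l> i j * y i) = (\<Sum>i<N. \<l> i j * x i)"
    using triangular_solve[where \<l> = \<l> and N = N and t = "\<lambda>j. \<Sum>i<N. \<l> i j * x i", OF tri diag k] by blast
  define z where "z i = x i - y i" for i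
  define p where "p m = (\<Sum>i<N. \<l> i m * z i)" for m
  have p: "p m = (\<Sum>i<N. \<l> i m * x i) - (\<Sum>i<N. \<l> i m * y i)" for m
    unfolding p_def z_def by (simp add: right_diff_distrib sum_subtractf)
  have p0: "p m = 0" if "m < k" for m using y(2) that by (simp add: p)
  have p1: "p m = (\<Sum>i<N. \<l> i m * x i)" if m: "k \<le> m" "m < N" for m
  proof -
    have "(\<Sum>i<N. \<l> i m * y i) = 0"
    proof (rule sum.neutral, rule ballI)
      fix i
      show "\<l> i m * y i = 0" using tri[of i m] y(1) m by (cases "i < k") auto
    qed
    then show ?thesis by (simp add: p)
  qed
  show thesis
  proof (rule that[of z])
    have "(\<Sum>i<N. z i * (\<Sum>j<N. \<theta> i j * z j)) = (\<Sum>m<N. p m * p m)"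
      unfolding p_def by (rule gram_matrix_form(2)[OF \<theta>])
    also have "\<dots> = (\<Sum>m<N. (p m)\<^sup>2)" by (simp add: power2_eq_square)
    also have "\<dots> = (\<Sum>m\<in>{k..<N}. (p m)\<^sup>2)"
      by (rule sum.mono_neutral_right) (auto simp: p0)
    also have "\<dots> = (\<Sum>m\<in>{k..<N}. (\<Sum>i<N. \<l> i m * x i)\<^sup>2)"
      by (rule sum.cong) (auto simp: p1)
    finally show "(\<Sum>m\<in>{k..<N}. (\<Sum>i<N. \<l> i m * x i)\<^sup>2) = (\<Sum>i<N. z i * (\<Sum>j<N. \<theta> i j * z j))" by simp
    show "\<forall>i<k. (\<Sum>j<N. \<theta> i j * z j) = 0"
    proof (intro allI impI)
      fix i assume i: "i < k"
      then have "(\<Sum>j<N. \<theta> i j * z j) = (\<Sum>m<N. \<l> i m * p m)"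
        unfolding p_def using k by (intro gram_matrix_form(1)[where \<theta> = \<theta> and \<l> = \<l>] \<theta>) auto
      also have "\<dots> = 0"
      proof (rule sum.neutral, rule ballI)
        fix m assume "m \<in> {..<N}"
        then show "\<l> i m * p m = 0" using tri[of i m] p0[of m] i by (cases "m < k") auto
      qed
      finally show "(\<Sum>j<N. \<theta> i j * z j) = 0" .
    qed
    show "\<forall>i\<ge>k. z i = x i" using y(1) by (simp add: z_def)
  qed
qed

text \<open>This avoids eigenvalues: for \<open>b = R x\<close>, the squared norm of
  \<open>b\<close> is the bilinear form at \<open>b\<close> and \<open>x\<close>. Cauchy-Schwarz
  bounds its square by the two quadratic forms, and a squared norm of \<open>b\<close>
  cancels.\<close>

lemma mat_norm2_le_of_quadratic_form:
  fixes \<l> :: "nat \<Rightarrow> nat \<Rightarrow> real"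
  assumes R: "R \<in> carrier_mat N N"
    and entries: "\<And>i j. i < N \<Longrightarrow> j < N \<Longrightarrow> R $$ (i, j) = (\<Sum>m\<in>A. \<l> i m * \<l> j m)"
    and le: "\<And>x. (\<Sum>m\<in>A. (\<Sum>i<N. \<l> i m * x i)\<^sup>2) \<le> \<epsilon> * (\<Sum>i<N. (x i)\<^sup>2)" and \<epsilon>: "0 \<le> \<epsilon>"
  shows "mat_norm2 R \<le> \<epsilon>"
proof (rule mat_norm2_le[OF R])
  fix x :: "nat \<Rightarrow> real" assume x: "(\<Sum>i<N. (x i)\<^sup>2) \<le> 1"
  define b where "b i = (\<Sum>j<N. R $$ (i, j) * x j)" for i
  define p where "p m y = (\<Sum>i<N. \<l> i m * y i)" for m and y :: "nat \<Rightarrow> real"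
  define B where "B = (\<Sum>i<N. (b i)\<^sup>2)"
  have B0: "0 \<le> B" unfolding B_def by (intro sum_nonneg) auto
  have "B = (\<Sum>i<N. b i * (\<Sum>j<N. R $$ (i, j) * x j))" unfolding B_def b_def by (simp add: power2_eq_square)
  also have "\<dots> = (\<Sum>m\<in>A. p m b * p m x)"
    unfolding p_def by (rule gram_matrix_form(2)[OF entries])
  finally have "B\<^sup>2 \<le> (\<Sum>m\<in>A. (p m b)\<^sup>2) * (\<Sum>m\<in>A. (p m x)\<^sup>2)"
    using Cauchy_Schwarz_ineq_sum[of "\<lambda>m. p m b" "\<lambda>m. p m x" A] by simp
  also have "\<dots> \<le> (\<epsilon> * B) * (\<epsilon> * 1)"
  proof (intro mult_mono)
    show "(\<Sum>m\<in>A. (p m b)\<^sup>2) \<le> \<epsilon> * B" unfolding p_def B_def by (rule le)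
    have "(\<Sum>m\<in>A. (p m x)\<^sup>2) \<le> \<epsilon> * (\<Sum>i<N. (x i)\<^sup>2)" unfolding p_def by (rule le)
    also have "\<dots> \<le> \<epsilon> * 1" by (intro mult_left_mono x \<epsilon>)
    finally show "(\<Sum>m\<in>A. (p m x)\<^sup>2) \<le> \<epsilon> * 1" .
  qed (use \<epsilon> B0 in \<open>auto intro: sum_nonneg\<close>)
  finally have "B * B \<le> B * \<epsilon>\<^sup>2" by (simp add: power2_eq_square mult_ac)
  then have "B \<le> \<epsilon>\<^sup>2" using B0 by (cases "B = 0") auto
  then show "sqrt (\<Sum>i<N. (\<Sum>j<N. R $$ (i, j) * x j)\<^sup>2) \<le> \<epsilon>"
    unfolding B_def b_def by (rule real_le_lsqrt[rotated]) (use \<epsilon> in auto)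
qed

text \<open>Taking the first \<open>k + 1\<close> columns, which are dependent, makes the kernel
  vector live on the coarsest basis functions, where the Gram matrix is largest.\<close>

lemma low_rank_kernel_vector:
  fixes M :: "real mat"
  assumes M: "M \<in> carrier_mat N N" and rank: "vec_space.rank N M \<le> k" and k: "k < N"
  obtains x :: "nat \<Rightarrow> real" where "\<forall>i. k < i \<longrightarrow> x i = 0" "(\<Sum>i<N. (x i)\<^sup>2) = 1"
    "\<forall>i<N. (\<Sum>j<N. M $$ (i, j) * x j) = 0"
proof -
  interpret V: vec_space "TYPE(real)" N .
  define A where "A = Matrix.mat N (Suc k) (\<lambda>(i, j). M $$ (i, j))"
  have A: "A \<in> carrier_mat N (Suc k)" by (simp add: A_def)
  have colA: "col A j = col M j" if "j \<le> k" for j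
    using that M k by (intro eq_vecI) (auto simp: A_def)
  have "\<exists>v. v \<in> carrier_vec (Suc k) \<and> v \<noteq> 0\<^sub>v (Suc k) \<and> A *\<^sub>v v = 0\<^sub>v N"
  \<comment> \<open>Linear dependence is a property of the set of columns, in which equal columns
    collapse; two equal columns give a kernel vector directly.\<close>
  proof (cases "distinct (cols A)")
    case True
    have "set (cols A) \<subseteq> set (cols M)"
    proof
      fix u assume "u \<in> set (cols A)"
      then obtain j where j: "j < Suc k" "u = col A j"
        using A by (metis cols_length cols_nth in_set_conv_nth carrier_matD(2))
      then have "u = cols M ! j" using colA[of j] M k by simp
      moreover have "j < length (cols M)" using j M k by simp
      ultimately show "u \<in> set (cols M)" by (metis nth_mem)
    qed
    then have "V.lin_dep (set (cols A))"
      using V.rank_ge_card_indpt[OF M, of "set (cols A)"] rank distinct_card[OF True] A by auto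
    then show ?thesis using V.lin_depE[OF A _ True] by metis
  next
    case False
    then obtain i j where ij: "i < Suc k" "j < Suc k" "i \<noteq> j" "col A i = col A j"
      using A by (auto simp: distinct_conv_nth)
    define v where "v = Matrix.vec (Suc k) (\<lambda>l. if l = i then 1 else if l = j then -1 else (0 :: real))"
    have "v $ i \<noteq> 0" using ij by (simp add: v_def)
    then have "v \<noteq> 0\<^sub>v (Suc k)" using ij by auto
    moreover have "A *\<^sub>v v = 0\<^sub>v N"
    proof (rule eq_vecI)
      fix m assume "m < dim_vec (0\<^sub>v N :: real Matrix.vec)"
      then have m: "m < N" by simp
      have e: "A $$ (m, i) = A $$ (m, j)"
      proof -
        have "col A i $ m = A $$ (m, i)" "col A j $ m = A $$ (m, j)" using m ij(1,2) A by simp_all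
        then show ?thesis using ij(4) by metis
      qed
      have "(A *\<^sub>v v) $ m = (\<Sum>l<Suc k. A $$ (m, l) * (if l = i then 1 else if l = j then -1 else 0))"
        using m A by (simp add: v_def scalar_prod_def atLeast0LessThan del: sum.lessThan_Suc)
      also have "\<dots> = (\<Sum>l<Suc k. (if l = i then A $$ (m, i) else 0) - (if l = j then A $$ (m, j) else 0))"
        using ij(3) by (intro sum.cong) auto
      also have "\<dots> = 0" using ij e by (simp add: sum_subtractf del: sum.lessThan_Suc)
      finally show "(A *\<^sub>v v) $ m = 0\<^sub>v N $ m" using m by simp
    qed (use A in auto)
    ultimately show ?thesis by (intro exI[of _ v]) (simp add: v_def)
  qed
  then obtain v where v: "v \<in> carrier_vec (Suc k)" "v \<noteq> 0\<^sub>v (Suc k)" "A *\<^sub>v v = 0\<^sub>v N" by blast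
  define y where "y i = (if i \<le> k then v $ i else 0)" for i
  have "\<exists>i<Suc k. v $ i \<noteq> 0"
    using v(1,2) by (metis carrier_vecD eq_vecI index_zero_vec(1) index_zero_vec(2))
  then obtain i where i: "i \<le> k" "y i \<noteq> 0" by (auto simp: y_def less_Suc_eq_le)
  define Y where "Y = (\<Sum>i<N. (y i)\<^sup>2)"
  have "0 < (y i)\<^sup>2" using i by simp
  also have "(y i)\<^sup>2 \<le> Y" unfolding Y_def using i k by (intro member_le_sum) auto
  finally have Y: "0 < Y" .
  have ker: "(\<Sum>j<N. M $$ (m, j) * y j) = 0" if m: "m < N" for m
  proof -
    have "(\<Sum>j<N. M $$ (m, j) * y j) = (\<Sum>j<Suc k. A $$ (m, j) * v $ j)"
      using k m by (intro sum.mono_neutral_cong_right) (auto simp: y_def A_def)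
    also have "\<dots> = (A *\<^sub>v v) $ m"
      using m A v(1) by (simp add: scalar_prod_def atLeast0LessThan del: sum.lessThan_Suc)
    finally show ?thesis using m v(3) by simp
  qed
  show thesis
  proof (rule that[of "\<lambda>i. y i / sqrt Y"])
    show "\<forall>i. k < i \<longrightarrow> y i / sqrt Y = 0" by (simp add: y_def)
    show "(\<Sum>i<N. (y i / sqrt Y)\<^sup>2) = 1"
      using Y by (simp add: power_divide sum_divide_distrib[symmetric] Y_def[symmetric])
    show "\<forall>m<N. (\<Sum>j<N. M $$ (m, j) * (y j / sqrt Y)) = 0"
      using ker by (simp add: sum_divide_distrib[symmetric])
  qed
qed

section \<open>The rates\<close>

text \<open>\<open>k\<close> is at most the power \<open>- n\<close> of \<open>X\<close>, and the
  exponent of the rate is negative, so raising to it reverses the inequality.\<close>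

lemma power_le_powr_rate:
  assumes "0 < X" "1 \<le> k" "real k * X ^ n \<le> 1" "0 < n"
  shows "X ^ (2 * s) \<le> real k powr (- 2 * real s / real n)"
proof -
  have "real k \<le> X powr (- real n)"
    using assms by (simp add: powr_minus powr_realpow field_simps)
  then have "(X powr (- real n)) powr (- 2 * real s / real n) \<le> real k powr (- 2 * real s / real n)"
    using assms by (intro powr_mono2') auto
  also have "(X powr (- real n)) powr (- 2 * real s / real n) = X powr (real (2 * s))"
    using assms by (simp add: powr_powr)
  also have "\<dots> = X ^ (2 * s)" using assms by (simp only: powr_realpow)
  finally show ?thesis .
qed

lemma powr_rate_le_power:
  assumes "0 < X" "1 \<le> real k * X ^ n" "0 < n"
  shows "real k powr (- 2 * real s / real n) \<le> X ^ (2 * s)"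
proof -
  have "X powr (- real n) \<le> real k"
    using assms by (simp add: powr_minus powr_realpow field_simps)
  then have "real k powr (- 2 * real s / real n) \<le> (X powr (- real n)) powr (- 2 * real s / real n)"
    using assms by (intro powr_mono2') auto
  also have "(X powr (- real n)) powr (- 2 * real s / real n) = X powr (real (2 * s))"
    using assms by (simp add: powr_powr)
  also have "\<dots> = X ^ (2 * s)" using assms by (simp only: powr_realpow)
  finally show ?thesis .
qed

locale cholesky = multiresolution \<Omega> s \<L> h \<delta> q \<tau> N lev w
  for \<Omega> :: "(real^'n) set" and s \<L> h \<delta> q \<tau> N lev w +
  fixes L :: "real mat"
  assumes cholesky: "is_cholesky_factor (Theta_mat \<Omega> s \<L> N w) L"
begin

definition "\<Theta> = Theta_mat \<Omega> s \<L> N w"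

lemma Theta_carrier: "\<Theta> \<in> carrier_mat N N"
  by (simp add: \<Theta>_def Theta_mat_def)

lemma Theta_entry: "i < N \<Longrightarrow> j < N \<Longrightarrow> \<Theta> $$ (i, j) = gram i j"
  by (simp add: \<Theta>_def Theta_mat_def gram_def solution_def)

lemma cholesky_factor:
  shows L_carrier: "L \<in> carrier_mat N N"
    and L_upper: "i < j \<Longrightarrow> j < N \<Longrightarrow> L $$ (i, j) = 0"
    and L_diag: "i < N \<Longrightarrow> L $$ (i, i) \<noteq> 0"
    and Theta_eq: "\<Theta> = L * transpose_mat L"
proof -
  have dim: "dim_row (Theta_mat \<Omega> s \<L> N w) = N" by (simp add: Theta_mat_def)
  have pos: "\<forall>i<N. 0 < L $$ (i, i)"
    and upper: "\<forall>j<N. \<forall>i<j. L $$ (i, j) = 0"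
    using cholesky unfolding is_cholesky_factor_def dim by blast+
  show "L \<in> carrier_mat N N" "\<Theta> = L * transpose_mat L"
    using cholesky unfolding is_cholesky_factor_def dim \<Theta>_def by blast+
  show "i < j \<Longrightarrow> j < N \<Longrightarrow> L $$ (i, j) = 0" using upper by blast
  show "i < N \<Longrightarrow> L $$ (i, i) \<noteq> 0" using pos by force
qed

lemma gram_cholesky: "i < N \<Longrightarrow> j < N \<Longrightarrow> gram i j = (\<Sum>m<N. L $$ (i, m) * L $$ (j, m))"
proof -
  assume ij: "i < N" "j < N"
  have "gram i j = (L * transpose_mat L) $$ (i, j)"
    using Theta_entry[OF ij] by (simp only: Theta_eq)
  then show ?thesis using ij L_carrier by (simp add: scalar_prod_def atLeast0LessThan)
qed

definition "residual k = \<Theta> - first_cols L k * transpose_mat (first_cols L k)"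

lemma residual_carrier: "residual k \<in> carrier_mat N N"
  using Theta_carrier L_carrier unfolding residual_def first_cols_def by auto

lemma residual_entry:
  assumes "k \<le> N" "i < N" "j < N"
  shows "residual k $$ (i, j) = (\<Sum>m\<in>{k..<N}. L $$ (i, m) * L $$ (j, m))"
proof -
  have "(first_cols L k * transpose_mat (first_cols L k)) $$ (i, j) = (\<Sum>m<k. L $$ (i, m) * L $$ (j, m))"
    using assms L_carrier by (simp add: first_cols_def scalar_prod_def atLeast0LessThan)
  then have "residual k $$ (i, j) = (\<Sum>m<N. L $$ (i, m) * L $$ (j, m)) - (\<Sum>m<k. L $$ (i, m) * L $$ (j, m))"
    using assms L_carrier Theta_carrier Theta_entry[OF assms(2,3)] gram_cholesky[OF assms(2,3)]
    unfolding residual_def by (simp add: first_cols_def)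
  moreover have "{..<N} = {..<k} \<union> {k..<N}" using assms by auto
  moreover have "(\<Sum>m\<in>{..<k} \<union> {k..<N}. L $$ (i, m) * L $$ (j, m)) =
      (\<Sum>m<k. L $$ (i, m) * L $$ (j, m)) + (\<Sum>m\<in>{k..<N}. L $$ (i, m) * L $$ (j, m))"
    by (rule sum.union_disjoint) auto
  ultimately show ?thesis by simp
qed

definition upper_const :: real where
  "upper_const = opn * inv_opn\<^sup>2 * (sqrt (real CARD('n)) ^ (s * s) * sqrt (2 * 2 ^ CARD('n)) ^ s)\<^sup>2"

lemma upper_const_pos: "0 < upper_const"
  unfolding upper_const_def using opn_pos inv_opn_pos by simp

text \<open>The cut after \<open>k\<close> columns may run through a level; only the levels up to
  \<open>l\<close>, complete among those columns, provide orthogonality. The form of the residual at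
  \<open>x\<close> is the Gram form at the minimiser \<open>z\<close>.\<close>

lemma residual_norm_le:
  assumes k: "k \<le> N" and l: "l \<le> q" and idx: "\<And>i. i \<in> idx l \<Longrightarrow> i < k"
  shows "mat_norm2 (residual k) \<le> upper_const * (h ^ l) ^ (2 * s)"
proof (rule mat_norm2_le_of_quadratic_form[where \<l> = "\<lambda>i m. L $$ (i, m)" and A = "{k..<N}", OF residual_carrier residual_entry[OF k]])
  fix x :: "nat \<Rightarrow> real"
  obtain z where z: "(\<Sum>m\<in>{k..<N}. (\<Sum>i<N. L $$ (i, m) * x i)\<^sup>2) = (\<Sum>i<N. z i * (\<Sum>j<N. gram i j * z j))"
    and z0: "\<forall>i<k. (\<Sum>j<N. gram i j * z j) = 0" and zx: "\<forall>i\<ge>k. z i = x i"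
    using schur_complement_minimiser[where \<l> = "\<lambda>i m. L $$ (i, m)" and \<theta> = gram and x = x, OF L_upper L_diag k gram_cholesky]
    by blast
  have "(\<Sum>i<N. z i * (\<Sum>j<N. gram i j * z j)) \<le>
    opn * inv_opn\<^sup>2 * (sqrt (real CARD('n)) ^ (s * s) * (sqrt (2 * 2 ^ CARD('n)) * h ^ l) ^ s)\<^sup>2 * (\<Sum>i<N. (x i)\<^sup>2)"
  proof (rule gram_upper_bound[OF _ _ l])
    show "(\<Sum>i<N. z i * (\<Sum>j<N. gram i j * z j)) = (\<Sum>i<N. x i * (\<Sum>j<N. gram i j * z j))"
    proof (rule sum.cong[OF refl])
      fix i
      show "z i * (\<Sum>j<N. gram i j * z j) = x i * (\<Sum>j<N. gram i j * z j)"
        using z0 zx by (cases "i < k") auto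
    qed
    show "(\<Sum>j<N. gram i j * z j) = 0" if "i \<in> idx l" for i using idx[OF that] z0 by blast
  qed
  also have "\<dots> = upper_const * (h ^ l) ^ (2 * s) * (\<Sum>i<N. (x i)\<^sup>2)"
    unfolding upper_const_def by (simp add: power_mult_distrib power_mult[symmetric] mult_ac)
  finally show "(\<Sum>m\<in>{k..<N}. (\<Sum>i<N. L $$ (i, m) * x i)\<^sup>2) \<le> upper_const * (h ^ l) ^ (2 * s) * (\<Sum>i<N. (x i)\<^sup>2)"
    unfolding z .
qed (use upper_const_pos h in auto)

text \<open>The case \<open>k = 0\<close>, \<open>l = 0\<close> of
  \<open>residual_norm_le\<close>.\<close>

lemma Theta_norm_le: "mat_norm2 \<Theta> \<le> upper_const"
proof -
  have "residual 0 = \<Theta>"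
    using Theta_carrier residual_carrier[of 0] residual_entry[of 0] gram_cholesky
    by (intro eq_matI) (auto simp: Theta_entry atLeast0LessThan)
  moreover have "idx 0 = {}" using lev_range by (force simp: idx_def)
  ultimately show ?thesis using residual_norm_le[of 0 0] by simp
qed

lemma gram_const_pos: "0 < gram_const"
  unfolding gram_const_def
  by (intro divide_pos_pos mult_pos_pos zero_less_power bump_energy_pos bump_mass_pos opn_pos) (use \<delta> in simp_all)

text \<open>The kernel vector is supported on the indices 0 to \<open>k\<close>, all of level at
  most \<open>lev k\<close>. \<open>M\<close> contributes nothing to the form there, and the Gram
  form is bounded from below.\<close>

lemma gram_const_le_norm:
  assumes M: "M \<in> carrier_mat N N" and rank: "vec_space.rank N M \<le> k" and k: "k < N"
  shows "gram_const * (h ^ lev k) ^ (2 * s) \<le> mat_norm2 (\<Theta> - M)"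
proof -
  obtain x where x: "\<forall>i. k < i \<longrightarrow> x i = 0" "(\<Sum>i<N. (x i)\<^sup>2) = 1"
    "\<forall>i<N. (\<Sum>j<N. M $$ (i, j) * x j) = 0"
    by (rule low_rank_kernel_vector[OF M rank k])
  have "gram_const * (h ^ lev k) ^ (2 * s) * (\<Sum>i<N. (x i)\<^sup>2) \<le> (\<Sum>i<N. x i * (\<Sum>j<N. gram i j * x j))"
  proof (rule gram_lower_bound)
    show "lev k \<in> {1..q}" using lev_range[OF k] by simp
    show "x i = 0" if "i < N" "i \<notin> idx (lev k)" for i
    proof -
      have "\<not> i \<le> k" using that lev_mono[OF _ k] by (auto simp: idx_def)
      then show ?thesis using x(1) by simp
    qed
  qed
  also have "\<dots> = (\<Sum>i<N. x i * (\<Sum>j<N. (\<Theta> - M) $$ (i, j) * x j))"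
  proof (rule sum.cong[OF refl], rule arg_cong2[where f = "(*)", OF refl])
    fix i assume "i \<in> {..<N}"
    then have i: "i < N" by simp
    have "(\<Sum>j<N. (\<Theta> - M) $$ (i, j) * x j) = (\<Sum>j<N. gram i j * x j - M $$ (i, j) * x j)"
      using i M Theta_carrier by (intro sum.cong) (auto simp: Theta_entry left_diff_distrib)
    then show "(\<Sum>j<N. gram i j * x j) = (\<Sum>j<N. (\<Theta> - M) $$ (i, j) * x j)"
      using x(3) i by (simp add: sum_subtractf)
  qed
  also have "\<dots> \<le> mat_norm2 (\<Theta> - M)"
    using x(2) M by (intro quadratic_form_le_mat_norm2) auto
  finally show ?thesis using x(2) by simp
qed

lemma Theta_norm_ge:
  assumes "1 \<le> N"
  shows "gram_const * h ^ (2 * s) \<le> mat_norm2 \<Theta>"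
proof -
  have N: "0 < N" using assms by simp
  interpret A: cell_partition \<Omega> "\<tau> 1" "h ^ 1" "\<delta> * h ^ 1" using q_pos by (intro cells) auto
  obtain T where "T \<in> \<tau> 1" using A.cell_exists nonempty by blast
  then have "0 < card (\<tau> 1)" using A.finite_cells card_gt_0_iff by blast
  then have "0 < card (idx 1)" using card_idx[of 1] q_pos by simp
  then have "idx 1 \<noteq> {}" by (metis card.empty less_irrefl)
  then obtain i where "i \<in> idx 1" by blast
  then have "lev 0 \<le> 1" using lev_mono[of 0 i] by (auto simp: idx_def)
  \<comment> \<open>Level 1 has as many indices as cells, hence at least one, and the order is from
    coarse to fine; so the first unit vector can serve as test vector.\<close>
  then have l0: "lev 0 = 1" using lev_range[OF N] by simp
  let ?x = "\<lambda>i :: nat. if i = 0 then 1 else (0 :: real)"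
  have s1: "(\<Sum>i<N. (?x i)\<^sup>2) = 1" using N by (simp add: if_distrib[of "\<lambda>y. y\<^sup>2"] cong: if_cong)
  have "gram_const * (h ^ 1) ^ (2 * s) * (\<Sum>i<N. (?x i)\<^sup>2) \<le> (\<Sum>i<N. ?x i * (\<Sum>j<N. gram i j * ?x j))"
    by (rule gram_lower_bound) (use q_pos N l0 in \<open>auto simp: idx_def intro!: gr0I\<close>)
  also have "\<dots> = (\<Sum>i<N. ?x i * (\<Sum>j<N. \<Theta> $$ (i, j) * ?x j))"
    by (intro sum.cong refl arg_cong2[where f = "(*)"]) (auto simp: Theta_entry)
  also have "\<dots> \<le> mat_norm2 \<Theta>"
    by (rule quadratic_form_le_mat_norm2[OF Theta_carrier]) (simp only: s1)
  finally show ?thesis using s1 by simp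
qed

lemma upper_rate:
  assumes k: "1 \<le> k" "k \<le> N"
  shows "mat_norm2 (residual k) \<le>
    upper_const / ((\<delta> * h) ^ (2 * s) * (gram_const * h ^ (2 * s))) * mat_norm2 \<Theta> * real k powr (- 2 * real s / real CARD('n))"
\<comment> \<open>For \<open>k = N\<close> there is no index \<open>k\<close> whose level could be
  used, but the residual is zero.\<close>
proof (cases "k = N")
  case True
  have "mat_norm2 (residual k) \<le> 0"
    by (rule mat_norm2_le_of_quadratic_form[where \<l> = "\<lambda>i m. L $$ (i, m)" and A = "{k..<N}", OF residual_carrier residual_entry[OF k(2)]])
      (use True in auto)
  also have "0 \<le> upper_const / ((\<delta> * h) ^ (2 * s) * (gram_const * h ^ (2 * s))) * mat_norm2 \<Theta> * real k powr (- 2 * real s / real CARD('n))"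
  proof -
    have "0 \<le> gram_const * h ^ (2 * s)" using gram_const_pos h by simp
    also have "\<dots> \<le> mat_norm2 \<Theta>" using k by (intro Theta_norm_ge) simp
    finally show ?thesis using upper_const_pos gram_const_pos \<delta> h by simp
  qed
  finally show ?thesis .
next
  case False
  then have kN: "k < N" using k by simp
  \<comment> \<open>Indices start at 0, so \<open>k\<close> is the first column left out: the levels
    below \<open>l\<close> are complete among the first \<open>k\<close> indices, and
    \<open>k\<close> is at most the number of indices up to level \<open>l\<close>.\<close>
  define l where "l = lev k"
  define n where "n = CARD('n)"
  define \<rho> where "\<rho> = real k powr (- 2 * real s / real n)"
  have l: "l \<in> {1..q}" unfolding l_def using lev_range[OF kN] by simp
  have "i < k" if "i \<in> idx (l - 1)" for i
    using that l lev_mono[of k i] by (force simp: idx_def l_def)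
  then have R: "mat_norm2 (residual k) \<le> upper_const * (h ^ (l - 1)) ^ (2 * s)"
    using l by (intro residual_norm_le k) auto
  have "{..<k} \<subseteq> idx l" using lev_mono[OF _ kN] kN by (auto simp: idx_def l_def)
  then have "k \<le> card (idx l)" using card_mono[OF finite_idx[of l], of "{..<k}"] by simp
  then have "k \<le> card (\<tau> l)" by (simp add: card_idx[OF l])
  then have "real k * (\<delta> * h ^ l) ^ n \<le> real (card (\<tau> l)) * (\<delta> * h ^ l) ^ n"
    using \<delta> h by (intro mult_right_mono) auto
  also have "\<dots> \<le> 1" unfolding n_def by (rule card_cells_le[OF l])
  finally have "(\<delta> * h ^ l) ^ (2 * s) \<le> \<rho>"
    unfolding \<rho>_def using \<delta> h k by (intro power_le_powr_rate) (auto simp: n_def)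
  \<comment> \<open>The error bound is in terms of level \<open>l - 1\<close>, the count in terms of
    level \<open>l\<close>; the gap costs a factor \<open>\<delta> * h\<close>, to the power
    \<open>2 * s\<close>.\<close>
  moreover have "\<delta> * h ^ l = (\<delta> * h) * h ^ (l - 1)" using l by (cases l) auto
  ultimately have rate: "(\<delta> * h) ^ (2 * s) * (h ^ (l - 1)) ^ (2 * s) \<le> \<rho>" by (simp only: power_mult_distrib)
  have pos: "0 < (\<delta> * h) ^ (2 * s)" "0 < gram_const * h ^ (2 * s)" "0 \<le> \<rho>"
    using \<delta> h gram_const_pos by (auto simp: \<rho>_def)
  have cancel: "a * (r / D) = a / (D * g) * g * r" if "D \<noteq> 0" "g \<noteq> 0" for a r D g :: real
    using that by simp
  have "mat_norm2 (residual k) \<le> upper_const * (\<rho> / (\<delta> * h) ^ (2 * s))"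
    using R rate pos upper_const_pos
    by (intro order_trans[OF R] mult_left_mono) (auto simp: pos_le_divide_eq mult.commute)
  also have "\<dots> = upper_const / ((\<delta> * h) ^ (2 * s) * (gram_const * h ^ (2 * s))) * (gram_const * h ^ (2 * s)) * \<rho>"
    by (rule cancel) (use pos(1,2) in linarith)+
  also have "\<dots> \<le> upper_const / ((\<delta> * h) ^ (2 * s) * (gram_const * h ^ (2 * s))) * mat_norm2 \<Theta> * \<rho>"
    using pos upper_const_pos k by (intro mult_right_mono mult_left_mono Theta_norm_ge) auto
  finally show ?thesis unfolding \<rho>_def n_def .
qed

lemma lower_rate:
  assumes k: "1 \<le> k" "k < N" and M: "M \<in> carrier_mat N N" "vec_space.rank N M \<le> k"
  shows "gram_const * (\<delta> * h\<^sup>2) ^ (2 * s) / upper_const * mat_norm2 \<Theta> * real k powr (- 2 * real s / real CARD('n))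
    \<le> mat_norm2 (\<Theta> - M)"
proof -
  define l where "l = lev k"
  define n where "n = CARD('n)"
  define \<rho> where "\<rho> = real k powr (- 2 * real s / real n)"
  \<comment> \<open>Chosen so that the cell count of level \<open>l - 1\<close> gives
    \<open>1 \<le> real k * X ^ n\<close>. For \<open>l = 1\<close> there is no such count, but
    \<open>X\<close> is then at least 1.\<close>
  define X where "X = h ^ (l - 1) / (\<delta> * h)"
  have l: "l \<in> {1..q}" unfolding l_def using lev_range[OF k(2)] by simp
  have dh: "0 < \<delta> * h" "\<delta> * h \<le> 1" using \<delta> h by (auto intro: mult_le_one)
  have X: "0 < X" unfolding X_def using dh h by simp
  have "1 \<le> real k * X ^ n"
  proof (cases "l = 1")
    case True
    then have "1 \<le> X" unfolding X_def using dh by simp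
    then have "1 * 1 \<le> real k * X ^ n" using k by (intro mult_mono one_le_power) auto
    then show ?thesis by simp
  next
    case False
    then have l1: "l - 1 \<in> {1..q}" using l by auto
    have "idx (l - 1) \<subseteq> {..<k}"
    proof
      fix i assume "i \<in> idx (l - 1)"
      then show "i \<in> {..<k}" using l lev_mono[of k i] by (force simp: idx_def l_def)
    qed
    then have "card (idx (l - 1)) \<le> card {..<k}" by (intro card_mono) auto
    then have "card (\<tau> (l - 1)) \<le> k" unfolding card_idx[OF l1] by simp
    then have "real (card (\<tau> (l - 1))) * (h ^ (l - 1)) ^ n \<le> real k * (h ^ (l - 1)) ^ n"
      using h by (intro mult_right_mono) auto
    then have "(\<delta> * h) ^ n \<le> real k * (h ^ (l - 1)) ^ n"
      using card_cells_ge[OF l1] unfolding n_def by linarith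
    then show ?thesis unfolding X_def power_divide using dh by (simp add: pos_le_divide_eq)
  qed
  then have rate: "\<rho> \<le> X ^ (2 * s)"
    unfolding \<rho>_def using X by (intro powr_rate_le_power) (auto simp: n_def)
  have eq: "X * (\<delta> * h\<^sup>2) = h ^ l"
    using l \<delta> h unfolding X_def by (cases l) (auto simp: power2_eq_square)
  have "gram_const * (\<delta> * h\<^sup>2) ^ (2 * s) / upper_const * mat_norm2 \<Theta> * \<rho> \<le>
    gram_const * (\<delta> * h\<^sup>2) ^ (2 * s) / upper_const * upper_const * \<rho>"
    using gram_const_pos upper_const_pos \<delta> h
    by (intro mult_right_mono mult_left_mono Theta_norm_le) (auto simp: \<rho>_def)
  also have "\<dots> = gram_const * (\<delta> * h\<^sup>2) ^ (2 * s) * \<rho>" using upper_const_pos by simp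
  also have "\<dots> \<le> gram_const * (\<delta> * h\<^sup>2) ^ (2 * s) * X ^ (2 * s)"
    using rate gram_const_pos \<delta> by (intro mult_left_mono) auto
  also have "\<dots> = gram_const * (h ^ l) ^ (2 * s)"
    unfolding eq[symmetric] power_mult_distrib[of X] by simp
  also have "\<dots> \<le> mat_norm2 (\<Theta> - M)"
    unfolding l_def by (rule gram_const_le_norm[OF M k(2)])
  finally show ?thesis unfolding \<rho>_def n_def .
qed

end

text \<open>Choosing \<open>C\<close> and \<open>c\<close> before the domain, \<open>q\<close>, the
  partitions and the basis expresses what they may depend on; the dimension is fixed by the type.
  The second bound makes the optimality precise; it stops before \<open>N\<close>, since at rank
  \<open>N\<close> the choice \<open>M = \<Theta>\<close> leaves no error.\<close>

theorem theorem3p4: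
  shows "\<exists>C c :: real \<Rightarrow> real \<Rightarrow> real \<Rightarrow> real \<Rightarrow> nat \<Rightarrow> real.
    (\<forall>a b h \<delta> s. 0 < C a b h \<delta> s \<and> 0 < c a b h \<delta> s) \<and>
    (\<forall>(\<Omega> :: (real^'n) set) s \<L> h \<delta> q \<tau> N lev w L.
       bounded_lipschitz_domain \<Omega> \<longrightarrow> diameter \<Omega> = 1 \<longrightarrow>
       1 \<le> s \<longrightarrow> admissible_op \<Omega> s \<L> \<longrightarrow>
       0 < h \<longrightarrow> h < 1 \<longrightarrow> 0 < \<delta> \<longrightarrow> \<delta> < 1 \<longrightarrow> 1 \<le> q \<longrightarrow>
       nested_partitions \<Omega> h \<delta> q \<tau> \<longrightarrow>
       coarse_to_fine q N lev \<longrightarrow>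
       multiresolution_basis \<Omega> q \<tau> N lev w \<longrightarrow>
       is_cholesky_factor (Theta_mat \<Omega> s \<L> N w) L \<longrightarrow>
       (let \<Theta> = Theta_mat \<Omega> s \<L> N w;
            C' = C (op_norm \<Omega> s \<L>) (inverse_op_norm \<Omega> s \<L>) h \<delta> s;
            c' = c (op_norm \<Omega> s \<L>) (inverse_op_norm \<Omega> s \<L>) h \<delta> s;
            rate = (\<lambda>k :: nat. real k powr (- 2 * real s / real CARD('n)))
        in (\<forall>k\<in>{1..N}.
              mat_norm2 (\<Theta> - first_cols L k * transpose_mat (first_cols L k))
                \<le> C' * mat_norm2 \<Theta> * rate k) \<and>
           (\<forall>k\<in>{1..<N}. \<forall>M\<in>carrier_mat N N. vec_space.rank N M \<le> k \<longrightarrow>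
              c' * mat_norm2 \<Theta> * rate k \<le> mat_norm2 (\<Theta> - M))))"
proof -
  define G where "G a \<delta> s = (\<delta> / (2 * real CARD('n))) ^ (CARD('n) + 2 * s) * (bump_mass TYPE('n))\<^sup>2 /
     (unit_ball_vol (real CARD('n)) * (\<bar>a\<bar> + 1) * bump_energy TYPE('n) s)" for a \<delta> :: real and s
  define U where "U a b s = (\<bar>a\<bar> + 1) * (\<bar>b\<bar> + 1)\<^sup>2 *
     (sqrt (real CARD('n)) ^ (s * s) * sqrt (2 * 2 ^ CARD('n)) ^ s)\<^sup>2" for a b :: real and s :: nat
  \<comment> \<open>The value 1 is a default that keeps the constants positive for parameters
    outside the admissible range.\<close>
  define C where "C a b h \<delta> s =
     (if 0 < h \<and> 0 < \<delta> then U a b s / ((\<delta> * h) ^ (2 * s) * (G a \<delta> s * h ^ (2 * s))) else 1)"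
    for a b h \<delta> :: real and s
  define c where "c a b h \<delta> s =
     (if 0 < h \<and> 0 < \<delta> then G a \<delta> s * (\<delta> * h\<^sup>2) ^ (2 * s) / U a b s else 1)"
    for a b h \<delta> :: real and s
  have G: "0 < G a \<delta> s" if "0 < \<delta>" for a \<delta> s
    unfolding G_def
    by (intro divide_pos_pos mult_pos_pos zero_less_power bump_energy_pos bump_mass_pos)
      (use that in \<open>simp_all add: add_nonneg_pos\<close>)
  have U: "0 < U a b s" for a b s
    unfolding U_def by (intro mult_pos_pos zero_less_power) (auto simp: add_nonneg_pos)
  show ?thesis
  proof (rule exI[of _ C], rule exI[of _ c], intro conjI allI impI)
    fix a b h \<delta> s
    show "0 < C a b h \<delta> s" unfolding C_def using G U by simp
    show "0 < c a b h \<delta> s" unfolding c_def using G U by simp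
  next
    fix \<Omega> :: "(real^'n) set" and s \<L> h \<delta> q \<tau> N lev w L
    assume asm: "bounded_lipschitz_domain \<Omega>" "diameter \<Omega> = 1" "1 \<le> s" "admissible_op \<Omega> s \<L>"
      "0 < h" "h < 1" "0 < \<delta>" "\<delta> < 1" "1 \<le> q" "nested_partitions \<Omega> h \<delta> q \<tau>"
      "coarse_to_fine q N lev" "multiresolution_basis \<Omega> q \<tau> N lev w"
      "is_cholesky_factor (Theta_mat \<Omega> s \<L> N w) L"
    interpret cholesky \<Omega> s \<L> h \<delta> q \<tau> N lev w L
      using asm by unfold_locales (auto simp: bounded_lipschitz_domain_def)
    have g: "gram_const = G (op_norm \<Omega> s \<L>) \<delta> s"
      unfolding gram_const_def G_def opn_def ..
    have u: "upper_const = U (op_norm \<Omega> s \<L>) (inverse_op_norm \<Omega> s \<L>) s"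
      unfolding upper_const_def U_def opn_def inv_opn_def ..
    have C': "C (op_norm \<Omega> s \<L>) (inverse_op_norm \<Omega> s \<L>) h \<delta> s =
        upper_const / ((\<delta> * h) ^ (2 * s) * (gram_const * h ^ (2 * s)))"
      unfolding C_def g u using asm by simp
    have c': "c (op_norm \<Omega> s \<L>) (inverse_op_norm \<Omega> s \<L>) h \<delta> s =
        gram_const * (\<delta> * h\<^sup>2) ^ (2 * s) / upper_const"
      unfolding c_def g u using asm by simp
    show "let \<Theta> = Theta_mat \<Omega> s \<L> N w;
            C' = C (op_norm \<Omega> s \<L>) (inverse_op_norm \<Omega> s \<L>) h \<delta> s;
            c' = c (op_norm \<Omega> s \<L>) (inverse_op_norm \<Omega> s \<L>) h \<delta> s;
            rate = (\<lambda>k :: nat. real k powr (- 2 * real s / real CARD('n)))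
        in (\<forall>k\<in>{1..N}.
              mat_norm2 (\<Theta> - first_cols L k * transpose_mat (first_cols L k))
                \<le> C' * mat_norm2 \<Theta> * rate k) \<and>
           (\<forall>k\<in>{1..<N}. \<forall>M\<in>carrier_mat N N. vec_space.rank N M \<le> k \<longrightarrow>
              c' * mat_norm2 \<Theta> * rate k \<le> mat_norm2 (\<Theta> - M))"
      unfolding Let_def C' c' \<Theta>_def[symmetric] residual_def[symmetric]
      using upper_rate lower_rate by auto
  qed
qed

end
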